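(* Let $G$ be a finitely generated group equipped with the word metric $d$ coming from a fixed finite generating set, let $t\ge 0$ be a real number, and let $n$ be an integer. Suppose that $D_t(S)$ is $(n-|S|-1)$-connected for every non-empty finite subset $S\subseteq G$ with $S\neq\{1\}$, $\mathrm{diam}(S)\le t$, and $\mathrm{len}$ constant on $S$. Then $\mathcal{VR}_t(G)$ is $(n-1)$-connected. Moreover, if $D_t(S)$ is contractible for every such $S$, then $\mathcal{VR}_t(G)$ is contractible.
   Context: The word metric is $d(g,h)=$ the word length of $g^{-1}h$ with respect to the fixed finite generating set. For non-empty finite $S\subseteq G$, $\mathrm{diam}(S)=\max\{d(g,g') : g,g'\in S\}$. Write $\mathrm{len}(g)=d(g,1)$ and $\mathrm{len}_{\min}(S)=\min\{\mathrm{len}(g): g\in S\}$. The geometric realization $|P|$ of a poset $P$ is the simplicial complex with vertex set $P$ and a $k$-simplex for each chain $p_0<\cdots<p_k$. The Vietoris--Rips complex $\mathcal{VR}_t(G)$ is the geometric realization of the poset (under inclusion) of all non-empty finite subsets $S\subseteq G$ with $\mathrm{diam}(S)\le t$ (i.e. the barycentric subdivision of the usual Vietoris--Rips complex). $D_t(S)$ is the geometric realization of the poset (under inclusion) of all finite $S'\subseteq G$ with $S'\supsetneq S$, $\mathrm{diam}(S')\le t$ and $\mathrm{len}_{\min}(S')<\mathrm{len}_{\min}(S)$. A space is $k$-connected (for $k\ge 0$) if it is non-empty and its homotopy groups/sets $\pi_i$ are trivial for $0\le i\le k$; $(-1)$-connected means non-empty; for $k\le -2$ being $k$-connected is no condition.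 *)

theory Defs
  imports "HOL-Analysis.Analysis" "HOL-Algebra.Generated_Groups"
begin

section \<open>Geometric realization of simplicial complexes and posets\<close>

text \<open>A point of the closed simplex spanned by a finite vertex set is given by its barycentric
  coordinates, extended by zero to all of the ambient type.\<close>

definition geom_simplex :: "'v set \<Rightarrow> ('v \<Rightarrow> real) set" where
  "geom_simplex s = {\<alpha>. (\<forall>v. 0 \<le> \<alpha> v) \<and> (\<forall>v. v \<notin> s \<longrightarrow> \<alpha> v = 0) \<and> sum \<alpha> s = 1}"

text \<open>The realization carries the weak topology: a set is open iff its intersection with every
  closed simplex is open there. On a single finite simplex the product topology induces the
  usual Euclidean one.\<close>

definition realization :: "'v set set \<Rightarrow> ('v \<Rightarrow> real) topology" where
  "realization K = topology (\<lambda>U. U \<subseteq> (\<Union>s\<in>K. geom_simplex s) \<and>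
     (\<forall>s\<in>K. openin (subtopology (powertop_real UNIV) (geom_simplex s)) (U \<inter> geom_simplex s)))"

lemma openin_realization:
  "openin (realization K) U \<longleftrightarrow> U \<subseteq> (\<Union>s\<in>K. geom_simplex s) \<and>
     (\<forall>s\<in>K. openin (subtopology (powertop_real UNIV) (geom_simplex s)) (U \<inter> geom_simplex s))"
proof -
  let ?P = "\<lambda>U. U \<subseteq> (\<Union>s\<in>K. geom_simplex s) \<and>
     (\<forall>s\<in>K. openin (subtopology (powertop_real UNIV) (geom_simplex s)) (U \<inter> geom_simplex s))"
  have "istopology ?P"
    unfolding istopology_def
  proof (intro conjI allI impI)
    fix S T assume S: "?P S" and T: "?P T"
    show "S \<inter> T \<subseteq> (\<Union>s\<in>K. geom_simplex s)" using S by blast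
    show "\<forall>s\<in>K. openin (subtopology (powertop_real UNIV) (geom_simplex s)) (S \<inter> T \<inter> geom_simplex s)"
    proof
      fix s assume s: "s \<in> K"
      have "S \<inter> T \<inter> geom_simplex s = (S \<inter> geom_simplex s) \<inter> (T \<inter> geom_simplex s)" by blast
      then show "openin (subtopology (powertop_real UNIV) (geom_simplex s)) (S \<inter> T \<inter> geom_simplex s)"
        using S T s by (simp only:) (blast intro: openin_Int)
    qed
  next
    fix \<K> assume A: "\<forall>U\<in>\<K>. ?P U"
    show "\<Union>\<K> \<subseteq> (\<Union>s\<in>K. geom_simplex s)" using A by blast
    show "\<forall>s\<in>K. openin (subtopology (powertop_real UNIV) (geom_simplex s)) (\<Union>\<K> \<inter> geom_simplex s)"
    proof
      fix s assume s: "s \<in> K"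
      have "\<Union>\<K> \<inter> geom_simplex s = (\<Union>U\<in>\<K>. U \<inter> geom_simplex s)" by blast
      then show "openin (subtopology (powertop_real UNIV) (geom_simplex s)) (\<Union>\<K> \<inter> geom_simplex s)"
        using A s by (simp only:) (blast intro: openin_Union)
    qed
  qed
  then show ?thesis
    unfolding realization_def by (simp add: topology_inverse')
qed

lemma topspace_realization: "topspace (realization K) = (\<Union>s\<in>K. geom_simplex s)"
proof (rule antisym)
  show "topspace (realization K) \<subseteq> (\<Union>s\<in>K. geom_simplex s)"
    using openin_realization openin_topspace by blast
  have "openin (realization K) (\<Union>s\<in>K. geom_simplex s)"
    unfolding openin_realization
  proof (intro conjI ballI)
    fix s assume "s \<in> K"
    then have "(\<Union>s\<in>K. geom_simplex s) \<inter> geom_simplex s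
        = topspace (subtopology (powertop_real UNIV) (geom_simplex s))"
      by auto
    then show "openin (subtopology (powertop_real UNIV) (geom_simplex s))
        ((\<Union>s\<in>K. geom_simplex s) \<inter> geom_simplex s)"
      by (metis openin_topspace)
  qed simp
  then show "(\<Union>s\<in>K. geom_simplex s) \<subseteq> topspace (realization K)"
    by (rule openin_subset)
qed

definition order_complex :: "('p::order) set \<Rightarrow> 'p set set" where
  "order_complex P = {C. C \<subseteq> P \<and> finite C \<and> C \<noteq> {} \<and> Complete_Partial_Order.chain (\<le>) C}"

definition poset_realization :: "('p::order) set \<Rightarrow> ('p \<Rightarrow> real) topology" where
  "poset_realization P = realization (order_complex P)"


section \<open>Connectivity\<close>

definition sphere_base :: "nat \<Rightarrow> real" where
  "sphere_base = (\<lambda>i. if i = 0 then 1 else 0)"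

lemma sphere_base_in_nsphere: "sphere_base \<in> topspace (nsphere n)"
proof -
  have "(\<Sum>i\<le>n. sphere_base i ^ 2) = (\<Sum>i\<le>n. if i = 0 then 1 else 0)"
    by (rule sum.cong) (auto simp: sphere_base_def)
  then show ?thesis
    by (simp add: nsphere topspace_Euclidean_space sphere_base_def)
qed

text \<open>The underlying set of \<open>\<pi>\<^sub>i(X, x)\<close>: based maps from the \<open>i\<close>-sphere modulo based
  homotopy. For \<open>i = 0\<close> the sphere has two points, one of them the base point, so that this is
  the set of path components.\<close>

definition homotopy_set :: "nat \<Rightarrow> 'a topology \<Rightarrow> 'a \<Rightarrow> ((nat \<Rightarrow> real) \<Rightarrow> 'a) set set" where
  "homotopy_set i X x =
     {f. continuous_map (nsphere i) X f \<and> f sphere_base = x} //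
     {(f, g). homotopic_with (\<lambda>h. h sphere_base = x) (nsphere i) X f g}"

definition k_connected :: "int \<Rightarrow> 'a topology \<Rightarrow> bool" where
  "k_connected k X \<longleftrightarrow>
     (k \<ge> -1 \<longrightarrow> topspace X \<noteq> {}) \<and>
     (\<forall>i::nat. int i \<le> k \<longrightarrow> (\<forall>x\<in>topspace X. is_singleton (homotopy_set i X x)))"

text \<open>The library predicate \<^const>\<open>contractible_space\<close> holds for the empty space.\<close>

definition contractible_nonempty :: "'a topology \<Rightarrow> bool" where
  "contractible_nonempty X \<longleftrightarrow> topspace X \<noteq> {} \<and> contractible_space X"


section \<open>Word metric, Vietoris--Rips complex and descending complexes\<close>

context
  fixes G :: "('a, 'b) monoid_scheme" (structure) and A :: "'a set"
begin

definition word_length :: "'a \<Rightarrow> nat" where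
  "word_length g = (LEAST k. \<exists>ws. length ws = k \<and> set ws \<subseteq> A \<union> m_inv G ` A \<and> foldr (\<otimes>) ws \<one> = g)"

definition word_dist :: "'a \<Rightarrow> 'a \<Rightarrow> nat" where
  "word_dist g h = word_length (inv g \<otimes> h)"

definition word_diam :: "'a set \<Rightarrow> nat" where
  "word_diam S = Max {word_dist g g' | g g'. g \<in> S \<and> g' \<in> S}"

definition len :: "'a \<Rightarrow> nat" where
  "len g = word_dist g \<one>"

definition len_min :: "'a set \<Rightarrow> nat" where
  "len_min S = Min (len ` S)"

definition VR_poset :: "real \<Rightarrow> 'a set set" where
  "VR_poset t = {S. S \<subseteq> carrier G \<and> finite S \<and> S \<noteq> {} \<and> real (word_diam S) \<le> t}"

definition VR :: "real \<Rightarrow> ('a set \<Rightarrow> real) topology" where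
  "VR t = poset_realization (VR_poset t)"

definition D_poset :: "real \<Rightarrow> 'a set \<Rightarrow> 'a set set" where
  "D_poset t S = {S'. S' \<subseteq> carrier G \<and> finite S' \<and> S \<subset> S' \<and> real (word_diam S') \<le> t \<and>
     len_min S' < len_min S}"

definition D_complex :: "real \<Rightarrow> 'a set \<Rightarrow> ('a set \<Rightarrow> real) topology" where
  "D_complex t S = poset_realization (D_poset t S)"

end

end

(* The vertices S of VR are added one at a time, in the order of the Morse function
   S |-> (len_min S, card S), starting from {1}; since balls are finite, only finitely many vertices lie
   below a given level. Adding S attaches a cone over the descending link, which is the order complex of
   {R. R < S, len_min R = len_min S} below S, joined with D_t(S) above S. If len is not constant on S, this
   link is contractible; otherwise it is the join of the boundary of a simplex of dimension |S| - 1 with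
   D_t(S), hence (n - 2)-connected. So every stage is (n - 1)-connected.

   Attaching a cone is controlled by a gluing theorem for two open sets, proved by contracting maps of
   spheres cell by cell over a fine cubical grid; the join is handled by the same gluing theorem. In the
   second part VR is weakly contractible, and a simplex-by-simplex null homotopy of the identity (Whitehead)
   makes it contractible. *)

theory Submission imports Defs begin

section \<open>Maps of spheres and their extension to cubes\<close>

text \<open>Spheres are replaced by boundaries of cubes in the single type
  \<open>nat \<Rightarrow> real\<close>, so that the dimension can vary inside one statement: a
  prism over a cube is again a cube, and every null homotopy is assembled from fillings of prisms.
  The integer index of \<open>conn_upto\<close> lets the drop by one in each link run into negative
  values without case distinctions. The gluing is done in finite posets, where a realization is a
  plain subspace of a product of lines and all retractions are explicit rescalings and straight
  segments; the weak topology returns only when the finite stages are put together. The count behind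
  the hypothesis: the boundary of the simplex on S is a sphere of dimension |S| - 2, and joining
  with it raises connectivity by |S| - 1, from n - |S| - 1 to n - 2. The vertex {1} is exempt
  because its minimal length is 0 and cannot drop, so its D_t is empty.\<close>

definition cube :: "nat \<Rightarrow> (nat \<Rightarrow> real) set" where
  "cube j = {x. (\<forall>i<j. \<bar>x i\<bar> \<le> 1) \<and> (\<forall>i\<ge>j. x i = 0)}"

definition cube_bd :: "nat \<Rightarrow> (nat \<Rightarrow> real) set" where
  "cube_bd j = {x \<in> cube j. \<exists>i<j. \<bar>x i\<bar> = 1}"

text \<open>\<open>cube_bd j\<close> is a sphere of dimension \<open>j - 1\<close>. It is empty for \<open>j = 0\<close>, so that
  \<open>sphere_null 0\<close> means non-empty, and \<open>conn_upto m\<close> means \<open>(m - 1)\<close>-connected.\<close>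

definition sphere_null :: "nat \<Rightarrow> 'b topology \<Rightarrow> bool" where
  "sphere_null j X \<longleftrightarrow> (\<forall>f. continuous_map (top_of_set (cube_bd j)) X f \<longrightarrow>
     (\<exists>a\<in>topspace X. homotopic_with (\<lambda>_. True) (top_of_set (cube_bd j)) X f (\<lambda>_. a)))"

definition conn_upto :: "int \<Rightarrow> 'b topology \<Rightarrow> bool" where
  "conn_upto m X \<longleftrightarrow> (\<forall>j. int j \<le> m \<longrightarrow> sphere_null j X)"

lemma cube_bd_subset: "cube_bd j \<subseteq> cube j"
  by (auto simp: cube_bd_def)

lemma compact_cube: "compact (cube j)"
proof -
  have eq: "cube j = Pi\<^sub>E UNIV (\<lambda>i. if i < j then {-1..1} else {0})"
  proof (rule antisym; rule subsetI)
    fix x assume x: "x \<in> cube j"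
    show "x \<in> Pi\<^sub>E UNIV (\<lambda>i. if i < j then {-1..1} else {0})"
    proof
      fix i show "x i \<in> (if i < j then {-1..1} else {0})"
        using x by (cases "i < j") (auto simp: cube_def abs_le_iff)
    qed auto
  next
    fix x :: "nat \<Rightarrow> real" assume x: "x \<in> Pi\<^sub>E UNIV (\<lambda>i. if i < j then {-1..1} else {0})"
    have "x i \<in> (if i < j then {-1..1} else {0})" for i
      using PiE_mem[OF x, of i] by simp
    then show "x \<in> cube j"
      unfolding cube_def by (smt (verit) atLeastAtMost_iff mem_Collect_eq not_le singletonD)
  qed
  have "compactin (product_topology (\<lambda>i. euclidean::real topology) UNIV) (cube j)"
    unfolding eq by (subst compactin_PiE) auto
  then show ?thesis by (simp add: euclidean_product_topology)
qed

lemma closed_cube_bd: "closed (cube_bd j)"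
proof -
  have "cube_bd j = cube j \<inter> (\<Union>i<j. {x. \<bar>x i\<bar> = 1})"
    by (auto simp: cube_bd_def)
  moreover have "closed (cube j)" using compact_cube compact_imp_closed by blast
  moreover have "closed {x::nat\<Rightarrow>real. \<bar>x i\<bar> = 1}" for i
    by (intro closed_Collect_eq continuous_intros) auto
  ultimately show ?thesis by (auto intro!: closed_Int closed_UN)
qed

lemma compact_cube_bd: "compact (cube_bd j)"
  using compact_cube closed_cube_bd cube_bd_subset by (metis compact_Int_closed inf.absorb2)

lemma cube_bd_0: "cube_bd 0 = {}"
  by (auto simp: cube_bd_def)

lemma cube_scale: "x \<in> cube j \<Longrightarrow> 0 \<le> s \<Longrightarrow> s \<le> 1 \<Longrightarrow> (\<lambda>i. s * x i) \<in> cube j"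
  by (auto simp: cube_def abs_mult intro: mult_le_one)

lemma continuous_on_Max_coord:
  fixes I :: "'i set"
  assumes "finite I" "I \<noteq> {}" "\<And>i. i \<in> I \<Longrightarrow> continuous_on A (\<lambda>x. f x i :: real)"
  shows "continuous_on A (\<lambda>x. Max (f x ` I))"
  using assms
proof (induction rule: finite_ne_induct)
  case (insert i F)
  have "continuous_on A (\<lambda>x. max (f x i) (Max (f x ` F)))"
    using insert by (intro continuous_on_max) auto
  then show ?case using insert by simp
qed auto

section \<open>The cube as the cone over its boundary\<close>

lemma continuous_cube_cone:
  "continuous_map (prod_topology (top_of_set {0..1}) (top_of_set (cube_bd j))) (top_of_set (cube j))
     (\<lambda>(t::real, u). (\<lambda>i. (1 - t) * u i))"
proof -
  have "continuous_on ({0..1} \<times> cube_bd j) (\<lambda>(t::real, u). (\<lambda>i. (1 - t) * u i))"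
    unfolding case_prod_beta
    by (intro continuous_intros continuous_on_product_then_coordinatewise)
  then show ?thesis
    using cube_bd_subset[of j] by (auto intro!: cube_scale)
qed

text \<open>Dividing x by its largest absolute coordinate writes it as 1 - t times a boundary point,
  so the cone map is onto, and a continuous map from a compact space onto a Hausdorff space is a
  quotient map. For j = 0 the boundary is empty while the cube is a point, whence j > 0.\<close>

lemma cube_cone_quotient:
  assumes "j > 0"
  shows "quotient_map (prod_topology (top_of_set {0..1}) (top_of_set (cube_bd j))) (top_of_set (cube j))
          (\<lambda>(t, u). (\<lambda>i. (1 - t) * u i))"
proof (rule continuous_imp_quotient_map[OF continuous_cube_cone])
  show "compact_space (prod_topology (top_of_set {0..1::real}) (top_of_set (cube_bd j)))"
    by (simp add: compact_space_subtopology compact_cube_bd compact_Times)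
  show "Hausdorff_space (top_of_set (cube j))"
    by (simp add: Hausdorff_space_subtopology)
  have "\<exists>t\<in>{0..1}. \<exists>u\<in>cube_bd j. x = (\<lambda>i. (1 - t) * u i)" if x: "x \<in> cube j" for x
  proof -
    define M where "M = Max ((\<lambda>i. \<bar>x i\<bar>) ` {..<j})"
    have M: "\<bar>x i\<bar> \<le> M" if "i < j" for i
      unfolding M_def using that by (intro Max_ge) auto
    have "M \<in> (\<lambda>i. \<bar>x i\<bar>) ` {..<j}"
      unfolding M_def using assms by (intro Max_in) auto
    then obtain k where k: "k < j" "M = \<bar>x k\<bar>" by auto
    have M01: "0 \<le> M" "M \<le> 1" using k x by (auto simp: cube_def)
    show ?thesis
    proof (cases "M = 0")
      case True
      then have "x i = 0" for i using M[of i] x by (cases "i < j") (auto simp: cube_def)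
      \<comment> \<open>The origin is the cone point: with t = 1 any boundary point serves, here the
        corner with all coordinates 1.\<close>
      moreover have "(\<lambda>i. if i < j then 1 else 0) \<in> cube_bd j"
        using assms by (auto simp: cube_bd_def cube_def)
      ultimately show ?thesis by (intro bexI[of _ 1] bexI[of _ "\<lambda>i. if i < j then 1 else 0"]) auto
    next
      case False
      have "(\<lambda>i. x i / M) \<in> cube_bd j"
        using x k M M01 False by (auto simp: cube_bd_def cube_def)
      then show ?thesis using M01 False
        by (intro bexI[of _ "1 - M"] bexI[of _ "\<lambda>i. x i / M"]) auto
    qed
  qed
  then show "(\<lambda>(t::real, u). (\<lambda>i. (1 - t) * u i)) ` topspace (prod_topology (top_of_set {0..1}) (top_of_set (cube_bd j)))
     = topspace (top_of_set (cube j))"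
    using cube_bd_subset[of j] by (fastforce intro!: cube_scale)
qed

text \<open>The null homotopy is constant on the end t = 1, which is all that the cone map
  collapses, so it factors through the quotient onto the cube. Together with
  \<open>sphere_nullI\<close> this makes null homotopies on the boundary and fillings of the cube
  interchangeable.\<close>

lemma sphere_null_extend:
  assumes X: "sphere_null j X" and f: "continuous_map (top_of_set (cube_bd j)) X f"
  obtains F where "continuous_map (top_of_set (cube j)) X F" "\<And>x. x \<in> cube_bd j \<Longrightarrow> F x = f x"
proof -
  obtain a where a: "a \<in> topspace X" and h: "homotopic_with (\<lambda>_. True) (top_of_set (cube_bd j)) X f (\<lambda>_. a)"
    using X f by (auto simp: sphere_null_def)
  show thesis
  proof (cases "j = 0")
    case True
    \<comment> \<open>The cube of dimension 0 is one point with empty boundary; the point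
      \<open>a\<close> provides the filling.\<close>
    show thesis
      by (rule that[of "\<lambda>_. a"]) (use a True in \<open>auto simp: cube_bd_0\<close>)
  next
    case False
    obtain h where h: "continuous_map (prod_topology (top_of_set {0..1::real}) (top_of_set (cube_bd j))) X h"
      "\<And>x. h (0, x) = f x" "\<And>x. h (1, x) = a"
      using h unfolding homotopic_with_def by blast
    have fib: "h p = h q" if p: "p \<in> topspace (prod_topology (top_of_set {0..1}) (top_of_set (cube_bd j)))"
      and q: "q \<in> topspace (prod_topology (top_of_set {0..1}) (top_of_set (cube_bd j)))"
      and eq: "(\<lambda>(t, u). (\<lambda>i. (1 - t) * u i)) p = (\<lambda>(t, u). (\<lambda>i. (1 - t) * u i)) q" for p q
    proof -
      obtain t u s v where [simp]: "p = (t, u)" "q = (s, v)" by (cases p, cases q) auto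
      have tu: "0 \<le> t" "t \<le> 1" "u \<in> cube_bd j" "0 \<le> s" "s \<le> 1" "v \<in> cube_bd j" using p q by auto
      have e: "(1 - t) * u i = (1 - s) * v i" for i using eq by (auto dest: fun_cong)
      obtain k where k: "k < j" "\<bar>u k\<bar> = 1" using tu by (auto simp: cube_bd_def)
      obtain l where l: "l < j" "\<bar>v l\<bar> = 1" using tu by (auto simp: cube_bd_def)
      have le: "\<bar>u i\<bar> \<le> 1" "\<bar>v i\<bar> \<le> 1" if "i < j" for i using tu that by (auto simp: cube_bd_def cube_def)
      have a: "(1 - t) * \<bar>u i\<bar> = (1 - s) * \<bar>v i\<bar>" for i
        using e[of i] tu by (metis abs_mult abs_of_nonneg diff_ge_0_iff_ge)
      \<comment> \<open>At a coordinate with |u k| = 1 the equality reads 1 - t = (1 - s) * |v k|,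
        which is at most 1 - s; with the symmetric estimate at l, the cone parameter is determined
        by the point.\<close>
      have "1 - t \<le> 1 - s" using a[of k] k le(2)[of k] tu
        by (metis diff_ge_0_iff_ge mult.right_neutral mult_left_mono)
      moreover have "1 - s \<le> 1 - t" using a[of l] l le(1)[of l] tu
        by (metis diff_ge_0_iff_ge mult.right_neutral mult_left_mono)
      ultimately have st: "s = t" by simp
      show ?thesis
      proof (cases "t = 1")
        case True then show ?thesis using h st by simp
      next
        case False
        then have "u = v" using e st by (auto simp: fun_eq_iff)
        then show ?thesis using st by simp
      qed
    qed
    have jpos: "j > 0" using False by simp
    show thesis
    proof (rule quotient_map_lift_exists[OF cube_cone_quotient[OF jpos] h(1) fib])
      fix g assume g: "continuous_map (top_of_set (cube j)) X g"
        and gh: "\<And>p. p \<in> topspace (prod_topology (top_of_set {0..1}) (top_of_set (cube_bd j))) \<Longrightarrow>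
          g ((\<lambda>(t, u). (\<lambda>i. (1 - t) * u i)) p) = h p"
      show thesis
      proof (rule that[OF g])
        fix x assume "x \<in> cube_bd j"
        then show "g x = f x" using gh[of "(0, x)"] h by auto
      qed
    qed
  qed
qed

text \<open>Shrinking the boundary radially to the origin inside the cube and then applying the
  filling F is a null homotopy, ending at the value of F in the origin.\<close>

lemma sphere_nullI:
  assumes "\<And>f. continuous_map (top_of_set (cube_bd j)) X f \<Longrightarrow>
     \<exists>F. continuous_map (top_of_set (cube j)) X F \<and> (\<forall>x\<in>cube_bd j. F x = f x)"
  shows "sphere_null j X"
  unfolding sphere_null_def
proof (intro allI impI)
  fix f assume f: "continuous_map (top_of_set (cube_bd j)) X f"
  obtain F where F: "continuous_map (top_of_set (cube j)) X F" "\<And>x. x \<in> cube_bd j \<Longrightarrow> F x = f x"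
    using assms[OF f] by auto
  have 0: "(\<lambda>i. 0) \<in> cube j" by (auto simp: cube_def)
  have "homotopic_with (\<lambda>_. True) (top_of_set (cube_bd j)) X f (\<lambda>_. F (\<lambda>i. 0))"
    by (subst homotopic_with, simp)
      (intro exI[of _ "F \<circ> (\<lambda>(t::real, u). (\<lambda>i. (1 - t) * u i))"] conjI continuous_map_compose[OF continuous_cube_cone F(1)],
       auto simp: F(2))
  moreover have "F (\<lambda>i. 0) \<in> topspace X"
    using F(1) 0 by (force simp: continuous_map_def)
  ultimately show "\<exists>a\<in>topspace X. homotopic_with (\<lambda>_. True) (top_of_set (cube_bd j)) X f (\<lambda>_. a)" by blast
qed

lemma sphere_null_0: "sphere_null 0 X \<longleftrightarrow> topspace X \<noteq> {}"
proof
  assume "sphere_null 0 X"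
  moreover have "continuous_map (top_of_set (cube_bd 0)) X (\<lambda>_. undefined)"
    by (simp add: cube_bd_0)
  ultimately show "topspace X \<noteq> {}" unfolding sphere_null_def by blast
next
  assume "topspace X \<noteq> {}"
  then obtain a where "a \<in> topspace X" by blast
  then show "sphere_null 0 X"
    by (intro sphere_nullI exI[of _ "\<lambda>_. a"]) (auto simp: cube_bd_0)
qed

text \<open>f is homotopic to i o r o f, and r o f is null homotopic in Y. Every deformation of a
  space onto a smaller one is used in this one-sided form.\<close>

lemma sphere_null_dominated:
  assumes Y: "sphere_null j Y" and r: "continuous_map X Y r" and i: "continuous_map Y X i"
    and h: "homotopic_with (\<lambda>_. True) X X (i \<circ> r) id"
  shows "sphere_null j X"
  unfolding sphere_null_def
proof (intro allI impI)
  fix f assume f: "continuous_map (top_of_set (cube_bd j)) X f"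
  have "continuous_map (top_of_set (cube_bd j)) Y (r \<circ> f)"
    using f r continuous_map_compose by blast
  then obtain a where a: "a \<in> topspace Y" and ha: "homotopic_with (\<lambda>_. True) (top_of_set (cube_bd j)) Y (r \<circ> f) (\<lambda>_. a)"
    using Y by (auto simp: sphere_null_def)
  have "homotopic_with (\<lambda>_. True) (top_of_set (cube_bd j)) X (i \<circ> (r \<circ> f)) (i \<circ> (\<lambda>_. a))"
    by (rule homotopic_with_compose_continuous_map_left[OF ha i]) auto
  moreover have "homotopic_with (\<lambda>_. True) (top_of_set (cube_bd j)) X ((i \<circ> r) \<circ> f) (id \<circ> f)"
    by (rule homotopic_with_compose_continuous_map_right[OF h f]) auto
  ultimately have "homotopic_with (\<lambda>_. True) (top_of_set (cube_bd j)) X f (\<lambda>_. i a)"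
    by (simp add: o_def) (meson homotopic_with_symD homotopic_with_trans)
  moreover have "i a \<in> topspace X" using i a by (force simp: continuous_map_def)
  ultimately show "\<exists>a\<in>topspace X. homotopic_with (\<lambda>_. True) (top_of_set (cube_bd j)) X f (\<lambda>_. a)" by blast
qed

lemma sphere_null_contractible:
  assumes "contractible_nonempty X"
  shows "sphere_null j X"
  unfolding sphere_null_def
proof (intro allI impI)
  fix f assume f: "continuous_map (top_of_set (cube_bd j)) X f"
  obtain a where a: "a \<in> topspace X" and "homotopic_with (\<lambda>_. True) X X id (\<lambda>_. a)"
    using assms unfolding contractible_nonempty_def contractible_space by fastforce
  then have "homotopic_with (\<lambda>_. True) (top_of_set (cube_bd j)) X (id \<circ> f) ((\<lambda>_. a) \<circ> f)"
    by (intro homotopic_with_compose_continuous_map_right[OF _ f]) auto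
  then show "\<exists>a\<in>topspace X. homotopic_with (\<lambda>_. True) (top_of_set (cube_bd j)) X f (\<lambda>_. a)"
    using a by (auto simp: o_def)
qed

section \<open>Connectivity in terms of cubes\<close>

lemma nsphere_top_of_set:
  "nsphere i = top_of_set {x. (\<Sum>l\<le>i. (x l)\<^sup>2) = 1 \<and> (\<forall>k>i. x k = 0)}"
  by (simp add: nsphere euclidean_product_topology)

definition to_sphere :: "nat \<Rightarrow> (nat \<Rightarrow> real) \<Rightarrow> nat \<Rightarrow> real" where
  "to_sphere i x = (\<lambda>k. x k / sqrt (\<Sum>l\<le>i. (x l)\<^sup>2))"

definition to_cube_bd :: "nat \<Rightarrow> (nat \<Rightarrow> real) \<Rightarrow> nat \<Rightarrow> real" where
  "to_cube_bd i x = (\<lambda>k. x k / Max ((\<lambda>l. \<bar>x l\<bar>) ` {..i}))"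

lemma Max_abs_le: "l \<le> i \<Longrightarrow> \<bar>x l\<bar> \<le> Max ((\<lambda>l. \<bar>x l\<bar> :: real) ` {..i::nat})"
  by (intro Max_ge) auto

lemma Max_abs_attained: "\<exists>l\<le>i. Max ((\<lambda>l. \<bar>x l\<bar> :: real) ` {..i::nat}) = \<bar>x l\<bar>"
proof -
  have "Max ((\<lambda>l. \<bar>x l\<bar>) ` {..i}) \<in> (\<lambda>l. \<bar>x l\<bar>) ` {..i}"
    by (intro Max_in) auto
  then show ?thesis unfolding image_iff by (metis atMost_iff)
qed

lemma cube_bd_SucD:
  assumes "x \<in> cube_bd (Suc i)"
  shows "Max ((\<lambda>l. \<bar>x l\<bar>) ` {..i}) = 1" "(\<Sum>l\<le>i. (x l)\<^sup>2) > 0" "\<forall>k>i. x k = 0"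
proof -
  obtain k where k: "k \<le> i" "\<bar>x k\<bar> = 1" using assms by (auto simp: cube_bd_def less_Suc_eq_le)
  have le: "\<bar>x l\<bar> \<le> 1" if "l \<le> i" for l using assms that by (auto simp: cube_bd_def cube_def)
  show "Max ((\<lambda>l. \<bar>x l\<bar>) ` {..i}) = 1"
    by (rule Max_eqI) (use k le in \<open>auto intro: image_eqI[of _ _ k]\<close>)
  have "(x k)\<^sup>2 > 0" using k by auto
  then show "(\<Sum>l\<le>i. (x l)\<^sup>2) > 0" using k by (intro sum_pos2[of _ k]) auto
  show "\<forall>k>i. x k = 0" using assms by (auto simp: cube_bd_def cube_def)
qed

lemma sphere_Max_pos:
  assumes "(\<Sum>l\<le>i. (x l)\<^sup>2) = (1::real)"
  shows "Max ((\<lambda>l. \<bar>x l\<bar>) ` {..i::nat}) > 0"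
proof (rule ccontr)
  assume "\<not> ?thesis"
  then have "x l = 0" if "l \<le> i" for l using Max_abs_le[OF that, of x] by linarith
  then show False using assms by simp
qed

lemma continuous_to_sphere: "continuous_map (top_of_set (cube_bd (Suc i))) (nsphere i) (to_sphere i)"
proof -
  have "continuous_on (cube_bd (Suc i)) (to_sphere i)"
    unfolding to_sphere_def
  proof (rule continuous_on_coordinatewise_then_product)
    fix k
    have c: "continuous_on (cube_bd (Suc i)) (\<lambda>x. x l)" for l
      by (rule continuous_on_product_then_coordinatewise) (rule continuous_on_id)
    have "sqrt (\<Sum>l\<le>i. (x l)\<^sup>2) \<noteq> 0" if "x \<in> cube_bd (Suc i)" for x
      using cube_bd_SucD(2)[OF that] by simp
    then show "continuous_on (cube_bd (Suc i)) (\<lambda>x. x k / sqrt (\<Sum>l\<le>i. (x l)\<^sup>2))"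
      by (intro continuous_on_divide continuous_on_real_sqrt continuous_on_sum continuous_on_power c) auto
  qed
  moreover have "(\<Sum>l\<le>i. (to_sphere i x l)\<^sup>2) = 1" if "x \<in> cube_bd (Suc i)" for x
  proof -
    have "(\<Sum>l\<le>i. (to_sphere i x l)\<^sup>2) = (\<Sum>l\<le>i. (x l)\<^sup>2 / (\<Sum>l\<le>i. (x l)\<^sup>2))"
      unfolding to_sphere_def power_divide using cube_bd_SucD(2)[OF that] by simp
    also have "\<dots> = 1" using cube_bd_SucD(2)[OF that] by (simp flip: sum_divide_distrib)
    finally show ?thesis .
  qed
  ultimately show ?thesis
    using cube_bd_SucD(3) by (auto simp: nsphere_top_of_set to_sphere_def)
qed

lemma continuous_to_cube_bd: "continuous_map (nsphere i) (top_of_set (cube_bd (Suc i))) (to_cube_bd i)"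
proof -
  let ?S = "{x. (\<Sum>l\<le>i. (x l)\<^sup>2) = (1::real) \<and> (\<forall>k>i. x k = 0)}"
  have "continuous_on ?S (to_cube_bd i)"
    unfolding to_cube_bd_def
  proof (rule continuous_on_coordinatewise_then_product)
    fix k
    have c: "continuous_on ?S (\<lambda>x. x l)" for l
      by (rule continuous_on_product_then_coordinatewise) (rule continuous_on_id)
    have "Max ((\<lambda>l. \<bar>x l\<bar>) ` {..i}) \<noteq> 0" if "x \<in> ?S" for x
      using sphere_Max_pos[where x=x and i=i] that by auto
    then show "continuous_on ?S (\<lambda>x. x k / Max ((\<lambda>l. \<bar>x l\<bar>) ` {..i}))"
      by (intro continuous_on_divide c ballI continuous_on_Max_coord continuous_on_rabs) auto
  qed
  moreover have "to_cube_bd i x \<in> cube_bd (Suc i)" if x: "x \<in> ?S" for x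
  proof -
    have M: "Max ((\<lambda>l. \<bar>x l\<bar>) ` {..i}) > 0" using sphere_Max_pos[where x=x and i=i] x by auto
    obtain l where l: "l \<le> i" "Max ((\<lambda>l. \<bar>x l\<bar>) ` {..i}) = \<bar>x l\<bar>" using Max_abs_attained by blast
    show ?thesis
      using M l x Max_abs_le[where x=x and i=i]
      by (auto simp: cube_bd_def cube_def to_cube_bd_def less_Suc_eq_le)
  qed
  ultimately show ?thesis
    by (auto simp: nsphere_top_of_set)
qed

lemma to_cube_bd_to_sphere:
  assumes "x \<in> cube_bd (Suc i)"
  shows "to_cube_bd i (to_sphere i x) = x"
proof -
  define s where "s = sqrt (\<Sum>l\<le>i. (x l)\<^sup>2)"
  have s: "s > 0" using cube_bd_SucD(2)[OF assms] by (simp add: s_def)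
  obtain l where l: "l \<le> i" "Max ((\<lambda>l. \<bar>x l\<bar>) ` {..i}) = \<bar>x l\<bar>" using Max_abs_attained by blast
  have "Max ((\<lambda>l. \<bar>x l / s\<bar>) ` {..i}) = 1 / s"
    by (rule Max_eqI)
      (use s l cube_bd_SucD(1)[OF assms] Max_abs_le[where x=x and i=i] in
        \<open>auto simp: abs_divide divide_right_mono intro!: image_eqI[of _ _ l]\<close>)
  then show ?thesis using s by (simp add: to_cube_bd_def to_sphere_def flip: s_def)
qed

lemma to_sphere_to_cube_bd:
  assumes "x \<in> topspace (nsphere i)"
  shows "to_sphere i (to_cube_bd i x) = x"
proof -
  have x: "(\<Sum>l\<le>i. (x l)\<^sup>2) = 1" using assms by (simp add: nsphere_top_of_set)
  define M where "M = Max ((\<lambda>l. \<bar>x l\<bar>) ` {..i})"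
  have M: "M > 0" using sphere_Max_pos[OF x] by (simp add: M_def)
  have "(\<Sum>l\<le>i. (x l / M)\<^sup>2) = 1 / M\<^sup>2" using x by (simp add: power_divide flip: sum_divide_distrib)
  then have "sqrt (\<Sum>l\<le>i. (x l / M)\<^sup>2) = 1 / M" using M by (simp add: real_sqrt_divide)
  then show ?thesis using M by (simp add: to_cube_bd_def to_sphere_def flip: M_def)
qed

lemma sphere_base_cube_bd: "sphere_base \<in> cube_bd (Suc i)"
  by (auto simp: sphere_base_def cube_bd_def cube_def)

lemma sphere_base_fixed: "to_cube_bd i sphere_base = sphere_base" "to_sphere i sphere_base = sphere_base"
proof -
  show "to_cube_bd i sphere_base = sphere_base"
    using cube_bd_SucD(1)[OF sphere_base_cube_bd[of i]] by (simp add: to_cube_bd_def)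
  then show "to_sphere i sphere_base = sphere_base"
    using to_sphere_to_cube_bd[OF sphere_base_in_nsphere, of i] by simp
qed

text \<open>The radial projections fix the base point (1, 0, ...), so a map on the cube boundary
  becomes a based map of the round sphere and back. As the homotopy set has one element, the class
  of this map is that of the constant map; the resulting homotopy is based, and the condition on the
  base point is then dropped.\<close>

lemma homotopy_set_singleton_imp_sphere_null:
  assumes sing: "\<And>x. x \<in> topspace X \<Longrightarrow> is_singleton (homotopy_set i X x)"
  shows "sphere_null (Suc i) X"
  unfolding sphere_null_def
proof (intro allI impI)
  fix f assume f: "continuous_map (top_of_set (cube_bd (Suc i))) X f"
  define x where "x = f sphere_base"
  have x: "x \<in> topspace X" using f sphere_base_cube_bd[of i] by (auto simp: continuous_map_def x_def)
  define g where "g = f \<circ> to_cube_bd i"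
  have g: "continuous_map (nsphere i) X g" unfolding g_def
    using continuous_map_compose[OF continuous_to_cube_bd f] .
  define r where "r = {(f, g). homotopic_with (\<lambda>h. h sphere_base = x) (nsphere i) X f g}"
  have "g sphere_base = x" by (simp add: g_def sphere_base_fixed x_def)
  have mem: "r `` {h} \<in> homotopy_set i X x" if "continuous_map (nsphere i) X h" "h sphere_base = x" for h
    unfolding homotopy_set_def r_def[symmetric] by (rule quotientI) (use that in simp)
  have "r `` {g} \<in> homotopy_set i X x" "r `` {\<lambda>_. x} \<in> homotopy_set i X x"
    using mem[OF g \<open>g sphere_base = x\<close>] mem[of "\<lambda>_. x"] x by auto
  then have "r `` {g} = r `` {\<lambda>_. x}"
    using sing[OF x] by (metis is_singletonE singletonD)
  moreover have "(\<lambda>_. x) \<in> r `` {\<lambda>_. x}" using x by (simp add: r_def)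
  ultimately have "homotopic_with (\<lambda>h. h sphere_base = x) (nsphere i) X g (\<lambda>_. x)"
    by (auto simp: r_def)
  then have "homotopic_with (\<lambda>_. True) (nsphere i) X g (\<lambda>_. x)"
    by (rule homotopic_with_mono) simp
  then have "homotopic_with (\<lambda>_. True) (top_of_set (cube_bd (Suc i))) X (g \<circ> to_sphere i) ((\<lambda>_. x) \<circ> to_sphere i)"
    by (rule homotopic_with_compose_continuous_map_right[OF _ continuous_to_sphere]) simp
  then have "homotopic_with (\<lambda>_. True) (top_of_set (cube_bd (Suc i))) X f (\<lambda>_. x)"
    by (rule homotopic_with_eq) (auto simp: g_def to_cube_bd_to_sphere)
  then show "\<exists>a\<in>topspace X. homotopic_with (\<lambda>_. True) (top_of_set (cube_bd (Suc i))) X f (\<lambda>_. a)"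
    using x by blast
qed

text \<open>A free null homotopy may drag the base point along a loop. Instead f is filled over the
  convex cube, the boundary is contracted to the base point along straight segments in the cube, and
  the filling is applied; the base point, being the end of all segments, never moves.\<close>

lemma sphere_null_imp_based_null_homotopic:
  assumes X: "sphere_null (Suc i) X" and f: "continuous_map (nsphere i) X f"
  shows "homotopic_with (\<lambda>h. h sphere_base = f sphere_base) (nsphere i) X f (\<lambda>_. f sphere_base)"
proof -
  have "continuous_map (top_of_set (cube_bd (Suc i))) X (f \<circ> to_sphere i)"
    using continuous_map_compose[OF continuous_to_sphere f] .
  then obtain F where F: "continuous_map (top_of_set (cube (Suc i))) X F"
    and Ff: "\<And>x. x \<in> cube_bd (Suc i) \<Longrightarrow> F x = (f \<circ> to_sphere i) x"
    by (rule sphere_null_extend[OF X]) (rule that, assumption, simp only:)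
  define k where "k = (\<lambda>(t::real, y). (\<lambda>l. (1 - t) * to_cube_bd i y l + t * sphere_base l))"
  let ?S = "{x. (\<Sum>l\<le>i. (x l)\<^sup>2) = (1::real) \<and> (\<forall>k>i. x k = 0)}"
  have cb: "continuous_on ?S (to_cube_bd i)" "\<And>y. y \<in> ?S \<Longrightarrow> to_cube_bd i y \<in> cube_bd (Suc i)"
    using continuous_to_cube_bd[of i] by (auto simp: nsphere_top_of_set)
  have "continuous_on ({0..1} \<times> ?S) k"
    unfolding k_def case_prod_beta
  proof (rule continuous_on_coordinatewise_then_product)
    fix l
    have "continuous_on ({0..1::real} \<times> ?S) (\<lambda>p. to_cube_bd i (snd p) l)"
      by (rule continuous_on_product_then_coordinatewise, rule continuous_on_compose2[OF cb(1)])
        (auto intro: continuous_on_snd continuous_on_id)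
    then show "continuous_on ({0..1} \<times> ?S) (\<lambda>p. (1 - fst p) * to_cube_bd i (snd p) l + fst p * sphere_base l)"
      by (intro continuous_intros)
  qed
  moreover have "k (t, y) \<in> cube (Suc i)" if "t \<in> {0..1}" "y \<in> ?S" for t y
  proof -
    have y: "to_cube_bd i y \<in> cube (Suc i)" using cb(2)[OF that(2)] cube_bd_subset by blast
    have b: "sphere_base \<in> cube (Suc i)" using sphere_base_cube_bd cube_bd_subset by blast
    show ?thesis
      unfolding cube_def k_def
    proof (clarsimp, intro conjI allI impI)
      fix l assume l: "l < Suc i"
      have 1: "\<bar>to_cube_bd i y l\<bar> \<le> 1" "\<bar>sphere_base l\<bar> \<le> 1" using y b l by (auto simp: cube_def)
      have "\<bar>(1 - t) * to_cube_bd i y l + t * sphere_base l\<bar>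
         \<le> (1 - t) * \<bar>to_cube_bd i y l\<bar> + t * \<bar>sphere_base l\<bar>"
        using that by (intro order_trans[OF abs_triangle_ineq]) (simp add: abs_mult)
      also have "\<dots> \<le> 1" using 1 that by (intro convex_bound_le) auto
      finally show "\<bar>(1 - t) * to_cube_bd i y l + t * sphere_base l\<bar> \<le> 1" .
    next
      fix l assume "Suc i \<le> l"
      then show "(1 - t) * to_cube_bd i y l + t * sphere_base l = 0"
        using y b by (simp add: cube_def)
    qed
  qed
  ultimately have k: "continuous_map (prod_topology (top_of_set {0..1}) (nsphere i)) (top_of_set (cube (Suc i))) k"
    by (auto simp: nsphere_top_of_set)
  have base: "k (t, sphere_base) = sphere_base" for t
    by (auto simp: k_def sphere_base_fixed algebra_simps)
  have "F sphere_base = f sphere_base"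
    using Ff[OF sphere_base_cube_bd] by (simp add: sphere_base_fixed)
  show ?thesis
  proof (subst homotopic_with)
    show "(h sphere_base = f sphere_base) = (k sphere_base = f sphere_base)"
      if "\<And>x. x \<in> topspace (nsphere i) \<Longrightarrow> h x = k x" for h k :: "(nat \<Rightarrow> real) \<Rightarrow> 'a"
      using that[OF sphere_base_in_nsphere] by simp
    have 0: "F (k (0, x)) = f x" if "x \<in> topspace (nsphere i)" for x
    proof -
      have "to_cube_bd i x \<in> cube_bd (Suc i)" using that cb(2) by (simp add: nsphere_top_of_set)
      then show ?thesis using Ff[of "to_cube_bd i x"] to_sphere_to_cube_bd[OF that] by (simp add: k_def)
    qed
    show "\<exists>h. continuous_map (prod_topology (top_of_set {0..1::real}) (nsphere i)) X h \<and>
        (\<forall>x\<in>topspace (nsphere i). h (0, x) = f x) \<and>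
        (\<forall>x\<in>topspace (nsphere i). h (1, x) = f sphere_base) \<and>
        (\<forall>t\<in>{0..1}. h (t, sphere_base) = f sphere_base)"
      by (intro exI[of _ "F \<circ> k"] conjI continuous_map_compose[OF k F])
        (use 0 base \<open>F sphere_base = f sphere_base\<close> in \<open>auto simp: k_def\<close>)
  qed
qed

text \<open>The shift by one: the i-sphere is the boundary of the cube of dimension i + 1, and the
  cube of dimension 0 with its empty boundary accounts for being non-empty.\<close>

lemma k_connected_iff_conn_upto: "k_connected k X \<longleftrightarrow> conn_upto (k + 1) X"
proof
  assume k: "k_connected k X"
  show "conn_upto (k + 1) X"
    unfolding conn_upto_def
  proof (intro allI impI)
    fix j assume j: "int j \<le> k + 1"
    show "sphere_null j X"
    proof (cases j)
      case 0
      then show ?thesis using k j unfolding k_connected_def by (simp add: sphere_null_0)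
    next
      case (Suc i)
      then show ?thesis
        using k j by (auto simp: k_connected_def intro!: homotopy_set_singleton_imp_sphere_null)
    qed
  qed
next
  assume c: "conn_upto (k + 1) X"
  show "k_connected k X"
    unfolding k_connected_def
  proof (intro conjI allI impI ballI)
    assume "-1 \<le> k"
    then have "sphere_null 0 X" using c by (auto simp: conn_upto_def)
    then show "topspace X \<noteq> {}" by (simp add: sphere_null_0)
  next
    fix i x assume i: "int i \<le> k" and x: "x \<in> topspace X"
    define r where "r = {(f, g). homotopic_with (\<lambda>h. h sphere_base = x) (nsphere i) X f g}"
    have X: "sphere_null (Suc i) X" using c i by (auto simp: conn_upto_def)
    have eq: "r `` {f} = r `` {\<lambda>_. x}" if "continuous_map (nsphere i) X f" "f sphere_base = x" for f
    proof -
      have *: "homotopic_with (\<lambda>h. h sphere_base = x) (nsphere i) X f (\<lambda>_. x)"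
        using sphere_null_imp_based_null_homotopic[OF X that(1)] that(2) by simp
      have "homotopic_with (\<lambda>h. h sphere_base = x) (nsphere i) X f g \<longleftrightarrow>
          homotopic_with (\<lambda>h. h sphere_base = x) (nsphere i) X (\<lambda>_. x) g" for g
        by (rule iffI, rule homotopic_with_trans[OF homotopic_with_symD[OF *]], assumption,
            rule homotopic_with_trans[OF *])
      then show ?thesis by (simp add: r_def Image_def)
    qed
    have "(\<lambda>_. x) \<in> {f. continuous_map (nsphere i) X f \<and> f sphere_base = x}"
      using x by simp
    then have "homotopy_set i X x = {r `` {\<lambda>_. x}}"
      unfolding homotopy_set_def quotient_def r_def[symmetric] using eq by blast
    then show "is_singleton (homotopy_set i X x)" by (simp add: is_singleton_def)
  qed
qed

section \<open>Null homotopies built cell by cell\<close>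

lemma continuous_map_closed_cover:
  assumes "finite \<T>" "topspace X \<subseteq> \<Union>\<T>"
    and "\<And>S. S \<in> \<T> \<Longrightarrow> closedin X S"
    and "\<And>S. S \<in> \<T> \<Longrightarrow> continuous_map (subtopology X S) Y g"
  shows "continuous_map X Y g"
  by (rule pasting_lemma_closed[where I=\<T> and T="\<lambda>S. S" and f="\<lambda>_. g"]) (use assms in auto)

text \<open>The pair (c, b) is a retract of the pair formed by a cube and its boundary:
  \<open>\<theta>\<close> undoes \<open>\<psi>\<close>, and both respect the boundary. This is all
  that transferring a filling takes. For d = 0 the boundary of the cube is empty, which forces b to
  be empty.\<close>

definition cell_like :: "nat \<Rightarrow> 'z::topological_space set \<Rightarrow> 'z set \<Rightarrow> bool" where
  "cell_like d c b \<longleftrightarrow> b \<subseteq> c \<and> (\<exists>\<psi> \<theta>.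
     continuous_on c \<psi> \<and> \<psi> ` c \<subseteq> cube d \<and> \<psi> ` b \<subseteq> cube_bd d \<and>
     continuous_on (cube d) \<theta> \<and> \<theta> ` cube d \<subseteq> c \<and> \<theta> ` cube_bd d \<subseteq> b \<and> (\<forall>x\<in>c. \<theta> (\<psi> x) = x))"

text \<open>The prism over c is a retract of the cube of dimension d + 1, with bottom, top and walls
  going into the boundary. Carried over to that boundary, g is filled there, and the filling is
  pulled back.\<close>

lemma prism_extend:
  fixes c :: "'z::topological_space set"
  assumes c: "cell_like d c b" and X: "sphere_null (Suc d) X"
    and g: "continuous_map (top_of_set ({0..1::real} \<times> b \<union> {0,1} \<times> c)) X g"
  obtains G where "continuous_map (top_of_set ({0..1} \<times> c)) X G"
    "\<And>p. p \<in> {0..1} \<times> b \<union> {0,1} \<times> c \<Longrightarrow> G p = g p"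
proof -
  obtain \<psi> \<theta> where bc: "b \<subseteq> c" and \<psi>: "continuous_on c \<psi>" "\<psi> ` c \<subseteq> cube d" "\<psi> ` b \<subseteq> cube_bd d"
    and \<theta>: "continuous_on (cube d) \<theta>" "\<theta> ` cube d \<subseteq> c" "\<theta> ` cube_bd d \<subseteq> b"
    and inv: "\<And>x. x \<in> c \<Longrightarrow> \<theta> (\<psi> x) = x"
    using c unfolding cell_like_def by (elim conjE exE) (rule that, assumption+, blast)
  \<comment> \<open>Coordinate d vanishes on the cube of dimension d, so it is free to store the
    time; 2 * t - 1 stretches [0, 1] to [-1, 1].\<close>
  define r where "r = (\<lambda>(t::real, x). (\<lambda>k. if k = d then 2 * t - 1 else \<psi> x k))"
  define s where "s = (\<lambda>y::nat \<Rightarrow> real. ((y d + 1) / 2, \<theta> (\<lambda>k. if k = d then 0 else y k)))"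
  have \<psi>d: "\<psi> x d = 0" if "x \<in> c" for x
    using \<psi>(2) that by (auto simp: cube_def)
  have cut: "(\<lambda>k. if k = d then 0 else y k) \<in> cube d" if "y \<in> cube (Suc d)" for y
    using that by (auto simp: cube_def)
  have r_cube: "r p \<in> cube (Suc d)" if "p \<in> {0..1} \<times> c" for p
    using that \<psi>(2) by (auto simp: r_def cube_def abs_le_iff less_Suc_eq)
  have r_bd: "r p \<in> cube_bd (Suc d)" if p: "p \<in> {0..1} \<times> b \<union> {0,1} \<times> c" for p
  proof -
    obtain t x where [simp]: "p = (t, x)" by (cases p)
    have *: "r p \<in> cube (Suc d)" by (rule r_cube) (use p bc in auto)
    show ?thesis
    proof (cases "x \<in> b")
      case True
      then obtain i where "i < d" "\<bar>\<psi> x i\<bar> = 1" using \<psi>(3) by (auto simp: cube_bd_def)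
      then show ?thesis using * by (auto simp: cube_bd_def r_def intro!: exI[of _ i])
    next
      case False
      then have "\<bar>r p d\<bar> = 1" using p by (auto simp: r_def)
      then show ?thesis using * by (auto simp: cube_bd_def)
    qed
  qed
  have s_bd: "s y \<in> {0..1} \<times> b \<union> {0,1} \<times> c" if y: "y \<in> cube_bd (Suc d)" for y
  proof -
    have yc: "y \<in> cube (Suc d)" using y by (auto simp: cube_bd_def)
    then have yd: "\<bar>y d\<bar> \<le> 1" by (auto simp: cube_def)
    show ?thesis
    proof (cases "\<bar>y d\<bar> = 1")
      case True
      then have "(y d + 1) / 2 \<in> {0, 1}" by auto
      then show ?thesis using \<theta>(2) cut[OF yc] by (auto simp: s_def)
    next
      case False
      then obtain i where "i < d" "\<bar>y i\<bar> = 1" using y by (auto simp: cube_bd_def less_Suc_eq)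
      then have "(\<lambda>k. if k = d then 0 else y k) \<in> cube_bd d"
        using cut[OF yc] by (auto simp: cube_bd_def intro!: exI[of _ i])
      then show ?thesis using \<theta>(3) yd by (auto simp: s_def)
    qed
  qed
  have sr: "s (r (t, x)) = (t, x)" if "x \<in> c" for t x
  proof -
    have "(\<lambda>k. if k = d then 0 else \<psi> x k) = \<psi> x" using \<psi>d[OF that] by auto
    then show ?thesis using inv[OF that] by (auto simp: s_def r_def cong: if_cong)
  qed
  have cont_r: "continuous_on ({0..1} \<times> c) r"
    unfolding r_def case_prod_beta
  proof (rule continuous_on_coordinatewise_then_product)
    fix k
    have "continuous_on ({0..1} \<times> c) (\<lambda>p. \<psi> (snd p) k)"
      by (rule continuous_on_product_then_coordinatewise, rule continuous_on_compose2[OF \<psi>(1)])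
        (auto intro: continuous_on_snd continuous_on_id)
    then show "continuous_on ({0..1} \<times> c) (\<lambda>p. if k = d then 2 * fst p - 1 else \<psi> (snd p) k)"
      by (cases "k = d") (auto intro!: continuous_intros)
  qed
  have cont_cut: "continuous_on A (\<lambda>y::nat \<Rightarrow> real. (\<lambda>k. if k = d then 0 else y k))" for A
  proof (rule continuous_on_coordinatewise_then_product)
    fix k show "continuous_on A (\<lambda>y::nat \<Rightarrow> real. if k = d then 0 else y k)"
      by (cases "k = d") (auto intro!: continuous_on_product_then_coordinatewise continuous_intros)
  qed
  have cont_s: "continuous_on (cube_bd (Suc d)) s"
    unfolding s_def
    by (intro continuous_intros continuous_on_compose2[OF \<theta>(1) cont_cut] continuous_on_product_then_coordinatewise)
       (use cut cube_bd_subset in auto)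
  have "continuous_map (top_of_set (cube_bd (Suc d))) X (g \<circ> s)"
    by (rule continuous_map_compose[OF _ g]) (use cont_s s_bd in \<open>auto simp: continuous_map_in_subtopology\<close>)
  then obtain F where F: "continuous_map (top_of_set (cube (Suc d))) X F"
    "\<And>y. y \<in> cube_bd (Suc d) \<Longrightarrow> F y = (g \<circ> s) y"
    by (rule sphere_null_extend[OF X]) (rule that, assumption, blast)
  show thesis
  proof (rule that)
    show "continuous_map (top_of_set ({0..1} \<times> c)) X (F \<circ> r)"
      by (rule continuous_map_compose[OF _ F(1)])
        (use cont_r r_cube in \<open>auto simp: continuous_map_in_subtopology\<close>)
    fix p :: "real \<times> 'z" assume p: "p \<in> {0..1} \<times> b \<union> {0,1} \<times> c"
    then have "snd p \<in> c" using bc by auto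
    then have "s (r p) = p" using sr by (metis prod.collapse)
    then show "(F \<circ> r) p = g p" using F(2)[OF r_bd[OF p]] by simp
  qed
qed

text \<open>\<open>cell x\<close> plays the smallest closed cell through x, and \<open>T\<close>
  prescribes the set in which the homotopy has to stay over each cell. The construction is a
  recursion over inclusion of cells: over a cell the homotopy is already given at the bottom by f,
  at the top by the constant y0 and on the walls by the proper faces, and \<open>nul\<close> fills
  the prism inside \<open>T (cell x)\<close>. Monotonicity of \<open>T\<close> brings the walls into
  that target.\<close>

theorem cellwise_null_homotopy:
  fixes cell :: "'z::topological_space \<Rightarrow> 'z set" and X :: "'x topology"
  assumes self: "\<And>x. x \<in> Z \<Longrightarrow> x \<in> cell x"
    and sub: "\<And>x y. x \<in> Z \<Longrightarrow> y \<in> cell x \<Longrightarrow> y \<in> Z \<and> cell y \<subseteq> cell x"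
    and fin: "\<And>x. x \<in> Z \<Longrightarrow> finite (cell ` cell x)"
    and clo: "\<And>x. x \<in> Z \<Longrightarrow> closed (cell x)"
    and cell: "\<And>x. x \<in> Z \<Longrightarrow> cell_like (dm x) (cell x) {y \<in> cell x. cell y \<noteq> cell x}"
    and mono: "\<And>x y. x \<in> Z \<Longrightarrow> y \<in> cell x \<Longrightarrow> T (cell y) \<subseteq> T (cell x)"
    and nul: "\<And>x. x \<in> Z \<Longrightarrow> sphere_null (Suc (dm x)) (subtopology X (T (cell x)))"
    and f: "\<And>x. x \<in> Z \<Longrightarrow> continuous_map (top_of_set (cell x)) (subtopology X (T (cell x))) f"
    and y0: "\<And>x. x \<in> Z \<Longrightarrow> y0 \<in> T (cell x)" "y0 \<in> topspace X"
  obtains H where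
    "\<And>x. x \<in> Z \<Longrightarrow> continuous_map (top_of_set ({0..1::real} \<times> cell x)) (subtopology X (T (cell x))) H"
    "\<And>x. x \<in> Z \<Longrightarrow> H (0, x) = f x" "\<And>x. x \<in> Z \<Longrightarrow> H (1, x) = y0"
proof -
  define R where "R = {(d, c). d \<in> cell ` Z \<and> c \<in> cell ` Z \<and> d \<subset> c}"
  have fin': "finite {d \<in> cell ` Z. d \<subseteq> cell x}" if "x \<in> Z" for x
    by (rule finite_subset[OF _ fin[OF that]]) (use self in auto)
  \<comment> \<open>Each cell contains finitely many cells, and a proper face contains strictly
    fewer of them.\<close>
  have "R \<subseteq> Wellfounded.measure (\<lambda>c. card {d \<in> cell ` Z. d \<subseteq> c})"
  proof clarify
    fix d c assume "(d, c) \<in> R"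
    then obtain x where x: "x \<in> Z" "c = cell x" "d \<in> cell ` Z" "d \<subset> c" by (auto simp: R_def)
    have "{e \<in> cell ` Z. e \<subseteq> d} \<subset> {e \<in> cell ` Z. e \<subseteq> c}" using x by auto
    then show "(d, c) \<in> Wellfounded.measure (\<lambda>c. card {d \<in> cell ` Z. d \<subseteq> c})"
      using psubset_card_mono[OF fin'[OF x(1)]] x by simp
  qed
  then have wf: "wf R" by (rule wf_subset[OF wf_measure])
  define P where "P = (\<lambda>(G :: 'z set \<Rightarrow> real \<times> 'z \<Rightarrow> 'x) c r. c \<in> cell ` Z \<longrightarrow>
     continuous_map (top_of_set ({0..1} \<times> c)) (subtopology X (T c)) r \<and>
     (\<forall>x\<in>c. r (0, x) = f x \<and> r (1, x) = y0) \<and>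
     (\<forall>y\<in>c. \<forall>t\<in>{0..1}. cell y \<noteq> c \<longrightarrow> r (t, y) = G (cell y) (t, y)))"
  \<comment> \<open>A filling is not unique and depends on those chosen over the faces, so the
    choice runs along the well-founded relation.\<close>
  have "\<exists>G. \<forall>c. P G c (G c)"
  proof (rule dependent_wf_choice[OF wf])
    fix G G' :: "'z set \<Rightarrow> real \<times> 'z \<Rightarrow> 'x" and c r
    assume eq: "\<And>d. (d, c) \<in> R \<Longrightarrow> G d = G' d"
    have "G (cell y) = G' (cell y)" if "c \<in> cell ` Z" "y \<in> c" "cell y \<noteq> c" for y
      by (rule eq) (use that sub in \<open>auto simp: R_def\<close>)
    then show "P G c r = P G' c r" by (auto simp: P_def)
  next
    fix c and G :: "'z set \<Rightarrow> real \<times> 'z \<Rightarrow> 'x"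
    assume IH: "\<And>d. (d, c) \<in> R \<Longrightarrow> P G d (G d)"
    show "\<exists>r. P G c r"
    proof (cases "c \<in> cell ` Z")
      case False then show ?thesis by (auto simp: P_def)
    next
      case True
      then obtain x where x: "x \<in> Z" "c = cell x" by auto
      define b where "b = {y \<in> c. cell y \<noteq> c}"
      have cl: "cell_like (dm x) c b" using cell[OF x(1)] x by (simp add: b_def)
      \<comment> \<open>On a wall the value at y is read off from the smallest cell through y; the
        fourth fact of \<open>PG\<close> makes this agree with the filling over any proper face
        containing y.\<close>
      define g where "g = (\<lambda>(t::real, y). if y \<in> b then G (cell y) (t, y) else if t = 0 then f y else y0)"
      have bsub: "y \<in> Z \<and> cell y \<subset> c \<and> (cell y, c) \<in> R" if "y \<in> b" for y
        using that sub[OF x(1)] x by (auto simp: b_def R_def)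
      have PG: "continuous_map (top_of_set ({0..1} \<times> cell z)) (subtopology X (T (cell z))) (G (cell z))"
         "\<And>y. y \<in> cell z \<Longrightarrow> G (cell z) (0, y) = f y"
         "\<And>y. y \<in> cell z \<Longrightarrow> G (cell z) (1, y) = y0"
         "\<And>y t. y \<in> cell z \<Longrightarrow> t \<in> {0..1} \<Longrightarrow> G (cell z) (t, y) = G (cell y) (t, y)"
         if "z \<in> b" for z
      proof -
        have "P G (cell z) (G (cell z))" using IH bsub[OF that] by blast
        then have *: "continuous_map (top_of_set ({0..1} \<times> cell z)) (subtopology X (T (cell z))) (G (cell z)) \<and>
     (\<forall>x\<in>cell z. G (cell z) (0, x) = f x \<and> G (cell z) (1, x) = y0) \<and>
     (\<forall>y\<in>cell z. \<forall>t\<in>{0..1}. cell y \<noteq> cell z \<longrightarrow> G (cell z) (t, y) = G (cell y) (t, y))"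
          unfolding P_def using bsub[OF that] by blast
        then show "continuous_map (top_of_set ({0..1} \<times> cell z)) (subtopology X (T (cell z))) (G (cell z))"
          by blast
        show "\<And>y. y \<in> cell z \<Longrightarrow> G (cell z) (0, y) = f y" 
         "\<And>y. y \<in> cell z \<Longrightarrow> G (cell z) (1, y) = y0" using * by blast+
        fix y and t :: real assume "y \<in> cell z" "t \<in> {0..1}"
        then show "G (cell z) (t, y) = G (cell y) (t, y)"
          using * by (cases "cell y = cell z") auto
      qed
      have b_self: "y \<in> cell y" if "y \<in> b" for y using self bsub[OF that] by blast
      have b_down: "y \<in> b" if "z \<in> b" "y \<in> cell z" for y z
        using bsub[OF that(1)] that sub[of z y] by (auto simp: b_def)
      have g0: "g (0, y) = f y" if "y \<in> c" for y
        using PG(2)[OF _ b_self] by (auto simp: g_def)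
      have g1: "g (1, y) = y0" if "y \<in> c" for y
        using PG(3)[OF _ b_self] by (auto simp: g_def)
      define B where "B = {0..1::real} \<times> b \<union> {0,1} \<times> c"
      define \<T> where "\<T> = (\<lambda>d. {0..1::real} \<times> d) ` cell ` b \<union> {{0} \<times> c, {1} \<times> c}"
      have "continuous_map (top_of_set B) (subtopology X (T c)) g"
      proof (rule continuous_map_closed_cover)
        have "finite (cell ` b)" by (rule finite_subset[OF _ fin[OF x(1)]]) (auto simp: b_def x)
        then show "finite \<T>" by (simp add: \<T>_def)
        show "topspace (top_of_set B) \<subseteq> \<Union>\<T>"
          using b_self by (fastforce simp: B_def \<T>_def)
        fix S assume S: "S \<in> \<T>"
        have SB: "S \<subseteq> B" using S b_down by (auto simp: \<T>_def B_def)
        have "closed S" using S clo[of x] clo bsub x by (auto simp: \<T>_def intro!: closed_Times)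
        then show "closedin (top_of_set B) S" using SB closed_subset by blast
        have st: "subtopology (top_of_set B) S = top_of_set S"
          using SB by (simp add: subtopology_subtopology inf.absorb2)
        consider z where "z \<in> b" "S = {0..1} \<times> cell z" | "S = {0} \<times> c" | "S = {1} \<times> c"
          using S by (auto simp: \<T>_def)
        then show "continuous_map (subtopology (top_of_set B) S) (subtopology X (T c)) g"
          unfolding st
        proof cases
          case 1
          have "T (cell z) \<subseteq> T c" using mono[of x z] x 1 by (auto simp: b_def)
          then have "continuous_map (top_of_set S) (subtopology X (T c)) (G (cell z))"
            using PG(1)[OF 1(1)] 1(2) by (auto simp: continuous_map_in_subtopology)
          then show "continuous_map (top_of_set S) (subtopology X (T c)) g"
            by (rule continuous_map_eq) (use 1 b_down PG(4) in \<open>auto simp: g_def\<close>)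
        next
          case 2
          have "continuous_map (top_of_set S) (subtopology X (T c)) (f \<circ> snd)"
            by (rule continuous_map_compose[OF _ f[OF x(1), folded x(2)]])
              (use 2 in \<open>auto simp: continuous_map_in_subtopology intro!: continuous_intros\<close>)
          then show "continuous_map (top_of_set S) (subtopology X (T c)) g"
            by (rule continuous_map_eq) (use 2 g0 in auto)
        next
          case 3
          have "continuous_map (top_of_set S) (subtopology X (T c)) (\<lambda>_. y0)"
            using y0 x by auto
          then show "continuous_map (top_of_set S) (subtopology X (T c)) g"
            by (rule continuous_map_eq) (use 3 g1 in auto)
        qed
      qed
      then have "continuous_map (top_of_set ({0..1::real} \<times> b \<union> {0,1} \<times> c)) (subtopology X (T c)) g"
        by (simp only: B_def)
      then obtain r where r: "continuous_map (top_of_set ({0..1} \<times> c)) (subtopology X (T c)) r"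
        "\<And>p. p \<in> {0..1} \<times> b \<union> {0,1} \<times> c \<Longrightarrow> r p = g p"
        by (rule prism_extend[OF cl nul[OF x(1), folded x(2)]]) (rule that, assumption, simp only:)
      have "P G c r"
        unfolding P_def
      proof (intro impI conjI ballI r(1))
        fix y assume y: "y \<in> c"
        show "r (0, y) = f y" using r(2)[of "(0, y)"] y g0 by simp
        show "r (1, y) = y0" using r(2)[of "(1, y)"] y g1 by simp
        fix t :: real assume t: "t \<in> {0..1}" and n: "cell y \<noteq> c"
        then have "y \<in> b" using y by (simp add: b_def)
        then show "r (t, y) = G (cell y) (t, y)" using r(2)[of "(t, y)"] t by (simp add: g_def)
      qed
      then show ?thesis by blast
    qed
  qed
  then obtain G where "\<And>c. P G c (G c)" by blast
  then have *: "continuous_map (top_of_set ({0..1} \<times> cell x)) (subtopology X (T (cell x))) (G (cell x)) \<and>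
     (\<forall>y\<in>cell x. G (cell x) (0, y) = f y \<and> G (cell x) (1, y) = y0) \<and>
     (\<forall>y\<in>cell x. \<forall>t\<in>{0..1}. cell y \<noteq> cell x \<longrightarrow> G (cell x) (t, y) = G (cell y) (t, y))" if "x \<in> Z" for x
    unfolding P_def using that by blast
  show thesis
  proof (rule that[of "\<lambda>(t, y). G (cell y) (t, y)"])
    fix x assume x: "x \<in> Z"
    have "G (cell x) (t, y) = G (cell y) (t, y)" if "y \<in> cell x" "t \<in> {0..1}" for y t
      using *[OF x] that by (cases "cell y = cell x") auto
    then show "continuous_map (top_of_set ({0..1::real} \<times> cell x)) (subtopology X (T (cell x))) (\<lambda>(t, y). G (cell y) (t, y))"
      using *[OF x] by (auto intro: continuous_map_eq[of _ _ "G (cell x)"])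
    show "(\<lambda>(t, y). G (cell y) (t, y)) (0, x) = f x" "(\<lambda>(t, y). G (cell y) (t, y)) (1, x) = y0"
      using *[OF x] self[OF x] by auto
  qed
qed

section \<open>Connectivity of a union of two open sets\<close>

definition grid_cell :: "nat \<Rightarrow> (nat \<Rightarrow> real) \<Rightarrow> (nat \<Rightarrow> real) set" where
  "grid_cell N x = {y. \<forall>i. of_int \<lfloor>N * x i\<rfloor> \<le> N * y i \<and> N * y i \<le> of_int \<lceil>N * x i\<rceil>}"

text \<open>\<open>grid_cell N x\<close> is the smallest closed cell of the grid through x: a
  coordinate that is a multiple of 1/N is frozen, any other ranges over an interval of length 1/N.
  The latter are collected here, so their number is the dimension of the cell.\<close>

definition free_coords :: "nat \<Rightarrow> (nat \<Rightarrow> real) \<Rightarrow> nat set" where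
  "free_coords N x = {i. \<lfloor>N * x i\<rfloor> < \<lceil>N * x i\<rceil>}"

lemma grid_cell_self: "x \<in> grid_cell N x"
  by (simp add: grid_cell_def)

lemma grid_cell_mono: "y \<in> grid_cell N x \<Longrightarrow> grid_cell N y \<subseteq> grid_cell N x"
proof
  fix z assume y: "y \<in> grid_cell N x" and z: "z \<in> grid_cell N y"
  show "z \<in> grid_cell N x"
    unfolding grid_cell_def
  proof (intro CollectI allI)
    fix i
    have "\<lfloor>N * x i\<rfloor> \<le> \<lfloor>N * y i\<rfloor>" "\<lceil>N * y i\<rceil> \<le> \<lceil>N * x i\<rceil>"
      using y by (auto simp: grid_cell_def le_floor_iff ceiling_le_iff)
    moreover have "of_int \<lfloor>N * y i\<rfloor> \<le> N * z i" "N * z i \<le> of_int \<lceil>N * y i\<rceil>"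
      using z by (auto simp: grid_cell_def)
    ultimately show "of_int \<lfloor>N * x i\<rfloor> \<le> N * z i \<and> N * z i \<le> of_int \<lceil>N * x i\<rceil>"
      by linarith
  qed
qed

lemma closed_grid_cell: "closed (grid_cell N x)"
proof -
  have c: "continuous_on UNIV (\<lambda>y :: nat \<Rightarrow> real. N * y i)" for i
    by (intro continuous_intros continuous_on_product_then_coordinatewise)
  show ?thesis
    unfolding grid_cell_def
    by (intro closed_Collect_all closed_Collect_conj closed_Collect_le c continuous_on_const)
qed

lemma not_free_coords:
  assumes "i \<notin> free_coords N x"
  shows "of_int \<lfloor>N * x i\<rfloor> = N * x i" "of_int \<lceil>N * x i\<rceil> = N * x i"
proof -
  have "\<lceil>N * x i\<rceil> \<le> \<lfloor>N * x i\<rfloor>" using assms by (simp add: free_coords_def)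
  then have "real_of_int \<lceil>N * x i\<rceil> \<le> of_int \<lfloor>N * x i\<rfloor>" by simp
  then show "of_int \<lfloor>N * x i\<rfloor> = N * x i" "of_int \<lceil>N * x i\<rceil> = N * x i"
    using of_int_floor_le[of "N * x i"] le_of_int_ceiling[of "N * x i"] by linarith+
qed

lemma free_coordsD:
  assumes "i \<in> free_coords N x"
  shows "\<lceil>N * x i\<rceil> = \<lfloor>N * x i\<rfloor> + 1" "of_int \<lfloor>N * x i\<rfloor> < N * x i" "N * x i < of_int \<lfloor>N * x i\<rfloor> + 1"
proof -
  have lt: "\<lfloor>N * x i\<rfloor> < \<lceil>N * x i\<rceil>" using assms by (simp add: free_coords_def)
  have "of_int \<lfloor>N * x i\<rfloor> \<noteq> N * x i"
  proof
    assume "of_int \<lfloor>N * x i\<rfloor> = N * x i"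
    then have "\<lceil>N * x i\<rceil> = \<lfloor>N * x i\<rfloor>" by (metis ceiling_of_int)
    then show False using lt by simp
  qed
  then show "of_int \<lfloor>N * x i\<rfloor> < N * x i" using of_int_floor_le[of "N * x i"] by linarith
  show "N * x i < of_int \<lfloor>N * x i\<rfloor> + 1" by linarith
  show "\<lceil>N * x i\<rceil> = \<lfloor>N * x i\<rfloor> + 1" using lt by linarith
qed

text \<open>Integers are multiples of 1/N, so the grid is compatible with the cube: coordinates 1
  and -1, and the zeros from position j on, are frozen, and a cell through a boundary point stays in
  the boundary.\<close>

lemma integral_not_free:
  assumes "x i \<in> \<int>"
  shows "i \<notin> free_coords N x"
proof -
  have "N * x i \<in> \<int>" using assms by auto
  then show ?thesis by (auto simp: free_coords_def elim!: Ints_cases)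
qed

lemma grid_cell_fixed:
  assumes "N > 0" "y \<in> grid_cell N x" "i \<notin> free_coords N x"
  shows "y i = x i"
proof -
  have "N * y i = N * x i"
    using assms(2) not_free_coords[OF assms(3)] unfolding grid_cell_def by (metis (no_types, lifting) antisym mem_Collect_eq)
  then show ?thesis using assms by simp
qed

lemma grid_cell_in_cube_bd:
  assumes N: "N > 0" and x: "x \<in> cube_bd j" and y: "y \<in> grid_cell N x"
  shows "y \<in> cube_bd j"
proof -
  have le: "\<bar>y i\<bar> \<le> 1" if "i < j" for i
  proof -
    have "\<bar>x i\<bar> \<le> 1" using x that by (auto simp: cube_bd_def cube_def)
    then have "\<bar>N * x i\<bar> \<le> N" using N by (simp add: abs_mult)
    then have "- int N \<le> \<lfloor>N * x i\<rfloor>" "\<lceil>N * x i\<rceil> \<le> int N"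
      by (auto simp: le_floor_iff ceiling_le_iff abs_le_iff)
    then have "- real N \<le> of_int \<lfloor>N * x i\<rfloor>" "of_int \<lceil>N * x i\<rceil> \<le> real N" by linarith+
    moreover have "of_int \<lfloor>N * x i\<rfloor> \<le> N * y i" "N * y i \<le> of_int \<lceil>N * x i\<rceil>"
      using y by (auto simp: grid_cell_def)
    ultimately have "\<bar>N * y i\<bar> \<le> N" by linarith
    then show ?thesis using N by (simp add: abs_mult)
  qed
  have int: "y i = x i" if "x i \<in> \<int>" for i
    by (rule grid_cell_fixed[OF N y integral_not_free[of x i N, OF that]])
  obtain i where i: "i < j" "\<bar>x i\<bar> = 1" using x by (auto simp: cube_bd_def)
  then have "x i = 1 \<or> x i = -1" by linarith
  then have "x i \<in> \<int>" by (metis Ints_1 Ints_minus)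
  then have "\<bar>y i\<bar> = 1" using int i by simp
  moreover have "y k = 0" if "k \<ge> j" for k
    using int[of k] x that by (auto simp: cube_bd_def cube_def)
  ultimately show ?thesis using i le by (auto simp: cube_bd_def cube_def)
qed

text \<open>Some coordinate is 1 or -1 and hence frozen, which leaves at most j - 1 directions among
  the first j; all later coordinates are 0.\<close>

lemma free_coords_cube_bd:
  assumes "x \<in> cube_bd j"
  shows "finite (free_coords N x)" "card (free_coords N x) < j"
proof -
  obtain i where i: "i < j" "\<bar>x i\<bar> = 1" using assms by (auto simp: cube_bd_def)
  then have "x i = 1 \<or> x i = -1" by linarith
  then have "x i \<in> \<int>" by (metis Ints_1 Ints_minus)
  then have i_notin: "i \<notin> free_coords N x" by (rule integral_not_free[of x i N])
  have j_notin: "k \<notin> free_coords N x" if "k \<ge> j" for k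
    using assms that by (auto simp: cube_bd_def cube_def free_coords_def)
  have s: "free_coords N x \<subseteq> {..<j} - {i}"
  proof
    fix k assume "k \<in> free_coords N x"
    then show "k \<in> {..<j} - {i}" using i_notin j_notin[of k] by (cases "k < j") auto
  qed
  then show "finite (free_coords N x)" by (rule finite_subset) auto
  have "card (free_coords N x) \<le> card ({..<j} - {i})" by (rule card_mono[OF _ s]) auto
  then show "card (free_coords N x) < j" using i by simp
qed

lemma finite_grid_cells: "finite (grid_cell N ` cube_bd j)"
proof -
  define B where "B = {- int N..int N} \<times> {- int N..int N}"
  define F where "F = {f :: nat \<Rightarrow> int \<times> int. \<forall>i. (i \<in> {..<j} \<longrightarrow> f i \<in> B) \<and> (i \<notin> {..<j} \<longrightarrow> f i = (0, 0))}"
  have "finite F" unfolding F_def by (rule finite_set_of_finite_funs) (auto simp: B_def)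
  moreover have "grid_cell N ` cube_bd j
    \<subseteq> (\<lambda>f. {y. \<forall>i. of_int (fst (f i)) \<le> N * y i \<and> N * y i \<le> of_int (snd (f i))}) ` F"
  proof clarify
    fix x assume x: "x \<in> cube_bd j"
    have "(\<lambda>i. (\<lfloor>N * x i\<rfloor>, \<lceil>N * x i\<rceil>)) \<in> F"
      unfolding F_def
    proof (intro CollectI allI conjI impI)
      fix i assume "i \<in> {..<j}"
      then have "\<bar>x i\<bar> \<le> 1" using x by (auto simp: cube_bd_def cube_def)
      then have "\<bar>N * x i\<bar> \<le> N" by (simp add: abs_mult mult_left_le)
      then show "(\<lfloor>N * x i\<rfloor>, \<lceil>N * x i\<rceil>) \<in> B"
        unfolding B_def by (simp add: le_floor_iff ceiling_le_iff abs_le_iff) linarith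
    next
      fix i assume "i \<notin> {..<j}"
      then show "(\<lfloor>N * x i\<rfloor>, \<lceil>N * x i\<rceil>) = (0, 0)" using x by (auto simp: cube_bd_def cube_def)
    qed
    then show "grid_cell N x \<in> (\<lambda>f. {y. \<forall>i. of_int (fst (f i)) \<le> N * y i \<and> N * y i \<le> of_int (snd (f i))}) ` F"
      by (intro image_eqI[of _ _ "\<lambda>i. (\<lfloor>N * x i\<rfloor>, \<lceil>N * x i\<rceil>)"]) (auto simp: grid_cell_def)
  qed
  ultimately show ?thesis by (rule finite_surj)
qed

text \<open>Identifies the boundary of a cell, which \<open>cellwise_null_homotopy\<close> takes to
  be the points spanning another cell, with the points having a free coordinate at an end of its
  interval.\<close>

lemma grid_cell_eq_iff:
  assumes N: "N > 0" and y: "y \<in> grid_cell N x"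
  shows "grid_cell N y = grid_cell N x \<longleftrightarrow>
    (\<forall>i\<in>free_coords N x. of_int \<lfloor>N * x i\<rfloor> < N * y i \<and> N * y i < of_int \<lfloor>N * x i\<rfloor> + 1)"
    (is "_ \<longleftrightarrow> ?R")
proof
  assume eq: "grid_cell N y = grid_cell N x"
  show ?R
  proof (rule ballI, rule ccontr)
    fix i assume i: "i \<in> free_coords N x" and n: "\<not> (of_int \<lfloor>N * x i\<rfloor> < N * y i \<and> N * y i < of_int \<lfloor>N * x i\<rfloor> + 1)"
    have "of_int \<lfloor>N * x i\<rfloor> \<le> N * y i" "N * y i \<le> of_int \<lfloor>N * x i\<rfloor> + 1"
      using y free_coordsD(1)[OF i] by (auto simp: grid_cell_def) (metis of_int_1 of_int_add)
    then have "N * y i = of_int \<lfloor>N * x i\<rfloor> \<or> N * y i = of_int (\<lfloor>N * x i\<rfloor> + 1)" using n by auto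
    then have "of_int \<lfloor>N * y i\<rfloor> = N * y i" "of_int \<lceil>N * y i\<rceil> = N * y i" by (metis floor_of_int, metis ceiling_of_int)
    moreover have "x \<in> grid_cell N y" using eq grid_cell_self by simp
    ultimately have "N * x i = N * y i" unfolding grid_cell_def by (smt (verit) mem_Collect_eq)
    then show False using n free_coordsD(2,3)[OF i] by linarith
  qed
next
  assume R: ?R
  have fl: "\<lfloor>N * y i\<rfloor> = \<lfloor>N * x i\<rfloor> \<and> \<lceil>N * y i\<rceil> = \<lceil>N * x i\<rceil>" for i
  proof (cases "i \<in> free_coords N x")
    case True
    have "of_int \<lfloor>N * x i\<rfloor> < N * y i" "N * y i < of_int \<lfloor>N * x i\<rfloor> + 1" using R True by auto
    then have "\<lfloor>N * y i\<rfloor> = \<lfloor>N * x i\<rfloor>" "\<lceil>N * y i\<rceil> = \<lfloor>N * x i\<rfloor> + 1" by linarith+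
    then show ?thesis using free_coordsD(1)[OF True] by simp
  qed (use grid_cell_fixed[OF N y] in simp)
  show "grid_cell N y = grid_cell N x" by (simp add: grid_cell_def fl)
qed

lemma grid_cell_like:
  assumes N: "N > 0" and fin: "finite (free_coords N x)"
  shows "cell_like (card (free_coords N x)) (grid_cell N x) {y \<in> grid_cell N x. grid_cell N y \<noteq> grid_cell N x}"
proof -
  let ?A = "free_coords N x" and ?d = "card (free_coords N x)"
  let ?b = "{y \<in> grid_cell N x. grid_cell N y \<noteq> grid_cell N x}"
  obtain \<pi> where \<pi>: "bij_betw \<pi> {..<?d} ?A"
    using ex_bij_betw_nat_finite[OF fin] by (auto simp: atLeast0LessThan)
  define \<rho> where "\<rho> = inv_into {..<?d} \<pi>"
  have \<pi>A: "\<pi> k \<in> ?A" if "k < ?d" for k using \<pi> that by (auto simp: bij_betw_def)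
  have \<rho>d: "\<rho> i < ?d" "\<pi> (\<rho> i) = i" if "i \<in> ?A" for i
  proof -
    have "i \<in> \<pi> ` {..<?d}" using \<pi> that by (simp add: bij_betw_def)
    then show "\<rho> i < ?d" "\<pi> (\<rho> i) = i"
      using inv_into_into[of i \<pi> "{..<?d}"] f_inv_into_f[of i \<pi> "{..<?d}"] by (auto simp: \<rho>_def)
  qed
  have \<rho>\<pi>: "\<rho> (\<pi> k) = k" if "k < ?d" for k
    unfolding \<rho>_def using \<pi> that by (intro inv_into_f_f) (auto simp: bij_betw_def)
  define lo where "lo = (\<lambda>i. real_of_int \<lfloor>N * x i\<rfloor>)"
  define \<psi> where "\<psi> = (\<lambda>(y :: nat \<Rightarrow> real) k. if k < ?d then 2 * (N * y (\<pi> k) - lo (\<pi> k)) - 1 else 0)"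
  define \<theta> where "\<theta> = (\<lambda>(z :: nat \<Rightarrow> real) i. if i \<in> ?A then (lo i + (z (\<rho> i) + 1) / 2) / N else x i)"
  have cell_iff: "y \<in> grid_cell N x \<longleftrightarrow> (\<forall>i\<in>?A. lo i \<le> N * y i \<and> N * y i \<le> lo i + 1) \<and> (\<forall>i. i \<notin> ?A \<longrightarrow> y i = x i)" for y :: "nat \<Rightarrow> real"
  proof
    assume y: "y \<in> grid_cell N x"
    show "(\<forall>i\<in>?A. lo i \<le> N * y i \<and> N * y i \<le> lo i + 1) \<and> (\<forall>i. i \<notin> ?A \<longrightarrow> y i = x i)"
      using grid_cell_fixed[OF N y] y free_coordsD(1)[of _ N x] by (auto simp: lo_def grid_cell_def) (metis of_int_1 of_int_add)
  next
    assume *: "(\<forall>i\<in>?A. lo i \<le> N * y i \<and> N * y i \<le> lo i + 1) \<and> (\<forall>i. i \<notin> ?A \<longrightarrow> y i = x i)"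
    show "y \<in> grid_cell N x"
      unfolding grid_cell_def
    proof (intro CollectI allI)
      fix i show "of_int \<lfloor>N * x i\<rfloor> \<le> N * y i \<and> N * y i \<le> of_int \<lceil>N * x i\<rceil>"
        using * free_coordsD(1)[of i N x] not_free_coords[of i N x]
        by (cases "i \<in> ?A") (auto simp: lo_def)
    qed
  qed
  have b_iff: "y \<in> ?b \<longleftrightarrow> y \<in> grid_cell N x \<and> (\<exists>i\<in>?A. N * y i = lo i \<or> N * y i = lo i + 1)" for y :: "nat \<Rightarrow> real"
    using grid_cell_eq_iff[OF N, of y x] cell_iff[of y] unfolding lo_def by force
  have \<psi>_cube: "\<psi> y \<in> cube ?d" if "y \<in> grid_cell N x" for y
    using that \<pi>A unfolding cell_iff by (force simp: \<psi>_def cube_def abs_le_iff)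
  have \<theta>N: "N * \<theta> z i = lo i + (z (\<rho> i) + 1) / 2" if "i \<in> ?A" for z i
    using that N by (simp add: \<theta>_def)
  have \<theta>_cell: "\<theta> z \<in> grid_cell N x" if "z \<in> cube ?d" for z
    unfolding cell_iff
  proof (intro conjI ballI allI impI)
    fix i assume i: "i \<in> ?A"
    have "\<bar>z (\<rho> i)\<bar> \<le> 1" using that \<rho>d[OF i] by (simp add: cube_def)
    then show "lo i \<le> N * \<theta> z i" "N * \<theta> z i \<le> lo i + 1" by (auto simp: \<theta>N[OF i] abs_le_iff)
  qed (simp add: \<theta>_def)
  show ?thesis
    unfolding cell_like_def
  proof (rule conjI, blast, rule exI[of _ \<psi>], rule exI[of _ \<theta>], intro conjI ballI)
    have co: "continuous_on A (\<lambda>y :: nat \<Rightarrow> real. y i)" for A i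
      by (rule continuous_on_product_then_coordinatewise) (rule continuous_on_id)
    show "continuous_on (grid_cell N x) \<psi>"
      unfolding \<psi>_def
    proof (rule continuous_on_coordinatewise_then_product)
      fix k show "continuous_on (grid_cell N x) (\<lambda>y. if k < ?d then 2 * (N * y (\<pi> k) - lo (\<pi> k)) - 1 else 0)"
        by (cases "k < ?d") (auto intro!: continuous_on_diff continuous_on_mult continuous_on_const co)
    qed
    show "continuous_on (cube ?d) \<theta>"
      unfolding \<theta>_def
    proof (rule continuous_on_coordinatewise_then_product)
      fix i show "continuous_on (cube ?d) (\<lambda>z. if i \<in> ?A then (lo i + (z (\<rho> i) + 1) / 2) / N else x i)"
        using N by (cases "i \<in> ?A") (auto intro!: continuous_on_add continuous_on_divide continuous_on_const co)
    qed
    show "\<psi> ` grid_cell N x \<subseteq> cube ?d" "\<theta> ` cube ?d \<subseteq> grid_cell N x"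
      using \<psi>_cube \<theta>_cell by auto
    show "\<psi> ` ?b \<subseteq> cube_bd ?d"
    proof (rule image_subsetI)
      fix y assume "y \<in> ?b"
      then obtain i where y: "y \<in> grid_cell N x" and i: "i \<in> ?A" "N * y i = lo i \<or> N * y i = lo i + 1"
        unfolding b_iff by blast
      then have "\<bar>\<psi> y (\<rho> i)\<bar> = 1" using \<rho>d[OF i(1)] by (auto simp: \<psi>_def)
      then show "\<psi> y \<in> cube_bd ?d" using \<psi>_cube[OF y] \<rho>d[OF i(1)] by (auto simp: cube_bd_def)
    qed
    show "\<theta> ` cube_bd ?d \<subseteq> ?b"
    proof (rule image_subsetI)
      fix z assume z: "z \<in> cube_bd ?d"
      then obtain k where k: "k < ?d" "\<bar>z k\<bar> = 1" by (auto simp: cube_bd_def)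
      then have "z k = 1 \<or> z k = -1" by linarith
      then have "N * \<theta> z (\<pi> k) = lo (\<pi> k) \<or> N * \<theta> z (\<pi> k) = lo (\<pi> k) + 1"
        unfolding \<theta>N[OF \<pi>A[OF k(1)]] \<rho>\<pi>[OF k(1)] by auto
      moreover have "\<theta> z \<in> grid_cell N x" using \<theta>_cell z by (auto simp: cube_bd_def)
      ultimately show "\<theta> z \<in> ?b" unfolding b_iff using \<pi>A[OF k(1)] by blast
    qed
    fix y assume y: "y \<in> grid_cell N x"
    show "\<theta> (\<psi> y) = y"
    proof
      fix i show "\<theta> (\<psi> y) i = y i"
        using y N \<rho>d[of i] unfolding cell_iff by (cases "i \<in> ?A") (auto simp: \<theta>_def \<psi>_def field_simps)
    qed
  qed
qed

text \<open>On a proper face some free coordinate reaches a grid point and freezes. This drop in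
  dimension pays for the weaker hypothesis on the intersection in
  \<open>conn_upto_open_union\<close>.\<close>

lemma free_coords_psubset:
  assumes N: "N > 0" and y: "y \<in> grid_cell N x" "grid_cell N y \<noteq> grid_cell N x"
  shows "free_coords N y \<subset> free_coords N x"
proof -
  have sub: "free_coords N y \<subseteq> free_coords N x"
    using grid_cell_fixed[OF N y(1)] by (force simp: free_coords_def)
  obtain i where i: "i \<in> free_coords N x" "\<not> (of_int \<lfloor>N * x i\<rfloor> < N * y i \<and> N * y i < of_int \<lfloor>N * x i\<rfloor> + 1)"
    using y grid_cell_eq_iff[OF N y(1)] by blast
  have "of_int \<lfloor>N * x i\<rfloor> \<le> N * y i" "N * y i \<le> of_int \<lfloor>N * x i\<rfloor> + 1"
    using y(1) free_coordsD(1)[OF i(1)] by (auto simp: grid_cell_def) (metis of_int_1 of_int_add)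
  then have "N * y i = of_int \<lfloor>N * x i\<rfloor> \<or> N * y i = of_int (\<lfloor>N * x i\<rfloor> + 1)" using i(2) by auto
  then have "i \<notin> free_coords N y"
    unfolding free_coords_def by (metis (no_types, lifting) ceiling_of_int floor_of_int less_irrefl mem_Collect_eq)
  then show ?thesis using sub i(1) by blast
qed

text \<open>The metric of \<open>nat \<Rightarrow> real\<close> is dominated by the first
  coordinates: a distance is at most twice their maximal distance plus a tail (1/2)^M. A bound 1/N
  in every coordinate therefore makes all cells small at once.\<close>

lemma grid_cell_small:
  assumes \<delta>: "\<delta> > 0"
  obtains N :: nat where "N > 0" "\<And>x. diameter (grid_cell N x) < \<delta>"
proof -
  \<comment> \<open>The tail is below \<delta>/4 by the choice of M, and 2/N is below \<delta>/4 as
    N > 8/\<delta>. The bound \<delta>/2 on distances passes to their supremum and so keeps the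
    diameter strictly below \<delta>.\<close>
  obtain M :: nat where M: "(1/2 :: real) ^ M < \<delta> / 4"
    using real_arch_pow_inv[of "\<delta> / 4" "1/2"] \<delta> by auto
  obtain N :: nat where N: "real N > 8 / \<delta>" using reals_Archimedean2 by blast
  have N0: "real N > 0" using N \<delta> by (meson divide_pos_pos less_trans zero_less_numeral)
  have N1: "1 / N < \<delta> / 8" using N N0 \<delta> by (simp add: field_simps)
  have "dist y z \<le> \<delta> / 2" if "y \<in> grid_cell N x" "z \<in> grid_cell N x" for x y z
  proof -
    have d: "dist (y i) (z i) \<le> 1 / N" for i
    proof -
      have "\<lceil>N * x i\<rceil> \<le> \<lfloor>N * x i\<rfloor> + 1" using ceiling_diff_floor_le_1[of "N * x i"] by linarith
      then have "real_of_int \<lceil>N * x i\<rceil> \<le> of_int \<lfloor>N * x i\<rfloor> + 1" by linarith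
      moreover have "of_int \<lfloor>N * x i\<rfloor> \<le> N * y i" "N * y i \<le> of_int \<lceil>N * x i\<rceil>"
         "of_int \<lfloor>N * x i\<rfloor> \<le> N * z i" "N * z i \<le> of_int \<lceil>N * x i\<rceil>"
        using that by (auto simp: grid_cell_def)
      ultimately have "\<bar>N * y i - N * z i\<bar> \<le> 1" by linarith
      then have "N * \<bar>y i - z i\<bar> \<le> 1" using N0
        by (metis abs_mult abs_of_pos right_diff_distrib)
      then show ?thesis using N0 by (simp add: dist_real_def field_simps)
    qed
    have "dist y z \<le> 2 * Max {dist (y (from_nat n)) (z (from_nat n))|n. n \<le> M} + (1/2)^M"
      by (rule dist_fun_le_dist_first_terms)
    moreover have "Max {dist (y (from_nat n)) (z (from_nat n))|n. n \<le> M} \<le> 1 / N"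
      by (rule Max.boundedI) (use d in auto)
    ultimately show ?thesis using M N1 by linarith
  qed
  note near = this
  have "diameter (grid_cell N x) \<le> \<delta> / 2" for x
  proof -
    have "grid_cell N x \<noteq> {}" using grid_cell_self by blast
    moreover have "(SUP p\<in>grid_cell N x \<times> grid_cell N x. dist (fst p) (snd p)) \<le> \<delta> / 2"
      by (rule cSUP_least) (use near calculation in auto)
    ultimately show ?thesis by (simp add: diameter_def case_prod_beta)
  qed
  moreover have "\<delta> / 2 < \<delta>" using \<delta> by simp
  ultimately have "diameter (grid_cell N x) < \<delta>" for x using order.strict_trans1 by blast
  then show thesis using that N0 by auto
qed

text \<open>A fine grid on the boundary of the cube makes every cell land in \<open>U\<close> or in \<open>V\<close>. The map is
  contracted cell by cell: non-maximal cells landing in both sets are contracted inside \<open>U \<inter> V\<close>,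
  and since their dimension is at most \<open>j - 2\<close>, the weaker hypothesis on \<open>U \<inter> V\<close> suffices.\<close>

theorem conn_upto_open_union:
  assumes U: "openin X U" and V: "openin X V" and UV: "topspace X \<subseteq> U \<union> V"
    and cU: "conn_upto m (subtopology X U)" and cV: "conn_upto m (subtopology X V)"
    and cUV: "conn_upto (m - 1) (subtopology X (U \<inter> V))"
  shows "conn_upto m X"
  unfolding conn_upto_def
proof (intro allI impI)
  fix j assume j: "int j \<le> m"
  show "sphere_null j X"
  proof (cases "j = 0")
    case True
    then have "sphere_null 0 (subtopology X U)" using cU j by (auto simp: conn_upto_def)
    then show ?thesis using True by (auto simp: sphere_null_0)
  next
    case False
    show ?thesis
      unfolding sphere_null_def
    proof (intro allI impI)
      fix f assume f: "continuous_map (top_of_set (cube_bd j)) X f"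
      have fX: "f x \<in> topspace X" if "x \<in> cube_bd j" for x
        using f that by (auto simp: continuous_map_def)
      \<comment> \<open>As j > 0, the hypothesis on the intersection covers dimension 0 and provides
        a point; as the end of the contraction it lies in every target set.\<close>
      have "sphere_null 0 (subtopology X (U \<inter> V))" using cUV j False by (auto simp: conn_upto_def)
      then obtain y0 where y0: "y0 \<in> topspace X" "y0 \<in> U" "y0 \<in> V" by (auto simp: sphere_null_0)
      obtain OU where OU: "open OU" "{x \<in> cube_bd j. f x \<in> U} = cube_bd j \<inter> OU"
        using openin_continuous_map_preimage[OF f U] by (auto simp: openin_open)
      obtain OV where OV: "open OV" "{x \<in> cube_bd j. f x \<in> V} = cube_bd j \<inter> OV"
        using openin_continuous_map_preimage[OF f V] by (auto simp: openin_open)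
      have fU: "f x \<in> U \<longleftrightarrow> x \<in> OU" and fV: "f x \<in> V \<longleftrightarrow> x \<in> OV" if "x \<in> cube_bd j" for x
        using that OU OV by blast+
      have cov0: "cube_bd j \<subseteq> \<Union>{OU, OV}"
      proof
        fix x assume x: "x \<in> cube_bd j"
        then have "f x \<in> U \<or> f x \<in> V" using fX UV by blast
        then show "x \<in> \<Union>{OU, OV}" using fU[OF x] fV[OF x] by simp
      qed
      have ne: "{OU, OV} \<noteq> {}" by simp
      have ope: "open B" if "B \<in> {OU, OV}" for B using that OU OV by auto
      obtain \<delta> where \<delta>: "\<delta> > 0" "\<And>S. S \<subseteq> cube_bd j \<Longrightarrow> diameter S < \<delta> \<Longrightarrow> \<exists>B\<in>{OU, OV}. S \<subseteq> B"
        by (rule Lebesgue_number_lemma[OF compact_cube_bd[of j] ne cov0 ope])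
          (assumption, rule that, assumption, simp only:)
      obtain N where N: "N > 0" and Nd: "\<And>x. diameter (grid_cell N x) < \<delta>"
        by (rule grid_cell_small[OF \<delta>(1)]) (rule that, assumption, simp only:)
      let ?c = "grid_cell N" and ?Z = "cube_bd j"
      have sub: "?c x \<subseteq> ?Z" if "x \<in> ?Z" for x using grid_cell_in_cube_bd[OF N that] by blast
      have cov: "?c x \<subseteq> OU \<or> ?c x \<subseteq> OV" if "x \<in> ?Z" for x
        using \<delta>(2)[OF sub[OF that] Nd] by blast
      \<comment> \<open>A cell inside both sets may be a face of one cell sent to U and of another
        sent to V, and monotonicity then demands the intersection. A maximal cell is a proper face
        of none and gets a single set, which keeps the top dimension away from the
        intersection.\<close>
      define T where "T = (\<lambda>c. if c \<subseteq> OU \<and> c \<subseteq> OV \<and> (\<exists>x\<in>?Z. c \<subset> ?c x) then U \<inter> V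
          else if c \<subseteq> OU then U else V)"
      have T_mono: "T (?c y) \<subseteq> T (?c x)" if "x \<in> ?Z" "y \<in> ?c x" for x y
      proof (cases "?c y = ?c x")
        case False
        then have "?c y \<subset> ?c x" using grid_cell_mono[OF that(2)] by blast
        then show ?thesis using cov[OF that(1)] that(1) unfolding T_def by auto
      qed simp
      have T_nul: "sphere_null (Suc (card (free_coords N x))) (subtopology X (T (?c x)))" if x: "x \<in> ?Z" for x
      proof (cases "?c x \<subseteq> OU \<and> ?c x \<subseteq> OV \<and> (\<exists>z\<in>?Z. ?c x \<subset> ?c z)")
        case True
        then obtain z where z: "z \<in> ?Z" "?c x \<subset> ?c z" by blast
        have "x \<in> ?c z" using z grid_cell_self by blast
        then have "card (free_coords N x) < card (free_coords N z)"
          using free_coords_psubset[OF N, of x z] z(2) free_coords_cube_bd(1)[OF z(1), of N]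
          by (metis less_irrefl psubset_card_mono)
        also have "\<dots> < j" by (rule free_coords_cube_bd(2)[OF z(1)])
        finally have "int (Suc (card (free_coords N x))) \<le> m - 1" using j \<open>_ < card (free_coords N z)\<close> \<open>_ < j\<close> by linarith
        then show ?thesis using True cUV by (simp add: T_def conn_upto_def)
      next
        case False
        have "int (Suc (card (free_coords N x))) \<le> m" using free_coords_cube_bd(2)[OF x, of N] j by linarith
        then have "sphere_null (Suc (card (free_coords N x))) (subtopology X U)"
          "sphere_null (Suc (card (free_coords N x))) (subtopology X V)" using cU cV by (simp_all add: conn_upto_def)
        then show ?thesis using False unfolding T_def by auto
      qed
      have T_f: "continuous_map (top_of_set (?c x)) (subtopology X (T (?c x))) f" if x: "x \<in> ?Z" for x
      proof -
        have "continuous_map (top_of_set (?c x)) X f"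
          using continuous_map_from_subtopology[OF f, of "?c x"] sub[OF x]
          by (simp add: subtopology_subtopology inf.absorb2)
        moreover have "f y \<in> T (?c x)" if "y \<in> ?c x" for y
        proof -
          have "y \<in> ?Z" using sub[OF x] that by blast
          then show ?thesis using that cov[OF x] fU fV unfolding T_def by auto
        qed
        ultimately show ?thesis by (auto simp: continuous_map_in_subtopology)
      qed
      have fin: "finite (?c ` ?c x)" if "x \<in> ?Z" for x
        using finite_subset[OF image_mono[OF sub[OF that]] finite_grid_cells] .
      have cl: "cell_like (card (free_coords N x)) (?c x) {y \<in> ?c x. ?c y \<noteq> ?c x}" if "x \<in> ?Z" for x
        by (rule grid_cell_like[OF N free_coords_cube_bd(1)[OF that]])
      have T_y0: "y0 \<in> T (?c x)" for x using y0 by (simp add: T_def)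
      have sub2: "y \<in> ?Z \<and> ?c y \<subseteq> ?c x" if "x \<in> ?Z" "y \<in> ?c x" for x y
        using sub[OF that(1)] that(2) grid_cell_mono[OF that(2)] by blast
      obtain H where H: "\<And>x. x \<in> ?Z \<Longrightarrow> continuous_map (top_of_set ({0..1::real} \<times> ?c x)) (subtopology X (T (?c x))) H"
        and H0: "\<And>x. x \<in> ?Z \<Longrightarrow> H (0, x) = f x" and H1: "\<And>x. x \<in> ?Z \<Longrightarrow> H (1, x) = y0"
        by (rule cellwise_null_homotopy[of ?Z ?c "\<lambda>x. card (free_coords N x)" T X f y0])
          (rule grid_cell_self sub2 fin closed_grid_cell cl T_mono T_nul T_f T_y0 y0(1) that | assumption)+
      have "continuous_map (top_of_set ({0..1} \<times> ?Z)) X H"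
      proof (rule continuous_map_closed_cover)
        show "finite ((\<lambda>c. {0..1::real} \<times> c) ` ?c ` ?Z)" using finite_grid_cells by blast
        show "topspace (top_of_set ({0..1} \<times> ?Z)) \<subseteq> \<Union> ((\<lambda>c. {0..1} \<times> c) ` ?c ` ?Z)"
          using grid_cell_self by fastforce
        fix S assume "S \<in> (\<lambda>c. {0..1::real} \<times> c) ` ?c ` ?Z"
        then obtain x where x: "x \<in> ?Z" "S = {0..1} \<times> ?c x" by blast
        have SZ: "S \<subseteq> {0..1} \<times> ?Z" using sub x by blast
        have "closed S" using closed_grid_cell x by (auto intro: closed_Times)
        then show "closedin (top_of_set ({0..1} \<times> ?Z)) S" using SZ closed_subset by blast
        show "continuous_map (subtopology (top_of_set ({0..1} \<times> ?Z)) S) X H"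
          using H[OF x(1)] SZ x(2) by (simp add: subtopology_subtopology inf.absorb2 continuous_map_in_subtopology)
      qed
      then have "homotopic_with (\<lambda>_. True) (top_of_set ?Z) X f (\<lambda>_. y0)"
        by (subst homotopic_with) (use H0 H1 in auto)
      then show "\<exists>a\<in>topspace X. homotopic_with (\<lambda>_. True) (top_of_set (cube_bd j)) X f (\<lambda>_. a)"
        using y0 by blast
    qed
  qed
qed

section \<open>Order complexes of finite posets\<close>

definition order_points :: "('p::order) set \<Rightarrow> ('p \<Rightarrow> real) set" where
  "order_points P = \<Union> (geom_simplex ` order_complex P)"

text \<open>For finite P the simplices disappear from the description: a point is a weight of total
  mass 1 supported on a chain. The retractions and segments below are checked in this form.\<close>

lemma order_points_iff:
  assumes "finite P"
  shows "\<alpha> \<in> order_points P \<longleftrightarrow> (\<forall>v. 0 \<le> \<alpha> v) \<and> (\<forall>v. v \<notin> P \<longrightarrow> \<alpha> v = 0) \<and>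
    (\<forall>u v. \<alpha> u \<noteq> 0 \<longrightarrow> \<alpha> v \<noteq> 0 \<longrightarrow> u \<le> v \<or> v \<le> u) \<and> sum \<alpha> P = 1"
proof
  assume "\<alpha> \<in> order_points P"
  then obtain C where C: "C \<subseteq> P" "Complete_Partial_Order.chain (\<le>) C"
    and \<alpha>: "\<forall>v. 0 \<le> \<alpha> v" "\<forall>v. v \<notin> C \<longrightarrow> \<alpha> v = 0" "sum \<alpha> C = 1"
    by (auto simp: order_points_def order_complex_def geom_simplex_def)
  have "sum \<alpha> C = sum \<alpha> P" by (rule sum.mono_neutral_left) (use assms C \<alpha> in auto)
  then show "(\<forall>v. 0 \<le> \<alpha> v) \<and> (\<forall>v. v \<notin> P \<longrightarrow> \<alpha> v = 0) \<and>
    (\<forall>u v. \<alpha> u \<noteq> 0 \<longrightarrow> \<alpha> v \<noteq> 0 \<longrightarrow> u \<le> v \<or> v \<le> u) \<and> sum \<alpha> P = 1"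
    using C \<alpha> by (metis chain_def subsetD)
next
  assume \<alpha>: "(\<forall>v. 0 \<le> \<alpha> v) \<and> (\<forall>v. v \<notin> P \<longrightarrow> \<alpha> v = 0) \<and>
    (\<forall>u v. \<alpha> u \<noteq> 0 \<longrightarrow> \<alpha> v \<noteq> 0 \<longrightarrow> u \<le> v \<or> v \<le> u) \<and> sum \<alpha> P = 1"
  define C where "C = {v \<in> P. \<alpha> v \<noteq> 0}"
  have "sum \<alpha> C = sum \<alpha> P" by (rule sum.mono_neutral_left) (use assms C_def in auto)
  then have s: "sum \<alpha> C = 1" using \<alpha> by simp
  then have "C \<noteq> {}" by auto
  moreover have "C \<subseteq> P" "Complete_Partial_Order.chain (\<le>) C" using \<alpha> by (auto simp: C_def chain_def)
  ultimately have "C \<in> order_complex P"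
    using assms finite_subset by (auto simp: order_complex_def)
  moreover have "\<alpha> \<in> geom_simplex C" using \<alpha> s by (auto simp: geom_simplex_def C_def)
  ultimately show "\<alpha> \<in> order_points P" by (auto simp: order_points_def)
qed

text \<open>Comparability across the two supports makes their union a chain, so both points lie in
  one simplex, and simplices are convex.\<close>

lemma order_points_segment:
  assumes P: "finite P" and \<alpha>: "\<alpha> \<in> order_points P" and \<beta>: "\<beta> \<in> order_points P"
    and comp: "\<And>u v. \<alpha> u \<noteq> 0 \<Longrightarrow> \<beta> v \<noteq> 0 \<Longrightarrow> u \<le> v \<or> v \<le> u"
    and t: "0 \<le> t" "t \<le> 1"
  shows "(\<lambda>v. (1 - t) * \<alpha> v + t * \<beta> v) \<in> order_points P"
proof -
  have a: "\<And>v. 0 \<le> \<alpha> v" "\<And>v. v \<notin> P \<Longrightarrow> \<alpha> v = 0" "\<And>u v. \<alpha> u \<noteq> 0 \<Longrightarrow> \<alpha> v \<noteq> 0 \<Longrightarrow> u \<le> v \<or> v \<le> u" "sum \<alpha> P = 1"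
    and b: "\<And>v. 0 \<le> \<beta> v" "\<And>v. v \<notin> P \<Longrightarrow> \<beta> v = 0" "\<And>u v. \<beta> u \<noteq> 0 \<Longrightarrow> \<beta> v \<noteq> 0 \<Longrightarrow> u \<le> v \<or> v \<le> u" "sum \<beta> P = 1"
    using \<alpha> \<beta> unfolding order_points_iff[OF P] by blast+
  show ?thesis
    unfolding order_points_iff[OF P]
  proof (intro conjI allI impI)
    fix v show "0 \<le> (1 - t) * \<alpha> v + t * \<beta> v" using a(1) b(1) t by simp
  next
    fix v assume "v \<notin> P" then show "(1 - t) * \<alpha> v + t * \<beta> v = 0" using a(2) b(2) by simp
  next
    fix u v assume "(1 - t) * \<alpha> u + t * \<beta> u \<noteq> 0" "(1 - t) * \<alpha> v + t * \<beta> v \<noteq> 0"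
    then have "\<alpha> u \<noteq> 0 \<or> \<beta> u \<noteq> 0" "\<alpha> v \<noteq> 0 \<or> \<beta> v \<noteq> 0" by auto
    then show "u \<le> v \<or> v \<le> u" using a(3) b(3) comp by blast
  next
    show "(\<Sum>v\<in>P. (1 - t) * \<alpha> v + t * \<beta> v) = 1"
      using a(4) b(4) by (simp add: sum.distrib flip: sum_distrib_left)
  qed
qed

lemma continuous_on_coord: "continuous_on A (\<lambda>\<alpha> :: 'v \<Rightarrow> real. \<alpha> v)"
  by (rule continuous_on_product_then_coordinatewise) (rule continuous_on_id)

lemma homotopic_with_segment:
  fixes f g :: "'z::topological_space \<Rightarrow> 'v \<Rightarrow> real"
  assumes f: "continuous_on A f" and g: "continuous_on A g"
    and seg: "\<And>x t. x \<in> A \<Longrightarrow> 0 \<le> t \<Longrightarrow> t \<le> 1 \<Longrightarrow> (\<lambda>v. (1 - t) * f x v + t * g x v) \<in> B"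
  shows "homotopic_with (\<lambda>_. True) (top_of_set A) (top_of_set B) f g"
proof -
  have "continuous_on ({0..1} \<times> A) (\<lambda>p. (\<lambda>v. (1 - fst p) * f (snd p) v + fst p * g (snd p) v))"
  proof (rule continuous_on_coordinatewise_then_product)
    fix v
    have "continuous_on ({0..1::real} \<times> A) (\<lambda>p. f (snd p) v)" "continuous_on ({0..1::real} \<times> A) (\<lambda>p. g (snd p) v)"
      by (rule continuous_on_product_then_coordinatewise, rule continuous_on_compose2[OF f] continuous_on_compose2[OF g],
          auto intro: continuous_on_snd continuous_on_id)+
    then show "continuous_on ({0..1} \<times> A) (\<lambda>p. (1 - fst p) * f (snd p) v + fst p * g (snd p) v)"
      by (intro continuous_on_add continuous_on_mult continuous_on_diff continuous_on_const continuous_on_fst continuous_on_id)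
  qed
  then have "continuous_map (prod_topology (top_of_set {0..1}) (top_of_set A)) (top_of_set B)
      (\<lambda>p. (\<lambda>v. (1 - fst p) * f (snd p) v + fst p * g (snd p) v))"
    using seg by auto
  then show ?thesis unfolding homotopic_with_def
    by (intro exI[of _ "\<lambda>p. (\<lambda>v. (1 - fst p) * f (snd p) v + fst p * g (snd p) v)"]) auto
qed

section \<open>Cones and the attachment of a vertex\<close>

definition vertex :: "'v \<Rightarrow> 'v \<Rightarrow> real" where
  "vertex p = (\<lambda>v. if v = p then 1 else 0)"

lemma vertex_in_order_points: "finite P \<Longrightarrow> p \<in> P \<Longrightarrow> vertex p \<in> order_points P"
  by (simp add: order_points_iff vertex_def)

lemma star_shaped_conn_upto:
  assumes "vertex p \<in> B"
    and "\<And>\<alpha> t. \<alpha> \<in> B \<Longrightarrow> 0 \<le> t \<Longrightarrow> t \<le> 1 \<Longrightarrow> (\<lambda>v. (1 - t) * \<alpha> v + t * vertex p v) \<in> B"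
  shows "conn_upto m (top_of_set B)"
proof -
  have "homotopic_with (\<lambda>_. True) (top_of_set B) (top_of_set B) id (\<lambda>_. vertex p)"
    by (rule homotopic_with_segment) (use assms in auto)
  then have "contractible_nonempty (top_of_set B)"
    using assms(1) unfolding contractible_nonempty_def contractible_space_def by auto
  then show ?thesis by (simp add: conn_upto_def sphere_null_contractible)
qed

text \<open>Every chain stays a chain after adding p, so all points move straight to p. Such cones
  are the starting stages of the filtrations below and, where no connectivity may be lost, the links
  along which vertices are attached.\<close>

lemma cone_conn_upto:
  assumes P: "finite P" "p \<in> P" and cone: "\<And>q. q \<in> P \<Longrightarrow> q \<le> p \<or> p \<le> q"
  shows "conn_upto m (top_of_set (order_points P))"
proof (rule star_shaped_conn_upto[OF vertex_in_order_points[OF P]])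
  fix \<alpha> and t :: real assume \<alpha>: "\<alpha> \<in> order_points P" and t: "0 \<le> t" "t \<le> 1"
  show "(\<lambda>v. (1 - t) * \<alpha> v + t * vertex p v) \<in> order_points P"
  proof (rule order_points_segment[OF P(1) \<alpha> vertex_in_order_points[OF P] _ t])
    fix u v assume "\<alpha> u \<noteq> 0" "vertex p v \<noteq> 0"
    then have "u \<in> P" "v = p" using \<alpha> P by (auto simp: order_points_iff vertex_def split: if_splits)
    then show "u \<le> v \<or> v \<le> u" using cone by blast
  qed
qed

lemma conn_upto_dominated:
  assumes "conn_upto m Y" "continuous_map X Y r" "continuous_map Y X i" "homotopic_with (\<lambda>_. True) X X (i \<circ> r) id"
  shows "conn_upto m X"
  using assms sphere_null_dominated unfolding conn_upto_def by blast

text \<open>U omits the new vertex and deforms onto the old complex, V is the open star of p and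
  contracts to p, and U \<inter> V is an open collar that deforms onto the link. The gluing theorem
  asks one degree less of the intersection, hence of the link.\<close>

theorem conn_upto_add_vertex:
  fixes Q :: "('p::order) set"
  assumes Q: "finite Q" "p \<notin> Q" and cQ: "conn_upto m (top_of_set (order_points Q))"
    and cL: "conn_upto (m - 1) (top_of_set (order_points {q \<in> Q. q < p \<or> p < q}))"
  shows "conn_upto m (top_of_set (order_points (insert p Q)))"
proof -
  let ?P = "insert p Q" and ?L = "{q \<in> Q. q < p \<or> p < q}"
  let ?Y = "order_points ?P"
  have P: "finite ?P" and L: "finite ?L" using Q by auto
  have Y: "\<And>v. 0 \<le> \<alpha> v" "\<And>v. v \<notin> ?P \<Longrightarrow> \<alpha> v = 0" "\<And>u v. \<alpha> u \<noteq> 0 \<Longrightarrow> \<alpha> v \<noteq> 0 \<Longrightarrow> u \<le> v \<or> v \<le> u"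
     "\<alpha> p + sum \<alpha> Q = 1" if "\<alpha> \<in> ?Y" for \<alpha>
    using that Q unfolding order_points_iff[OF P] by auto
  define U where "U = {\<alpha> \<in> ?Y. \<alpha> p < 1}"
  define V where "V = {\<alpha> \<in> ?Y. 0 < \<alpha> p}"
  \<comment> \<open>\<open>r\<close> projects radially away from p; \<open>i\<close> places the link
    at height 1/2, halfway to p.\<close>
  define r where "r = (\<lambda>(\<alpha> :: 'p \<Rightarrow> real) v. if v = p then 0 else \<alpha> v / (1 - \<alpha> p))"
  define i where "i = (\<lambda>(\<beta> :: 'p \<Rightarrow> real) v. if v = p then 1 / 2 else \<beta> v / 2)"
  have "open {\<alpha> :: 'p \<Rightarrow> real. \<alpha> p < 1}" "open {\<alpha> :: 'p \<Rightarrow> real. 0 < \<alpha> p}"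
    by (intro open_Collect_less continuous_on_const continuous_on_coord)+
  moreover have "U = ?Y \<inter> {\<alpha>. \<alpha> p < 1}" "V = ?Y \<inter> {\<alpha>. 0 < \<alpha> p}" by (auto simp: U_def V_def)
  ultimately have op: "openin (top_of_set ?Y) U" "openin (top_of_set ?Y) V" by (auto simp: openin_open)
  have cont_r: "continuous_on A r" if "A \<subseteq> U" for A
    unfolding r_def
  proof (rule continuous_on_coordinatewise_then_product)
    fix v show "continuous_on A (\<lambda>\<alpha>. if v = p then 0 else \<alpha> v / (1 - \<alpha> p))"
      using that by (cases "v = p") (auto simp: U_def intro!: continuous_on_divide continuous_on_diff continuous_on_const continuous_on_coord)
  qed
  have cont_i: "continuous_on A i" for A
    unfolding i_def
  proof (rule continuous_on_coordinatewise_then_product)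
    fix v show "continuous_on A (\<lambda>\<alpha> :: 'p \<Rightarrow> real. if v = p then 1 / 2 else \<alpha> v / 2)"
      by (cases "v = p") (auto intro!: continuous_on_divide continuous_on_const continuous_on_coord)
  qed
  have r_nz: "\<alpha> v \<noteq> 0 \<and> v \<noteq> p" if "r \<alpha> v \<noteq> 0" for \<alpha> v
    using that by (auto simp: r_def split: if_splits)
  have r_Q: "r \<alpha> \<in> order_points Q" if "\<alpha> \<in> U" for \<alpha>
  proof -
    have a: "\<alpha> \<in> ?Y" "\<alpha> p < 1" using that by (auto simp: U_def)
    have "sum (r \<alpha>) Q = (\<Sum>v\<in>Q. \<alpha> v / (1 - \<alpha> p))"
      by (rule sum.cong) (use Q in \<open>auto simp: r_def\<close>)
    also have "\<dots> = 1" using Y(4)[OF a(1)] a(2) by (simp flip: sum_divide_distrib)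
    finally have sum1: "sum (r \<alpha>) Q = 1" .
    show ?thesis
      unfolding order_points_iff[OF Q(1)]
    proof (intro conjI allI impI sum1)
      fix v
      show "0 \<le> r \<alpha> v" using Y(1)[OF a(1), of v] a(2) by (simp add: r_def)
      show "r \<alpha> v = 0" if "v \<notin> Q" using Y(2)[OF a(1), of v] that by (simp add: r_def)
      show "u \<le> v \<or> v \<le> u" if "r \<alpha> u \<noteq> 0" "r \<alpha> v \<noteq> 0" for u
        using Y(3)[OF a(1), of u v] r_nz[OF that(1)] r_nz[OF that(2)] by simp
    qed
  qed
  have QY: "\<beta> \<in> ?Y \<and> \<beta> p = 0" if "\<beta> \<in> order_points Q" for \<beta>
    using that Q unfolding order_points_iff[OF P] order_points_iff[OF Q(1)] by auto
  have LQ: "\<beta> \<in> order_points Q" if "\<beta> \<in> order_points ?L" for \<beta>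
    using that unfolding order_points_def order_complex_def by blast
  have r_L: "r \<alpha> \<in> order_points ?L" if "\<alpha> \<in> U \<inter> V" for \<alpha>
  proof -
    have a: "\<alpha> \<in> ?Y" "0 < \<alpha> p" using that by (auto simp: V_def)
    have rQ: "r \<alpha> \<in> order_points Q" using r_Q that by blast
    have z: "r \<alpha> v = 0" if "v \<notin> ?L" for v
    proof (rule ccontr)
      assume nz: "r \<alpha> v \<noteq> 0"
      then have "v \<in> Q" using rQ unfolding order_points_iff[OF Q(1)] by blast
      moreover have "v \<le> p \<or> p \<le> v" using Y(3)[OF a(1), of v p] r_nz[OF nz] a(2) by simp
      moreover have "v \<noteq> p" using r_nz[OF nz] by blast
      ultimately show False using that by (auto simp: less_le)
    qed
    have "sum (r \<alpha>) ?L = sum (r \<alpha>) Q"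
      by (rule sum.mono_neutral_left) (use Q z in auto)
    moreover have "\<And>v. 0 \<le> r \<alpha> v" "\<And>u v. r \<alpha> u \<noteq> 0 \<Longrightarrow> r \<alpha> v \<noteq> 0 \<Longrightarrow> u \<le> v \<or> v \<le> u" "sum (r \<alpha>) Q = 1"
      using rQ unfolding order_points_iff[OF Q(1)] by blast+
    ultimately show ?thesis unfolding order_points_iff[OF L] using z by simp
  qed
  have i_Y: "i \<beta> \<in> U \<inter> V" if \<beta>: "\<beta> \<in> order_points ?L" for \<beta>
  proof -
    have b: "\<And>v. 0 \<le> \<beta> v" "\<And>v. v \<notin> ?L \<Longrightarrow> \<beta> v = 0" "\<And>u v. \<beta> u \<noteq> 0 \<Longrightarrow> \<beta> v \<noteq> 0 \<Longrightarrow> u \<le> v \<or> v \<le> u"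
      using \<beta> unfolding order_points_iff[OF L] by blast+
    have bQ: "sum \<beta> Q = 1" using LQ[OF \<beta>] unfolding order_points_iff[OF Q(1)] by blast
    have "sum (i \<beta>) Q = (\<Sum>v\<in>Q. \<beta> v / 2)" by (rule sum.cong) (use Q in \<open>auto simp: i_def\<close>)
    then have "sum (i \<beta>) ?P = 1" using Q bQ by (simp add: i_def flip: sum_divide_distrib)
    moreover have "u \<le> v \<or> v \<le> u" if "i \<beta> u \<noteq> 0" "i \<beta> v \<noteq> 0" for u v
    proof -
      have "w = p \<or> \<beta> w \<noteq> 0 \<and> (w < p \<or> p < w)" if "i \<beta> w \<noteq> 0" for w
        using that b(2)[of w] by (auto simp: i_def split: if_splits)
      then show ?thesis using that b(3)[of u v] by (metis less_imp_le order_refl)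
    qed
    moreover have "0 \<le> i \<beta> v" for v using b(1)[of v] by (simp add: i_def)
    moreover have "i \<beta> v = 0" if "v \<notin> ?P" for v using b(2)[of v] that by (simp add: i_def)
    ultimately have "i \<beta> \<in> ?Y" unfolding order_points_iff[OF P] by blast
    then show ?thesis by (simp add: U_def V_def i_def)
  qed
  have "conn_upto m (subtopology (top_of_set ?Y) U)"
  proof -
    have "homotopic_with (\<lambda>_. True) (top_of_set U) (top_of_set U) (id \<circ> r) id"
    proof (rule homotopic_with_segment)
      fix \<alpha> and t :: real assume \<alpha>: "\<alpha> \<in> U" and t: "0 \<le> t" "t \<le> 1"
      have aY: "\<alpha> \<in> ?Y" "\<alpha> p < 1" using \<alpha> by (auto simp: U_def)
      have "(\<lambda>v. (1 - t) * r \<alpha> v + t * \<alpha> v) \<in> ?Y"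
        by (rule order_points_segment[OF P _ aY(1) _ t]) (use QY[OF r_Q[OF \<alpha>]] Y(3)[OF aY(1)] r_nz in blast)+
      moreover have "t * \<alpha> p < 1" using aY t Y(1)[OF aY(1), of p]
        by (metis dual_order.strict_trans2 leI mult_left_le_one_le not_less order_less_le_trans)
      ultimately show "(\<lambda>v. (1 - t) * (id \<circ> r) \<alpha> v + t * id \<alpha> v) \<in> U"
        by (simp add: U_def r_def)
    qed (use cont_r in auto)
    then have "conn_upto m (top_of_set U)"
    proof (rule conn_upto_dominated[OF cQ, rotated 2])
      show "continuous_map (top_of_set U) (top_of_set (order_points Q)) r" using cont_r r_Q by auto
      have "order_points Q \<subseteq> U"
      proof
        fix \<beta> assume "\<beta> \<in> order_points Q"
        then show "\<beta> \<in> U" using QY[of \<beta>] by (simp add: U_def)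
      qed
      then show "continuous_map (top_of_set (order_points Q)) (top_of_set U) id" by auto
    qed
    moreover have "?Y \<inter> U = U" by (auto simp: U_def)
    ultimately show ?thesis by (simp add: subtopology_subtopology)
  qed
  moreover have "conn_upto m (subtopology (top_of_set ?Y) V)"
  proof -
    have vY: "vertex p \<in> ?Y" by (rule vertex_in_order_points[OF P]) simp
    have "conn_upto m (top_of_set V)"
    proof (rule star_shaped_conn_upto)
      show "vertex p \<in> V" using vY by (simp add: V_def vertex_def)
      fix \<alpha> and t :: real assume \<alpha>: "\<alpha> \<in> V" and t: "0 \<le> t" "t \<le> 1"
      have aY: "\<alpha> \<in> ?Y" "0 < \<alpha> p" using \<alpha> by (auto simp: V_def)
      have "(\<lambda>v. (1 - t) * \<alpha> v + t * vertex p v) \<in> ?Y"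
      proof (rule order_points_segment[OF P aY(1) vY _ t])
        fix u v assume "\<alpha> u \<noteq> 0" "vertex p v \<noteq> 0"
        then show "u \<le> v \<or> v \<le> u" using Y(3)[OF aY(1), of u p] aY(2) by (auto simp: vertex_def split: if_splits)
      qed
      moreover have "(1 - t) * \<alpha> p + t * vertex p p > 0"
        using aY(2) t by (cases "t = 0") (auto simp: vertex_def intro: add_nonneg_pos)
      ultimately show "(\<lambda>v. (1 - t) * \<alpha> v + t * vertex p v) \<in> V" by (simp add: V_def)
    qed
    moreover have "?Y \<inter> V = V" by (auto simp: V_def)
    ultimately show ?thesis by (simp add: subtopology_subtopology)
  qed
  moreover have "conn_upto (m - 1) (subtopology (top_of_set ?Y) (U \<inter> V))"
  proof -
    \<comment> \<open>The support of \<open>i (r \<alpha>)\<close> lies in that of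
      \<open>\<alpha>\<close>, so the straight homotopy stays in one simplex; only the height above
      the link changes.\<close>
    have "homotopic_with (\<lambda>_. True) (top_of_set (U \<inter> V)) (top_of_set (U \<inter> V)) (i \<circ> r) id"
    proof (rule homotopic_with_segment)
      show "continuous_on (U \<inter> V) (i \<circ> r)" by (intro continuous_on_compose cont_r cont_i) auto
      show "continuous_on (U \<inter> V) id" by simp
      fix \<alpha> and t :: real assume \<alpha>: "\<alpha> \<in> U \<inter> V" and t: "0 \<le> t" "t \<le> 1"
      have aY: "\<alpha> \<in> ?Y" "\<alpha> p < 1" "0 < \<alpha> p" using \<alpha> by (auto simp: U_def V_def)
      have ir: "i (r \<alpha>) \<in> ?Y" using i_Y[OF r_L[OF \<alpha>]] by (auto simp: U_def)
      have "(\<lambda>v. (1 - t) * i (r \<alpha>) v + t * \<alpha> v) \<in> ?Y"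
      proof (rule order_points_segment[OF P ir aY(1) _ t])
        fix u v assume "i (r \<alpha>) u \<noteq> 0" "\<alpha> v \<noteq> 0"
        moreover from this have "\<alpha> u \<noteq> 0" using aY r_nz[of \<alpha> u] by (auto simp: i_def split: if_splits)
        ultimately show "u \<le> v \<or> v \<le> u" using Y(3)[OF aY(1)] by blast
      qed
      moreover have "(1 - t) * (1 / 2) + t * \<alpha> p < 1"
        by (rule convex_bound_lt) (use aY t in auto)
      moreover have "(1 - t) * (1 / 2) + t * \<alpha> p > 0"
        using aY t by (cases "t = 0") (auto intro: add_nonneg_pos)
      ultimately show "(\<lambda>v. (1 - t) * (i \<circ> r) \<alpha> v + t * id \<alpha> v) \<in> U \<inter> V"
        by (simp add: U_def V_def i_def)
    qed
    then have "conn_upto (m - 1) (top_of_set (U \<inter> V))"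
    proof (rule conn_upto_dominated[OF cL, rotated 2])
      show "continuous_map (top_of_set (U \<inter> V)) (top_of_set (order_points ?L)) r" using cont_r[of "U \<inter> V"] r_L by auto
      show "continuous_map (top_of_set (order_points ?L)) (top_of_set (U \<inter> V)) i" using cont_i i_Y by auto
    qed
    moreover have "?Y \<inter> (U \<inter> V) = U \<inter> V" by (auto simp: V_def)
    ultimately show ?thesis by (simp add: subtopology_subtopology)
  qed
  ultimately show ?thesis
    by (intro conn_upto_open_union[OF op]) (auto simp: U_def V_def)
qed

text \<open>A vertex outside P0 with maximal \<open>\<rho>\<close> is attached last. Vertices of
  equal value outside P0 are incomparable, so its link consists of members of P0 and of vertices of
  smaller value, exactly the set in the hypothesis. For the other vertices that set does not contain
  the one removed, so the hypothesis passes to the smaller poset.\<close>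

lemma conn_upto_filtration:
  fixes P :: "('p::order) set" and \<rho> :: "'p \<Rightarrow> nat"
  assumes "finite P" "P0 \<subseteq> P" "conn_upto m (top_of_set (order_points P0))"
    and "\<And>p. p \<in> P - P0 \<Longrightarrow>
      conn_upto (m - 1) (top_of_set (order_points {q \<in> P. (q < p \<or> p < q) \<and> (q \<in> P0 \<or> \<rho> q < \<rho> p)}))"
    and "\<And>p q. p \<in> P - P0 \<Longrightarrow> q \<in> P - P0 \<Longrightarrow> p < q \<Longrightarrow> \<rho> p \<noteq> \<rho> q"
  shows "conn_upto m (top_of_set (order_points P))"
  using assms
proof (induction "card (P - P0)" arbitrary: P)
  case 0
  then have "P = P0" by auto
  then show ?case using 0 by simp
next
  case (Suc n)
  then have fin: "finite (P - P0)" and "P - P0 \<noteq> {}" by auto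
  then obtain p where p: "p \<in> P - P0" and max: "\<And>q. q \<in> P - P0 \<Longrightarrow> \<rho> q \<le> \<rho> p"
    using Max_in[of "\<rho> ` (P - P0)"] Max_ge[of "\<rho> ` (P - P0)"] by (metis (no_types, lifting) finite_imageI image_iff image_is_empty)
  let ?Q = "P - {p}"
  have "conn_upto m (top_of_set (order_points ?Q))"
  proof (rule Suc.hyps(1))
    have "P - {p} - P0 = (P - P0) - {p}" by auto
    then show "n = card (P - {p} - P0)" using Suc.hyps(2) p fin by simp
    show "conn_upto (m - 1) (top_of_set (order_points {r \<in> ?Q. (r < q \<or> q < r) \<and> (r \<in> P0 \<or> \<rho> r < \<rho> q)}))"
      if "q \<in> ?Q - P0" for q
    proof -
      have "{r \<in> ?Q. (r < q \<or> q < r) \<and> (r \<in> P0 \<or> \<rho> r < \<rho> q)} = {r \<in> P. (r < q \<or> q < r) \<and> (r \<in> P0 \<or> \<rho> r < \<rho> q)}"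
        using p max[of q] that by auto
      then show ?thesis using Suc.prems(4)[of q] that by simp
    qed
  qed (use Suc.prems p in auto)
  moreover have "{q \<in> ?Q. q < p \<or> p < q} = {q \<in> P. (q < p \<or> p < q) \<and> (q \<in> P0 \<or> \<rho> q < \<rho> p)}"
  proof -
    have "q \<in> P0 \<or> \<rho> q < \<rho> p" if "q \<in> P" "q < p \<or> p < q" for q
    proof (cases "q \<in> P0")
      case False
      then have "\<rho> q \<le> \<rho> p" "\<rho> q \<noteq> \<rho> p" using max[of q] Suc.prems(5)[of p q] Suc.prems(5)[of q p] p that by auto
      then show ?thesis by simp
    qed simp
    then show ?thesis by auto
  qed
  ultimately have "conn_upto m (top_of_set (order_points (insert p ?Q)))"
    using Suc.prems(4)[OF p] Suc.prems(1) by (intro conn_upto_add_vertex) auto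
  then show ?case using p by (simp add: insert_absorb)
qed

text \<open>The poset below is the join of the boundary of the simplex on \<open>S\<close> with \<open>D\<close>.\<close>

lemma conn_upto_boundary_join:
  fixes S :: "'a set"
  assumes "finite S" "S \<noteq> {}" "finite D" "\<And>d. d \<in> D \<Longrightarrow> S \<subseteq> d" "conn_upto c (top_of_set (order_points D))"
  shows "conn_upto (c + int (card S) - 1) (top_of_set (order_points ({U. U \<subset> S \<and> U \<noteq> {}} \<union> D)))"
  using assms
proof (induction S rule: finite_ne_induct)
  case (singleton x)
  have eq: "{U. U \<subset> {x} \<and> U \<noteq> {}} \<union> D = D" by auto
  have "c + int (card {x}) - 1 = c" by simp
  then show ?case using singleton.prems(3) by (simp only: eq)
next
  case (insert s T)
  let ?S = "insert s T"
  define J where "J = {U. U \<subset> ?S \<and> U \<noteq> {}} \<union> D"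
  have finS: "finite ?S" using insert by simp
  have "finite {U. U \<subset> ?S \<and> U \<noteq> {}}"
    by (rule finite_subset[of _ "Pow ?S"]) (use finS in auto)
  then have fin: "finite J" unfolding J_def using insert by simp
  have finJ: "finite U" if "U \<subset> ?S" for U using that finS finite_subset by blast
  have TJ: "T \<in> J" using insert by (auto simp: J_def)
  have TD: "T \<notin> D" using insert.prems(2)[of T] insert.hyps by auto
  \<comment> \<open>Leaving out the facet T leaves a disc in place of the sphere: the sets
    containing s, with D above them, form a cone with apex {s}, and a set U avoiding s is attached
    along a cone with apex \<open>insert s U\<close>.\<close>
  have m1: "conn_upto m (top_of_set (order_points (J - {T})))" for m
  proof (rule conn_upto_filtration[where \<rho> = card])
    let ?B = "{U. U \<subset> ?S \<and> s \<in> U} \<union> D"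
    show "finite (J - {T})" using fin by simp
    show "?B \<subseteq> J - {T}" using TD insert.hyps by (auto simp: J_def)
    show "conn_upto m (top_of_set (order_points ?B))"
    proof (rule cone_conn_upto[where p = "{s}"])
      show "finite ?B" by (rule rev_finite_subset[OF fin]) (auto simp: J_def)
      show "{s} \<in> ?B" using insert.hyps by auto
      show "q \<le> {s} \<or> {s} \<le> q" if "q \<in> ?B" for q using that insert.prems(2)[of q] by auto
    qed
    fix U assume U: "U \<in> J - {T} - ?B"
    then have U': "U \<subset> T" "U \<noteq> {}" "s \<notin> U" by (auto simp: J_def)
    have wS: "insert s U \<subset> ?S" using U' insert.hyps by auto
    let ?L = "{q \<in> J - {T}. (q < U \<or> U < q) \<and> (q \<in> ?B \<or> card q < card U)}"
    show "conn_upto (m - 1) (top_of_set (order_points ?L))"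
    proof (rule cone_conn_upto[where p = "insert s U"])
      show "finite ?L" using fin by simp
      show "insert s U \<in> ?L" using wS U' insert.hyps by (auto simp: J_def)
      fix q assume q: "q \<in> ?L"
      consider "q \<in> D" | "s \<in> q" | "q \<notin> D" "s \<notin> q" by blast
      then show "q \<le> insert s U \<or> insert s U \<le> q"
      proof cases
        case 1
        then show ?thesis using insert.prems(2)[OF 1] wS by blast
      next
        case 2
        then show ?thesis using q U' by blast
      next
        case 3
        then have "finite q" "card q < card U" using q finJ by (auto simp: J_def)
        then have "\<not> U \<subset> q" using psubset_card_mono[of q U] by linarith
        then show ?thesis using q by blast
      qed
    qed
  next
    fix U W assume "U \<in> J - {T} - ({U. U \<subset> ?S \<and> s \<in> U} \<union> D)" "W \<in> J - {T} - ({U. U \<subset> ?S \<and> s \<in> U} \<union> D)" "U < W"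
    moreover from this have "finite W" using finJ by (auto simp: J_def)
    ultimately show "card U \<noteq> card W" using psubset_card_mono[of W U] by auto
  qed
  \<comment> \<open>T misses only s, so no proper subset of \<open>?S\<close> lies strictly above
    it; the link of T is the smaller join of the induction hypothesis.\<close>
  have L: "{q \<in> J - {T}. q < T \<or> T < q} = {U. U \<subset> T \<and> U \<noteq> {}} \<union> D"
    using insert.hyps insert.prems(2) TD unfolding J_def by blast
  have "conn_upto (c + int (card T) - 1) (top_of_set (order_points {q \<in> J - {T}. q < T \<or> T < q}))"
    unfolding L by (rule insert.IH) (use insert.prems in auto)
  then have "conn_upto (c + int (card ?S) - 1 - 1) (top_of_set (order_points {q \<in> J - {T}. q < T \<or> T < q}))"
    using insert.hyps by (simp add: algebra_simps)
  then have "conn_upto (c + int (card ?S) - 1) (top_of_set (order_points (insert T (J - {T}))))"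
    by (intro conn_upto_add_vertex m1) (use fin in auto)
  then show ?case using TJ by (simp add: insert_absorb J_def)
qed

text \<open>Serves the sets S on which the length is not constant, M being the elements of minimal
  length. The non-empty subsets of M together with D form a cone with apex M, a member of the poset
  because it is proper in S. The other U follow in order of decreasing size: what lies below U at
  that stage is contained in M, everything else in the link contains U, so U \<inter> M is an apex
  of the link.\<close>

lemma conn_upto_subsets_meeting:
  fixes S :: "'a set"
  assumes S: "finite S" and M: "M \<subset> S" "M \<noteq> {}" and D: "finite D" "\<And>d. d \<in> D \<Longrightarrow> S \<subseteq> d"
  shows "conn_upto m (top_of_set (order_points ({U. U \<subset> S \<and> U \<inter> M \<noteq> {}} \<union> D)))"
proof (rule conn_upto_filtration[where \<rho> = "\<lambda>U. card S - card U"])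
  let ?P = "{U. U \<subset> S \<and> U \<inter> M \<noteq> {}} \<union> D"
  let ?B = "{U. U \<subseteq> M \<and> U \<noteq> {}} \<union> D"
  have "finite {U. U \<subset> S \<and> U \<inter> M \<noteq> {}}"
    by (rule finite_subset[of _ "Pow S"]) (use S in auto)
  then show fin: "finite ?P" using D by simp
  show "?B \<subseteq> ?P" using M by auto
  show "conn_upto m (top_of_set (order_points ?B))"
  proof (rule cone_conn_upto[where p = M])
    show "finite ?B" using fin by (rule rev_finite_subset) (use M in auto)
    show "M \<in> ?B" using M by auto
    show "q \<le> M \<or> M \<le> q" if "q \<in> ?B" for q using that M D(2)[of q] by auto
  qed
  have finU: "finite U" "card U < card S" if "U \<subset> S" for U
    using that S by (auto intro: finite_subset psubset_card_mono)
  fix U assume U: "U \<in> ?P - ?B"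
  then have U': "U \<subset> S" "U \<inter> M \<noteq> {}" "\<not> U \<subseteq> M" by auto
  let ?L = "{q \<in> ?P. (q < U \<or> U < q) \<and> (q \<in> ?B \<or> card S - card q < card S - card U)}"
  show "conn_upto (m - 1) (top_of_set (order_points ?L))"
  proof (rule cone_conn_upto[where p = "U \<inter> M"])
    show "finite ?L" using fin by (rule rev_finite_subset) auto
    show "U \<inter> M \<in> ?L" using U' by auto
    fix q assume q: "q \<in> ?L"
    have "card q < card U" if "q < U" using that psubset_card_mono[OF finU(1)[OF U'(1)]] by blast
    then have "U \<subset> q" if "q \<notin> ?B"
      using q that by (metis (mono_tags, lifting) diff_le_mono2 leD less_imp_le mem_Collect_eq)
    moreover have "S \<subseteq> q" if "q \<in> D" using D(2) that .
    ultimately show "q \<le> U \<inter> M \<or> U \<inter> M \<le> q" using q U' by auto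
  qed
next
  have finU: "finite U" "card U < card S" if "U \<subset> S" for U
    using that S by (auto intro: finite_subset psubset_card_mono)
  fix U W assume "U \<in> ({U. U \<subset> S \<and> U \<inter> M \<noteq> {}} \<union> D) - ({U. U \<subseteq> M \<and> U \<noteq> {}} \<union> D)"
    "W \<in> ({U. U \<subset> S \<and> U \<inter> M \<noteq> {}} \<union> D) - ({U. U \<subseteq> M \<and> U \<noteq> {}} \<union> D)" and UW: "U < W"
  then have "U \<subset> S" "W \<subset> S" by auto
  moreover have "card U < card W" using UW finU(1)[OF \<open>W \<subset> S\<close>] by (auto intro: psubset_card_mono)
  ultimately show "card S - card U \<noteq> card S - card W" using finU(2) by (metis diff_less_mono2 less_irrefl)
qed

section \<open>Realizations of locally finite posets\<close>

text \<open>At a zero of c the value is 0, since b vanishes there, and nearby the quotient is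
  bounded by |b|, which tends to 0. This covers the rescalings of simplices and cubes at the points
  where they divide by zero.\<close>

lemma continuous_on_mult_bounded_ratio:
  fixes a b c :: "'z::topological_space \<Rightarrow> real"
  assumes "continuous_on A a" "continuous_on A b" "continuous_on A c"
    and ac: "\<And>x. x \<in> A \<Longrightarrow> \<bar>a x\<bar> \<le> c x" and bc: "\<And>x. x \<in> A \<Longrightarrow> c x = 0 \<Longrightarrow> b x = 0"
  shows "continuous_on A (\<lambda>x. a x * b x / c x)"
  unfolding continuous_on_def
proof
  fix x assume x: "x \<in> A"
  have a: "(a \<longlongrightarrow> a x) (at x within A)" and b: "(b \<longlongrightarrow> b x) (at x within A)" and c: "(c \<longlongrightarrow> c x) (at x within A)"
    using assms(1-3) x by (auto simp: continuous_on_def)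
  show "((\<lambda>x. a x * b x / c x) \<longlongrightarrow> a x * b x / c x) (at x within A)"
  proof (cases "c x = 0")
    case False
    then show ?thesis using a b c by (intro tendsto_intros)
  next
    case True
    have "((\<lambda>x. a x * b x / c x) \<longlongrightarrow> 0) (at x within A)"
    proof (rule Lim_null_comparison)
      show "((\<lambda>x. \<bar>b x\<bar>) \<longlongrightarrow> 0) (at x within A)"
        using tendsto_rabs[OF b] bc[OF x True] by simp
      have "norm (a y * b y / c y) \<le> \<bar>b y\<bar>" if "y \<in> A" for y
      proof (cases "c y = 0")
        case False
        then have "c y > 0" using ac[OF that] by linarith
        then have "\<bar>a y\<bar> / c y \<le> 1" using ac[OF that] by simp
        then have "\<bar>b y\<bar> * (\<bar>a y\<bar> / c y) \<le> \<bar>b y\<bar> * 1" by (intro mult_left_mono) auto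
        then show ?thesis using \<open>c y > 0\<close> by (simp add: abs_mult mult.commute)
      qed simp
      then show "\<forall>\<^sub>F y in at x within A. norm (a y * b y / c y) \<le> \<bar>b y\<bar>"
        by (auto simp: eventually_at_filter)
    qed
    then show ?thesis using True by simp
  qed
qed

text \<open>The inserted 0 keeps the maximum meaningful for empty I, the case of a simplex with a
  single vertex.\<close>

lemma continuous_on_Max_insert_0:
  assumes "finite I" "\<And>i. i \<in> I \<Longrightarrow> continuous_on A (\<lambda>x. f x i :: real)"
  shows "continuous_on A (\<lambda>x. Max (insert 0 (f x ` I)))"
  using assms
proof (induction rule: finite_induct)
  case (insert i F)
  have "Max (insert 0 (f x ` insert i F)) = max (f x i) (Max (insert 0 (f x ` F)))" for x
    using insert.hyps by (subst Max_insert[symmetric]) (auto simp: insert_commute)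
  moreover have "continuous_on A (\<lambda>x. max (f x i) (Max (insert 0 (f x ` F))))"
    using insert by (intro continuous_on_max) auto
  ultimately show ?case by simp
qed auto

text \<open>In the coordinates other than that of a chosen vertex, the simplex is
  \<open>{x \<ge> 0. \<Sum>x \<le> 1}\<close>; rescaling \<open>x\<close> by \<open>\<Sum>x / max x\<close> carries it onto the cube \<open>{x \<ge> 0. max x \<le> 1}\<close>.\<close>

lemma geom_simplex_cell_like:
  assumes s: "finite s" "s \<noteq> {}"
  shows "cell_like (card s - 1) (geom_simplex s) {\<alpha> \<in> geom_simplex s. \<exists>v\<in>s. \<alpha> v = 0}"
proof -
  obtain v0 where v0: "v0 \<in> s" using s by blast
  define s' where "s' = s - {v0}"
  let ?d = "card s - 1"
  have s': "finite s'" "card s' = ?d" "v0 \<notin> s'" "s = insert v0 s'" using s v0 by (auto simp: s'_def)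
  obtain \<pi> where \<pi>: "bij_betw \<pi> {..<?d} s'"
    using ex_bij_betw_nat_finite[OF s'(1)] s'(2) by (auto simp: atLeast0LessThan)
  define \<rho> where "\<rho> = inv_into {..<?d} \<pi>"
  have \<pi>s: "\<pi> k \<in> s'" if "k < ?d" for k using \<pi> that by (auto simp: bij_betw_def)
  have \<rho>d: "\<rho> v < ?d" "\<pi> (\<rho> v) = v" if "v \<in> s'" for v
  proof -
    have "v \<in> \<pi> ` {..<?d}" using \<pi> that by (simp add: bij_betw_def)
    then show "\<rho> v < ?d" "\<pi> (\<rho> v) = v"
      using inv_into_into[of v \<pi> "{..<?d}"] f_inv_into_f[of v \<pi> "{..<?d}"] by (auto simp: \<rho>_def)
  qed
  have \<rho>\<pi>: "\<rho> (\<pi> k) = k" if "k < ?d" for k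
    unfolding \<rho>_def using \<pi> that by (intro inv_into_f_f) (auto simp: bij_betw_def)
  define mx where "mx = (\<lambda>f :: 'a \<Rightarrow> real. Max (insert 0 (f ` s')))"
  have mx_ge: "f v \<le> mx f" if "v \<in> s'" for f v unfolding mx_def using s' that by (intro Max_ge) auto
  have mx_0: "0 \<le> mx f" for f unfolding mx_def using s' by (intro Max_ge) auto
  have mx_att: "mx f = 0 \<or> (\<exists>v\<in>s'. mx f = f v)" for f
    using Max_in[of "insert 0 (f ` s')"] s' by (auto simp: mx_def)
  have mx_scale: "mx (\<lambda>v. f v * c) = mx f * c" if "c \<ge> 0" for f c
  proof (rule antisym)
    show "mx (\<lambda>v. f v * c) \<le> mx f * c"
      using mx_att[of "\<lambda>v. f v * c"] mult_right_mono[OF mx_ge[of _ f] that] mult_nonneg_nonneg[OF mx_0[of f] that]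
      by auto
    show "mx f * c \<le> mx (\<lambda>v. f v * c)"
      using mx_att[of f] mx_ge[of _ "\<lambda>v. f v * c"] mx_0[of "\<lambda>v. f v * c"] by auto
  qed
  have mx_cong: "mx f = mx g" if "\<And>v. v \<in> s' \<Longrightarrow> f v = g v" for f g
    unfolding mx_def using that by (metis image_cong)
  \<comment> \<open>1 - \<alpha> v0 is the sum of the remaining coordinates, so the quotient is the
    rescaling by sum over maximum; 2 * x - 1 then passes from [0, 1] to [-1, 1]. At the vertex v0
    the quotient is 0.\<close>
  define \<psi> where "\<psi> = (\<lambda>(\<alpha> :: 'a \<Rightarrow> real) k. if k < ?d then 2 * (\<alpha> (\<pi> k) * (1 - \<alpha> v0) / mx \<alpha>) - 1 else 0)"
  define y where "y = (\<lambda>(z :: nat \<Rightarrow> real) v. (z (\<rho> v) + 1) / 2)"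
  define \<theta> where "\<theta> = (\<lambda>z v. if v \<in> s' then y z v * mx (y z) / sum (y z) s' else if v = v0 then 1 - mx (y z) else 0)"
  have G: "\<And>v. 0 \<le> \<alpha> v" "\<And>v. v \<notin> s \<Longrightarrow> \<alpha> v = 0" "sum \<alpha> s' = 1 - \<alpha> v0" if "\<alpha> \<in> geom_simplex s" for \<alpha>
    using that s' by (auto simp: geom_simplex_def)
  have mx_zero: "1 - \<alpha> v0 = 0" if "\<alpha> \<in> geom_simplex s" "mx \<alpha> = 0" for \<alpha>
  proof -
    have "\<alpha> v = 0" if "v \<in> s'" for v
      using mx_ge[OF that, of \<alpha>] G(1)[OF \<open>\<alpha> \<in> geom_simplex s\<close>, of v] \<open>mx \<alpha> = 0\<close> by simp
    then show ?thesis using G(3)[OF that(1)] by simp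
  qed
  have v0_le: "0 \<le> 1 - \<alpha> v0" if "\<alpha> \<in> geom_simplex s" for \<alpha>
    using G[OF that] by (metis sum_nonneg)
  have \<psi>_cube: "\<psi> \<alpha> \<in> cube ?d" if \<alpha>: "\<alpha> \<in> geom_simplex s" for \<alpha>
  proof -
    have "0 \<le> \<alpha> v * (1 - \<alpha> v0) / mx \<alpha> \<and> \<alpha> v * (1 - \<alpha> v0) / mx \<alpha> \<le> 1" if v: "v \<in> s'" for v
    proof
      show "0 \<le> \<alpha> v * (1 - \<alpha> v0) / mx \<alpha>" using G(1)[OF \<alpha>, of v] v0_le[OF \<alpha>] mx_0[of \<alpha>] by simp
      have "\<alpha> v * (1 - \<alpha> v0) \<le> mx \<alpha> * 1"
        using mx_ge[OF v, of \<alpha>] G(1)[OF \<alpha>] v0_le[OF \<alpha>] by (intro mult_mono) (auto simp: mx_0)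
      then show "\<alpha> v * (1 - \<alpha> v0) / mx \<alpha> \<le> 1" using mx_0[of \<alpha>] by (cases "mx \<alpha> = 0") (auto simp: divide_le_eq)
    qed
    then have "\<bar>2 * (\<alpha> v * (1 - \<alpha> v0) / mx \<alpha>) - 1\<bar> \<le> 1" if "v \<in> s'" for v
      using that by (smt (verit))
    then show ?thesis using \<pi>s unfolding \<psi>_def cube_def by simp
  qed
  have y01: "0 \<le> y z v" "y z v \<le> 1" if "z \<in> cube ?d" "v \<in> s'" for z v
    using that \<rho>d(1)[OF that(2)] by (auto simp: y_def cube_def abs_le_iff)
  have mx_y: "mx (y z) \<le> 1" if "z \<in> cube ?d" for z
    using mx_att[of "y z"] y01[OF that] by auto
  have sum_zero: "mx (y z) = 0" if z: "z \<in> cube ?d" and "sum (y z) s' = 0" for z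
  proof -
    have "\<forall>v\<in>s'. y z v = 0" using that(2) y01[OF z] s'(1) by (simp add: sum_nonneg_eq_0_iff)
    then show ?thesis using mx_att[of "y z"] by auto
  qed
  have y_le: "\<bar>y z v\<bar> \<le> sum (y z) s'" if "z \<in> cube ?d" "v \<in> s'" for z v
  proof -
    have "y z v \<le> sum (y z) s'" by (rule member_le_sum) (use y01[OF that(1)] that(2) s'(1) in auto)
    then show ?thesis using y01[OF that] by simp
  qed
  have \<theta>_simplex: "\<theta> z \<in> geom_simplex s" if z: "z \<in> cube ?d" for z
    unfolding geom_simplex_def
  proof (intro CollectI conjI allI impI)
    have sn: "0 \<le> sum (y z) s'" using y01[OF z] by (intro sum_nonneg) auto
    show "0 \<le> \<theta> z v" for v
      using y01[OF z, of v] mx_0[of "y z"] mx_y[OF z] sn by (simp add: \<theta>_def)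
    show "\<theta> z v = 0" if "v \<notin> s" for v using that s' by (auto simp: \<theta>_def)
    have "sum (\<theta> z) s' = (\<Sum>v\<in>s'. y z v * (mx (y z) / sum (y z) s'))"
      by (rule sum.cong) (auto simp: \<theta>_def)
    also have "\<dots> = sum (y z) s' * (mx (y z) / sum (y z) s')" by (simp only: sum_distrib_right)
    also have "\<dots> = mx (y z)" using sum_zero[OF z] by (cases "sum (y z) s' = 0") auto
    finally show "sum (\<theta> z) s = 1" using s' by (simp add: \<theta>_def)
  qed
  have \<theta>\<psi>: "\<theta> (\<psi> \<alpha>) = \<alpha>" if \<alpha>: "\<alpha> \<in> geom_simplex s" for \<alpha>
  proof -
    let ?S = "1 - \<alpha> v0" and ?M = "mx \<alpha>"
    have c: "0 \<le> ?S / ?M" using v0_le[OF \<alpha>] mx_0 by simp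
    have y: "y (\<psi> \<alpha>) v = \<alpha> v * (?S / ?M)" if "v \<in> s'" for v
      using \<rho>d[OF that] by (simp add: y_def \<psi>_def)
    have m: "mx (y (\<psi> \<alpha>)) = ?S"
      using mx_cong[OF y] mx_scale[OF c, of \<alpha>] mx_zero[OF \<alpha>] by auto
    have "sum (y (\<psi> \<alpha>)) s' = (\<Sum>v\<in>s'. \<alpha> v * (?S / ?M))" by (rule sum.cong) (simp_all add: y)
    then have sm: "sum (y (\<psi> \<alpha>)) s' = ?S * (?S / ?M)"
      using G(3)[OF \<alpha>] by (simp only: sum_distrib_right[symmetric])
    show ?thesis
    proof
      fix v
      consider "v \<in> s'" | "v = v0" | "v \<notin> s" using s' by blast
      then show "\<theta> (\<psi> \<alpha>) v = \<alpha> v"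
      proof cases
        case 1
        show ?thesis
        proof (cases "?S = 0")
          case True
          then have "\<alpha> v = 0" using G(3)[OF \<alpha>] G(1)[OF \<alpha>] s'(1) 1 by (simp add: sum_nonneg_eq_0_iff)
          then show ?thesis using 1 y[OF 1] by (simp add: \<theta>_def)
        next
          case False
          then have "?M \<noteq> 0" using mx_zero[OF \<alpha>] by blast
          then show ?thesis using 1 y[OF 1] m sm False by (simp add: \<theta>_def)
        qed
      next
        case 2 then show ?thesis using s' m by (simp add: \<theta>_def)
      next
        case 3 then show ?thesis using s' G(2)[OF \<alpha>] by (auto simp: \<theta>_def)
      qed
    qed
  qed
  show ?thesis
    unfolding cell_like_def
  proof (rule conjI, blast, rule exI[of _ \<psi>], rule exI[of _ \<theta>], intro conjI ballI)
    show "continuous_on (geom_simplex s) \<psi>"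
      unfolding \<psi>_def
    proof (rule continuous_on_coordinatewise_then_product)
      fix k
      have c: "continuous_on (geom_simplex s) (\<lambda>\<alpha>. \<alpha> (\<pi> k) * (1 - \<alpha> v0) / mx \<alpha>)" if "k < ?d"
      proof (rule continuous_on_mult_bounded_ratio)
        show "continuous_on (geom_simplex s) (\<lambda>\<alpha>. \<alpha> (\<pi> k))" by (rule continuous_on_coord)
        show "continuous_on (geom_simplex s) (\<lambda>\<alpha>. 1 - \<alpha> v0)"
          by (intro continuous_on_diff continuous_on_const continuous_on_coord)
        show "continuous_on (geom_simplex s) mx"
          unfolding mx_def by (rule continuous_on_Max_insert_0[OF s'(1)]) (rule continuous_on_coord)
        fix \<alpha> assume \<alpha>: "\<alpha> \<in> geom_simplex s"
        show "\<bar>\<alpha> (\<pi> k)\<bar> \<le> mx \<alpha>" using mx_ge[OF \<pi>s[OF that], of \<alpha>] G(1)[OF \<alpha>] by simp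
        show "1 - \<alpha> v0 = 0" if "mx \<alpha> = 0" using mx_zero[OF \<alpha> that] .
      qed
      show "continuous_on (geom_simplex s)
          (\<lambda>\<alpha>. if k < ?d then 2 * (\<alpha> (\<pi> k) * (1 - \<alpha> v0) / mx \<alpha>) - 1 else 0)"
      proof (cases "k < ?d")
        case True
        have "continuous_on (geom_simplex s) (\<lambda>\<alpha>. 2 * (\<alpha> (\<pi> k) * (1 - \<alpha> v0) / mx \<alpha>) - 1)"
          by (intro continuous_on_diff continuous_on_mult[OF continuous_on_const c[OF True]] continuous_on_const)
        then show ?thesis by (simp only: True if_True)
      qed simp
    qed
    have cy: "continuous_on A (\<lambda>z. y z v)" for A v
      unfolding y_def by (intro continuous_on_divide continuous_on_add continuous_on_const continuous_on_coord) auto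
    have cm: "continuous_on A (\<lambda>z. mx (y z))" for A
      unfolding mx_def by (rule continuous_on_Max_insert_0[OF s'(1)]) (rule cy)
    show "continuous_on (cube ?d) \<theta>"
      unfolding \<theta>_def
    proof (rule continuous_on_coordinatewise_then_product)
      fix v
      have "continuous_on (cube ?d) (\<lambda>z. y z v * mx (y z) / sum (y z) s')" if "v \<in> s'"
        by (rule continuous_on_mult_bounded_ratio[OF cy cm])
          (use y_le that sum_zero in \<open>auto intro: continuous_on_sum cy\<close>)
      then show "continuous_on (cube ?d)
          (\<lambda>z. if v \<in> s' then y z v * mx (y z) / sum (y z) s' else if v = v0 then 1 - mx (y z) else 0)"
        by (cases "v \<in> s'"; cases "v = v0") (auto intro!: continuous_on_diff continuous_on_const cm)
    qed
    show "\<psi> ` geom_simplex s \<subseteq> cube ?d" using \<psi>_cube by blast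
    show "\<theta> ` cube ?d \<subseteq> geom_simplex s" using \<theta>_simplex by blast
    show "\<psi> ` {\<alpha> \<in> geom_simplex s. \<exists>v\<in>s. \<alpha> v = 0} \<subseteq> cube_bd ?d"
    proof (rule image_subsetI)
      fix \<alpha> assume "\<alpha> \<in> {\<alpha> \<in> geom_simplex s. \<exists>v\<in>s. \<alpha> v = 0}"
      then obtain v where \<alpha>: "\<alpha> \<in> geom_simplex s" and v: "v \<in> s" "\<alpha> v = 0" by blast
      have "\<exists>k<?d. \<bar>\<psi> \<alpha> k\<bar> = 1"
      proof (cases "v = v0")
        case False
        then have "v \<in> s'" using v by (simp add: s'_def)
        then show ?thesis using v \<rho>d[of v] by (intro exI[of _ "\<rho> v"]) (simp add: \<psi>_def)
      next
        case True
        \<comment> \<open>If the coordinate at v0 vanishes, the others sum to 1 and the largest is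
          rescaled to 1: the face opposite v0 goes to the sides of the cube where a coordinate is 1,
          the other faces to those where it is -1.\<close>
        then have "mx \<alpha> \<noteq> 0" using mx_zero[OF \<alpha>] v by auto
        then obtain w where w: "w \<in> s'" "mx \<alpha> = \<alpha> w" using mx_att[of \<alpha>] by blast
        then show ?thesis using \<rho>d[OF w(1)] \<open>mx \<alpha> \<noteq> 0\<close> v True
          by (intro exI[of _ "\<rho> w"]) (simp add: \<psi>_def)
      qed
      then show "\<psi> \<alpha> \<in> cube_bd ?d" using \<psi>_cube[OF \<alpha>] by (simp add: cube_bd_def)
    qed
    show "\<theta> ` cube_bd ?d \<subseteq> {\<alpha> \<in> geom_simplex s. \<exists>v\<in>s. \<alpha> v = 0}"
    proof (rule image_subsetI)
      fix z assume "z \<in> cube_bd ?d"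
      then obtain k where z: "z \<in> cube ?d" and k: "k < ?d" "\<bar>z k\<bar> = 1" by (auto simp: cube_bd_def)
      have "\<exists>v\<in>s. \<theta> z v = 0"
      proof (cases "z k = 1")
        case False
        then have "y z (\<pi> k) = 0" using k \<rho>\<pi>[OF k(1)] by (auto simp: y_def)
        then show ?thesis using \<pi>s[OF k(1)] s' by (intro bexI[of _ "\<pi> k"]) (auto simp: \<theta>_def)
      next
        case True
        then have "y z (\<pi> k) = 1" using \<rho>\<pi>[OF k(1)] by (simp add: y_def)
        then have "mx (y z) = 1" using mx_ge[OF \<pi>s[OF k(1)], of "y z"] mx_y[OF z] by simp
        then show ?thesis using s' by (intro bexI[of _ v0]) (auto simp: \<theta>_def)
      qed
      then show "\<theta> z \<in> {\<alpha> \<in> geom_simplex s. \<exists>v\<in>s. \<alpha> v = 0}" using \<theta>_simplex[OF z] by blast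
    qed
    show "\<theta> (\<psi> \<alpha>) = \<alpha>" if "\<alpha> \<in> geom_simplex s" for \<alpha> using \<theta>\<psi>[OF that] .
  qed
qed

section \<open>Closed simplices, carriers and the weak topology\<close>

lemma closed_geom_simplex:
  assumes "finite s"
  shows "closed (geom_simplex s)"
proof -
  have eq: "geom_simplex s = (\<Inter>v. {\<alpha>. 0 \<le> \<alpha> v}) \<inter> (\<Inter>v\<in>-s. {\<alpha>. \<alpha> v = 0}) \<inter> {\<alpha>. sum \<alpha> s = 1}"
    by (auto simp: geom_simplex_def)
  show ?thesis
    unfolding eq
    by (intro closed_Int closed_INT ballI closed_Collect_le closed_Collect_eq continuous_on_const
        continuous_on_coord continuous_on_sum)
qed

lemma geom_simplex_mono:
  assumes "finite t" "s \<subseteq> t"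
  shows "geom_simplex s \<subseteq> geom_simplex t"
proof
  fix \<alpha> assume \<alpha>: "\<alpha> \<in> geom_simplex s"
  have "sum \<alpha> s = sum \<alpha> t"
    by (rule sum.mono_neutral_left) (use assms \<alpha> in \<open>auto simp: geom_simplex_def\<close>)
  then show "\<alpha> \<in> geom_simplex t" using assms \<alpha> by (auto simp: geom_simplex_def)
qed

lemma order_complexD:
  assumes "s \<in> order_complex P"
  shows "s \<subseteq> P" "finite s" "s \<noteq> {}" "\<And>u v. u \<in> s \<Longrightarrow> v \<in> s \<Longrightarrow> u \<le> v \<or> v \<le> u"
  using assms by (auto simp: order_complex_def chain_def)

lemma order_complex_subset:
  assumes "s \<in> order_complex P" "r \<subseteq> s" "r \<noteq> {}"
  shows "r \<in> order_complex P"
proof -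
  have "finite r" using order_complexD(2)[OF assms(1)] assms(2) finite_subset by blast
  moreover have "r \<subseteq> P" using order_complexD(1)[OF assms(1)] assms(2) by blast
  moreover have "u \<le> v \<or> v \<le> u" if "u \<in> r" "v \<in> r" for u v
    using order_complexD(4)[OF assms(1)] assms(2) that by blast
  ultimately show ?thesis using assms(3) unfolding order_complex_def chain_def by simp
qed

lemma order_complex_restrict: "s \<in> order_complex P \<Longrightarrow> s \<subseteq> F \<Longrightarrow> s \<in> order_complex F"
  by (simp add: order_complex_def)

lemma order_complex_mono: "F \<subseteq> P \<Longrightarrow> order_complex F \<subseteq> order_complex P"
  by (auto simp: order_complex_def)

lemma order_points_mono: "F \<subseteq> P \<Longrightarrow> order_points F \<subseteq> order_points P"
  using order_complex_mono[of F P] by (auto simp: order_points_def)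

definition carrier_simplex :: "('v \<Rightarrow> real) \<Rightarrow> 'v set" where
  "carrier_simplex \<alpha> = {v. \<alpha> v \<noteq> 0}"

lemma carrier_simplex_subset: "\<alpha> \<in> geom_simplex s \<Longrightarrow> carrier_simplex \<alpha> \<subseteq> s"
  by (auto simp: geom_simplex_def carrier_simplex_def)

lemma geom_simplex_carrier:
  assumes "finite s" "\<alpha> \<in> geom_simplex s"
  shows "\<alpha> \<in> geom_simplex (carrier_simplex \<alpha>)" "carrier_simplex \<alpha> \<noteq> {}"
proof -
  have "sum \<alpha> (carrier_simplex \<alpha>) = sum \<alpha> s"
    by (rule sum.mono_neutral_left) (use assms carrier_simplex_subset in \<open>auto simp: carrier_simplex_def\<close>)
  then have 1: "sum \<alpha> (carrier_simplex \<alpha>) = 1" using assms by (simp add: geom_simplex_def)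
  then show "carrier_simplex \<alpha> \<noteq> {}" by auto
  show "\<alpha> \<in> geom_simplex (carrier_simplex \<alpha>)"
    using 1 assms by (auto simp: geom_simplex_def carrier_simplex_def)
qed

lemma order_points_carrier:
  assumes "\<alpha> \<in> order_points P"
  shows "carrier_simplex \<alpha> \<in> order_complex P" "\<alpha> \<in> geom_simplex (carrier_simplex \<alpha>)"
proof -
  obtain s where s: "s \<in> order_complex P" "\<alpha> \<in> geom_simplex s" using assms by (auto simp: order_points_def)
  note c = geom_simplex_carrier[OF order_complexD(2)[OF s(1)] s(2)]
  show "\<alpha> \<in> geom_simplex (carrier_simplex \<alpha>)" by (rule c(1))
  show "carrier_simplex \<alpha> \<in> order_complex P"
    by (rule order_complex_subset[OF s(1) carrier_simplex_subset[OF s(2)] c(2)])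
qed

lemma order_points_chain:
  assumes "s \<in> order_complex P"
  shows "order_points s = geom_simplex s"
proof
  show "order_points s \<subseteq> geom_simplex s"
    using geom_simplex_mono[OF order_complexD(2)[OF assms]] by (auto simp: order_points_def order_complex_def)
  show "geom_simplex s \<subseteq> order_points s"
    using order_complex_restrict[OF assms order_refl] by (auto simp: order_points_def)
qed

lemma topspace_poset_realization: "topspace (poset_realization P) = order_points P"
  by (simp add: poset_realization_def topspace_realization order_points_def)

lemma openin_poset_realization:
  "openin (poset_realization P) W \<longleftrightarrow> W \<subseteq> order_points P \<and>
    (\<forall>s\<in>order_complex P. openin (top_of_set (geom_simplex s)) (W \<inter> geom_simplex s))"
  by (simp add: poset_realization_def openin_realization order_points_def euclidean_product_topology)

text \<open>The weak topology is finer than the product topology; this supplies the openness of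
  stars and the closedness of simplices.\<close>

lemma openin_poset_realization_Int:
  assumes "open W"
  shows "openin (poset_realization P) (order_points P \<inter> W)"
  unfolding openin_poset_realization
proof (intro conjI ballI)
  fix s assume "s \<in> order_complex P"
  then have "order_points P \<inter> W \<inter> geom_simplex s = geom_simplex s \<inter> W" by (auto simp: order_points_def)
  then show "openin (top_of_set (geom_simplex s)) (order_points P \<inter> W \<inter> geom_simplex s)"
    using assms by (auto simp: openin_open)
qed simp

text \<open>Within a finite subcomplex the complement of a weakly open set is a finite union of
  closed sets, hence closed for the product topology. This is the bridge from the computations in
  products of lines to the realization.\<close>

lemma subtopology_poset_realization_finite:
  assumes F: "finite F" "F \<subseteq> P"
  shows "subtopology (poset_realization P) (order_points F) = top_of_set (order_points F)"
  unfolding topology_eq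
proof (intro allI iffI)
  fix W assume "openin (subtopology (poset_realization P) (order_points F)) W"
  then obtain U where U: "openin (poset_realization P) U" "W = U \<inter> order_points F"
    by (auto simp: openin_subtopology)
  have fin: "finite (order_complex F)"
    by (rule finite_subset[of _ "Pow F"]) (use F in \<open>auto simp: order_complex_def\<close>)
  have cl: "closed (geom_simplex s - U)" if "s \<in> order_complex F" for s
  proof -
    have s: "s \<in> order_complex P" "finite s" using that order_complex_mono[OF F(2)] order_complexD(2) by auto
    then have "openin (top_of_set (geom_simplex s)) (U \<inter> geom_simplex s)"
      using U(1) unfolding openin_poset_realization by blast
    then obtain O' where "open O'" "U \<inter> geom_simplex s = geom_simplex s \<inter> O'" by (auto simp: openin_open)
    moreover from this have "geom_simplex s - U = geom_simplex s - O'" by blast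
    ultimately show ?thesis using closed_geom_simplex[OF s(2)] by (simp add: closed_Diff)
  qed
  have "closed (\<Union>s\<in>order_complex F. geom_simplex s - U)"
    using fin cl by (intro closed_UN) auto
  moreover have "W = order_points F \<inter> - (\<Union>s\<in>order_complex F. geom_simplex s - U)"
    using U(2) by (auto simp: order_points_def)
  ultimately show "openin (top_of_set (order_points F)) W" by (auto simp: openin_open)
next
  fix W assume "openin (top_of_set (order_points F)) W"
  then obtain O' where O': "open O'" "W = order_points F \<inter> O'" by (auto simp: openin_open)
  then have "W = (order_points P \<inter> O') \<inter> order_points F" using order_points_mono[OF F(2)] by blast
  then show "openin (subtopology (poset_realization P) (order_points F)) W"
    using openin_poset_realization_Int[OF O'(1)] by (auto simp: openin_subtopology)
qed

lemma poset_realization_finite: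
  assumes "finite F"
  shows "poset_realization F = top_of_set (order_points F)"
  using subtopology_poset_realization_finite[OF assms order_refl]
  by (metis subtopology_topspace topspace_poset_realization)

definition open_star :: "('p::order) set \<Rightarrow> 'p \<Rightarrow> ('p \<Rightarrow> real) set" where
  "open_star P p = {\<alpha> \<in> order_points P. \<alpha> p > 0}"

lemma openin_open_star: "openin (poset_realization P) (open_star P p)"
proof -
  have "open_star P p = order_points P \<inter> {\<alpha>. 0 < \<alpha> p}" by (auto simp: open_star_def)
  moreover have "open {\<alpha> :: 'a \<Rightarrow> real. 0 < \<alpha> p}"
    by (intro open_Collect_less continuous_on_const continuous_on_coord)
  ultimately show ?thesis by (simp add: openin_poset_realization_Int)
qed

lemma order_points_in_open_star:
  assumes "\<alpha> \<in> order_points P"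
  obtains p where "p \<in> P" "\<alpha> \<in> open_star P p"
proof -
  note c = order_points_carrier[OF assms]
  then obtain p where p: "p \<in> carrier_simplex \<alpha>" using order_complexD(3) by blast
  have "\<alpha> p > 0" using p c(2) by (auto simp: carrier_simplex_def geom_simplex_def less_le)
  then show thesis using that[of p] assms p order_complexD(1)[OF c(1)] by (auto simp: open_star_def)
qed

lemma open_star_comparable:
  assumes "\<alpha> \<in> open_star P p" "q \<in> carrier_simplex \<alpha>"
  shows "q \<in> P \<and> (q \<le> p \<or> p \<le> q)"
proof -
  have \<alpha>: "\<alpha> \<in> order_points P" "p \<in> carrier_simplex \<alpha>" using assms by (auto simp: open_star_def carrier_simplex_def)
  show ?thesis
    using order_complexD(1,4)[OF order_points_carrier(1)[OF \<alpha>(1)]] assms(2) \<alpha>(2) by blast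
qed

text \<open>A compact set meets only finitely many open stars from a cover by stars.\<close>

lemma sphere_null_exhaustion:
  fixes P :: "('p::order) set"
  assumes ex: "\<And>F. finite F \<Longrightarrow> F \<subseteq> P \<Longrightarrow> \<exists>E. finite E \<and> E \<subseteq> P \<and>
      {q \<in> P. \<exists>p\<in>F. q \<le> p \<or> p \<le> q} \<subseteq> E \<and> sphere_null j (top_of_set (order_points E))"
  shows "sphere_null j (poset_realization P)"
proof (rule sphere_nullI)
  let ?X = "poset_realization P"
  fix f assume f: "continuous_map (top_of_set (cube_bd j)) ?X f"
  have fX: "f x \<in> order_points P" if "x \<in> cube_bd j" for x
    using f that by (auto simp: continuous_map_def topspace_poset_realization)
  have "compactin ?X (f ` cube_bd j)"
    by (rule image_compactin[OF _ f]) (simp add: compactin_subtopology compact_cube_bd)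
  moreover have "f ` cube_bd j \<subseteq> \<Union> (open_star P ` P)"
    using fX by (auto elim: order_points_in_open_star)
  ultimately obtain \<F> where \<F>: "finite \<F>" "\<F> \<subseteq> open_star P ` P" "f ` cube_bd j \<subseteq> \<Union>\<F>"
    unfolding compactin_def using openin_open_star by (metis (no_types, lifting) image_iff)
  then obtain F where F: "F \<subseteq> P" "finite F" "\<F> = open_star P ` F"
    using finite_subset_image by meson
  obtain E where E: "finite E" "E \<subseteq> P" "{q \<in> P. \<exists>p\<in>F. q \<le> p \<or> p \<le> q} \<subseteq> E"
    and null: "sphere_null j (top_of_set (order_points E))"
    using ex[OF F(2,1)] by blast
  \<comment> \<open>A point in the open star of p has its support comparable with p, and E contains
    all elements comparable with a member of F.\<close>
  have fE: "f x \<in> order_points E" if x: "x \<in> cube_bd j" for x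
  proof -
    obtain p where p: "p \<in> F" "f x \<in> open_star P p" using \<F>(3) F(3) x by blast
    have "carrier_simplex (f x) \<subseteq> E" using open_star_comparable[OF p(2)] p(1) E(3) by blast
    then have "carrier_simplex (f x) \<in> order_complex E"
      using order_points_carrier(1)[OF fX[OF x]] order_complex_restrict by blast
    then show ?thesis using order_points_carrier(2)[OF fX[OF x]] by (auto simp: order_points_def)
  qed
  have "continuous_map (top_of_set (cube_bd j)) (subtopology ?X (order_points E)) f"
    using f fE by (auto simp: continuous_map_in_subtopology)
  then have "continuous_map (top_of_set (cube_bd j)) (top_of_set (order_points E)) f"
    by (simp only: subtopology_poset_realization_finite[OF E(1,2)])
  then obtain g where g: "continuous_map (top_of_set (cube j)) (top_of_set (order_points E)) g"
    "\<And>x. x \<in> cube_bd j \<Longrightarrow> g x = f x"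
    by (rule sphere_null_extend[OF null]) (rule that, assumption, simp only:)
  have "continuous_map (top_of_set (cube j)) ?X g"
    using g(1)[folded subtopology_poset_realization_finite[OF E(1,2)]] by (simp only: continuous_map_in_subtopology)
  then show "\<exists>F. continuous_map (top_of_set (cube j)) ?X F \<and> (\<forall>x\<in>cube_bd j. F x = f x)"
    using g(2) by blast
qed

text \<open>Whitehead's theorem: the null homotopy of the identity is built simplex by simplex.\<close>

theorem contractible_poset_realization:
  fixes P :: "('p::order) set"
  assumes lf: "\<And>p. p \<in> P \<Longrightarrow> finite {q \<in> P. q \<le> p \<or> p \<le> q}"
    and null: "\<And>j. sphere_null j (poset_realization P)"
  shows "contractible_nonempty (poset_realization P)"
proof -
  let ?X = "poset_realization P" and ?Z = "order_points P"
  let ?c = "\<lambda>\<alpha>. geom_simplex (carrier_simplex \<alpha>)"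
  have "topspace ?X \<noteq> {}" using null[of 0] by (simp add: sphere_null_0)
  then obtain y0 where y0: "y0 \<in> topspace ?X" by blast
  have fin: "finite (carrier_simplex \<alpha>)" if "\<alpha> \<in> ?Z" for \<alpha>
    using order_complexD(2)[OF order_points_carrier(1)[OF that]] .
  have sub: "\<beta> \<in> ?Z \<and> ?c \<beta> \<subseteq> ?c \<alpha>" if "\<alpha> \<in> ?Z" "\<beta> \<in> ?c \<alpha>" for \<alpha> \<beta>
    using geom_simplex_mono[OF fin[OF that(1)] carrier_simplex_subset[OF that(2)]]
      order_points_carrier(1)[OF that(1)] that(2) by (auto simp: order_points_def)
  have fin_faces: "finite (?c ` ?c \<alpha>)" if "\<alpha> \<in> ?Z" for \<alpha>
  proof (rule finite_subset)
    show "?c ` ?c \<alpha> \<subseteq> geom_simplex ` Pow (carrier_simplex \<alpha>)" using carrier_simplex_subset by blast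
    show "finite (geom_simplex ` Pow (carrier_simplex \<alpha>))" using fin[OF that] by simp
  qed
  have closed: "closed (?c \<alpha>)" if "\<alpha> \<in> ?Z" for \<alpha> by (rule closed_geom_simplex[OF fin[OF that]])
  have bd: "{\<beta> \<in> ?c \<alpha>. ?c \<beta> \<noteq> ?c \<alpha>} = {\<beta> \<in> ?c \<alpha>. \<exists>v\<in>carrier_simplex \<alpha>. \<beta> v = 0}" if \<alpha>: "\<alpha> \<in> ?Z" for \<alpha>
  proof -
    have "?c \<beta> \<noteq> ?c \<alpha> \<longleftrightarrow> (\<exists>v\<in>carrier_simplex \<alpha>. \<beta> v = 0)" if \<beta>: "\<beta> \<in> ?c \<alpha>" for \<beta>
    proof
      assume "?c \<beta> \<noteq> ?c \<alpha>"
      then have "carrier_simplex \<beta> \<noteq> carrier_simplex \<alpha>" by auto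
      then show "\<exists>v\<in>carrier_simplex \<alpha>. \<beta> v = 0"
        using carrier_simplex_subset[OF \<beta>] by (auto simp: carrier_simplex_def)
    next
      assume "\<exists>v\<in>carrier_simplex \<alpha>. \<beta> v = 0"
      then obtain v where v: "v \<in> carrier_simplex \<alpha>" "\<beta> v = 0" by blast
      have "vertex v \<in> ?c \<alpha>" using v(1) fin[OF \<alpha>] by (auto simp: geom_simplex_def vertex_def)
      moreover have "vertex v \<notin> ?c \<beta>" using v(2) by (auto simp: geom_simplex_def vertex_def carrier_simplex_def)
      ultimately show "?c \<beta> \<noteq> ?c \<alpha>" by blast
    qed
    then show ?thesis by blast
  qed
  have cell: "cell_like (card (carrier_simplex \<alpha>) - 1) (?c \<alpha>) {\<beta> \<in> ?c \<alpha>. ?c \<beta> \<noteq> ?c \<alpha>}" if \<alpha>: "\<alpha> \<in> ?Z" for \<alpha>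
    unfolding bd[OF \<alpha>]
    using geom_simplex_cell_like fin[OF \<alpha>] order_complexD(3)[OF order_points_carrier(1)[OF \<alpha>]] by blast
  have self: "\<alpha> \<in> ?c \<alpha>" if "\<alpha> \<in> ?Z" for \<alpha> using order_points_carrier(2)[OF that] .
  have sub_simplex: "subtopology ?X (geom_simplex s) = top_of_set (geom_simplex s)" if "s \<in> order_complex P" for s
    using subtopology_poset_realization_finite[of s P] order_complexD(1,2)[OF that] order_points_chain[OF that] by simp
  have id: "continuous_map (top_of_set (?c \<alpha>)) (subtopology ?X UNIV) id" if "\<alpha> \<in> ?Z" for \<alpha>
    unfolding sub_simplex[OF order_points_carrier(1)[OF that], symmetric]
    by (simp add: continuous_map_from_subtopology)
  have null': "sphere_null j (subtopology ?X UNIV)" for j using null by simp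
  obtain H where H: "\<And>\<alpha>. \<alpha> \<in> ?Z \<Longrightarrow> continuous_map (top_of_set ({0..1::real} \<times> ?c \<alpha>)) (subtopology ?X UNIV) H"
    and H0: "\<And>\<alpha>. \<alpha> \<in> ?Z \<Longrightarrow> H (0, \<alpha>) = id \<alpha>" and H1: "\<And>\<alpha>. \<alpha> \<in> ?Z \<Longrightarrow> H (1, \<alpha>) = y0"
    by (rule cellwise_null_homotopy[of ?Z ?c "\<lambda>\<alpha>. card (carrier_simplex \<alpha>) - 1" "\<lambda>_. UNIV" ?X id y0])
      (rule self sub fin_faces closed cell order_refl null' id UNIV_I y0 that | assumption)+
  let ?I = "top_of_set {0..1::real}"
  define C where "C = carrier_simplex ` ?Z"
  have C: "s \<in> order_complex P" if "s \<in> C" for s using that order_points_carrier(1) by (auto simp: C_def)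
  \<comment> \<open>Continuity on each closed prism suffices because the prisms are locally finite:
    a simplex meeting the open star of v has v as a vertex, so its vertices are among the finitely
    many elements comparable with v.\<close>
  have "continuous_map (prod_topology ?I ?X) ?X H"
  proof (rule pasting_lemma_locally_finite[where I = C and T = "\<lambda>s. {0..1} \<times> geom_simplex s" and f = "\<lambda>_. H"])
    fix p assume "p \<in> topspace (prod_topology ?I ?X)"
    then obtain t \<alpha> where p: "p = (t, \<alpha>)" "t \<in> {0..1}" "\<alpha> \<in> ?Z" by (auto simp: topspace_poset_realization)
    obtain v where v: "v \<in> P" "\<alpha> \<in> open_star P v" using order_points_in_open_star[OF p(3)] .
    show "\<exists>V. openin (prod_topology ?I ?X) V \<and> p \<in> V \<and> finite {s \<in> C. {0..1} \<times> geom_simplex s \<inter> V \<noteq> {}}"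
    proof (intro exI[of _ "{0..1} \<times> open_star P v"] conjI)
      show "openin (prod_topology ?I ?X) ({0..1} \<times> open_star P v)"
        by (simp add: openin_prod_Times_iff openin_open_star)
      show "p \<in> {0..1} \<times> open_star P v" using p v by simp
      show "finite {s \<in> C. {0..1} \<times> geom_simplex s \<inter> {0..1} \<times> open_star P v \<noteq> {}}"
      proof (rule finite_subset)
        show "finite (Pow {q \<in> P. q \<le> v \<or> v \<le> q})" using lf[OF v(1)] by simp
        show "{s \<in> C. {0..1} \<times> geom_simplex s \<inter> {0..1} \<times> open_star P v \<noteq> {}} \<subseteq> Pow {q \<in> P. q \<le> v \<or> v \<le> q}"
        proof (intro subsetI PowI)
          fix s q assume "s \<in> {s \<in> C. {0..1} \<times> geom_simplex s \<inter> {0..1} \<times> open_star P v \<noteq> {}}" and q: "q \<in> s"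
          then obtain \<beta> where s: "s \<in> C" "\<beta> \<in> geom_simplex s" "\<beta> \<in> open_star P v" by blast
          have "v \<in> s" using s(2,3) by (auto simp: geom_simplex_def open_star_def)
          then show "q \<in> {q \<in> P. q \<le> v \<or> v \<le> q}" using order_complexD(1,4)[OF C[OF s(1)]] q by blast
        qed
      qed
    qed
  next
    fix s assume s: "s \<in> C"
    have cs: "closedin ?X (geom_simplex s)"
    proof -
      have "geom_simplex s \<subseteq> ?Z" using C[OF s] by (auto simp: order_points_def)
      moreover have "?Z - geom_simplex s = ?Z \<inter> - geom_simplex s" by blast
      moreover have "open (- geom_simplex s)" using closed_geom_simplex[OF order_complexD(2)[OF C[OF s]]] by auto
      ultimately show ?thesis
        unfolding closedin_def topspace_poset_realization using openin_poset_realization_Int by metis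
    qed
    then show "closedin (prod_topology ?I ?X) ({0..1} \<times> geom_simplex s)"
      by (simp add: closedin_prod_Times_iff)
    obtain \<alpha> where \<alpha>: "\<alpha> \<in> ?Z" "s = carrier_simplex \<alpha>" using s by (auto simp: C_def)
    have "subtopology (prod_topology ?I ?X) ({0..1} \<times> geom_simplex s)
        = prod_topology (subtopology ?I {0..1}) (subtopology ?X (geom_simplex s))"
      by (simp add: subtopology_Times)
    also have "\<dots> = top_of_set ({0..1} \<times> geom_simplex s)"
      by (simp add: sub_simplex[OF C[OF s]] subtopology_subtopology)
    finally show "continuous_map (subtopology (prod_topology ?I ?X) ({0..1} \<times> geom_simplex s)) ?X H"
      using H[OF \<alpha>(1)] \<alpha>(2) by simp
  next
    fix p assume "p \<in> topspace (prod_topology ?I ?X)"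
    then show "\<exists>s. s \<in> C \<and> p \<in> {0..1} \<times> geom_simplex s \<and> H p = H p"
      using self by (auto simp: topspace_poset_realization C_def)
  qed simp
  then have "homotopic_with (\<lambda>_. True) ?X ?X id (\<lambda>_. y0)"
    by (subst homotopic_with) (use H0 H1 in \<open>auto simp: topspace_poset_realization\<close>)
  then show ?thesis using y0 by (auto simp: contractible_nonempty_def contractible_space_def)
qed

section \<open>The word metric and the Morse function\<close>

locale word_metric = group G for G (structure) +
  fixes A :: "'a set"
  assumes finite_A: "finite A" and A_carrier: "A \<subseteq> carrier G" and generate_A: "generate G A = carrier G"
begin

section \<open>Words, lengths and finite balls\<close>

abbreviation letters :: "'a set" where
  "letters \<equiv> A \<union> m_inv G ` A"

lemma letters_carrier: "letters \<subseteq> carrier G"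
  using A_carrier by auto

lemma foldr_mult_closed: "set ws \<subseteq> carrier G \<Longrightarrow> foldr (\<otimes>) ws \<one> \<in> carrier G"
  by (induction ws) auto

lemma foldr_mult_append:
  "set us \<subseteq> carrier G \<Longrightarrow> set vs \<subseteq> carrier G \<Longrightarrow>
    foldr (\<otimes>) (us @ vs) \<one> = foldr (\<otimes>) us \<one> \<otimes> foldr (\<otimes>) vs \<one>"
  by (induction us) (auto simp: foldr_mult_closed m_assoc simp del: foldr_append)

text \<open>Inverses of generators are letters, and products correspond to concatenations. This
  makes the \<open>LEAST\<close> in \<open>word_length\<close> a genuine minimum.\<close>

lemma word_exists:
  assumes "g \<in> carrier G"
  shows "\<exists>ws. set ws \<subseteq> letters \<and> foldr (\<otimes>) ws \<one> = g"
proof -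
  have "g \<in> generate G A" using assms generate_A by simp
  then show ?thesis
  proof (induction rule: generate.induct)
    case one
    show ?case by (intro exI[of _ "[]"]) auto
  next
    case (incl h)
    then show ?case using A_carrier by (intro exI[of _ "[h]"]) auto
  next
    case (inv h)
    then show ?case using A_carrier by (intro exI[of _ "[inv h]"]) auto
  next
    case (eng h1 h2)
    then obtain us vs where us: "set us \<subseteq> letters" "foldr (\<otimes>) us \<one> = h1"
      and vs: "set vs \<subseteq> letters" "foldr (\<otimes>) vs \<one> = h2"
      by blast
    have "foldr (\<otimes>) (us @ vs) \<one> = h1 \<otimes> h2"
      using foldr_mult_append[OF order_trans[OF us(1) letters_carrier] order_trans[OF vs(1) letters_carrier]]
      by (simp only: us vs)
    moreover have "set (us @ vs) \<subseteq> letters" using us vs by simp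
    ultimately show ?case by blast
  qed
qed

lemma word_length_attained:
  assumes "g \<in> carrier G"
  obtains ws where "length ws = word_length G A g" "set ws \<subseteq> letters" "foldr (\<otimes>) ws \<one> = g"
proof -
  have "\<exists>k. \<exists>ws. length ws = k \<and> set ws \<subseteq> letters \<and> foldr (\<otimes>) ws \<one> = g"
    using word_exists[OF assms] by blast
  then have "\<exists>ws. length ws = word_length G A g \<and> set ws \<subseteq> letters \<and> foldr (\<otimes>) ws \<one> = g"
    unfolding word_length_def by (rule LeastI_ex)
  then show thesis using that by blast
qed

lemma word_length_le: "set ws \<subseteq> letters \<Longrightarrow> word_length G A (foldr (\<otimes>) ws \<one>) \<le> length ws"
  unfolding word_length_def by (rule Least_le) blast

lemma word_length_one: "word_length G A \<one> = 0"
  using word_length_le[of "[]"] by simp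

lemma word_length_mult_le:
  assumes "g \<in> carrier G" "h \<in> carrier G"
  shows "word_length G A (g \<otimes> h) \<le> word_length G A g + word_length G A h"
proof -
  obtain us where us: "length us = word_length G A g" "set us \<subseteq> letters" "foldr (\<otimes>) us \<one> = g"
    using word_length_attained[OF assms(1)] .
  obtain vs where vs: "length vs = word_length G A h" "set vs \<subseteq> letters" "foldr (\<otimes>) vs \<one> = h"
    using word_length_attained[OF assms(2)] .
  have "foldr (\<otimes>) (us @ vs) \<one> = g \<otimes> h"
    using foldr_mult_append[OF order_trans[OF us(2) letters_carrier] order_trans[OF vs(2) letters_carrier]]
    by (simp only: us vs)
  then show ?thesis using word_length_le[of "us @ vs"] us vs by (simp del: foldr_append)
qed

lemma finite_word_ball: "finite {g \<in> carrier G. word_length G A g \<le> k}"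
proof (rule finite_subset)
  show "finite ((\<lambda>ws. foldr (\<otimes>) ws \<one>) ` {ws. set ws \<subseteq> letters \<and> length ws \<le> k})"
    using finite_A by (intro finite_imageI finite_lists_length_le) auto
  show "{g \<in> carrier G. word_length G A g \<le> k} \<subseteq> (\<lambda>ws. foldr (\<otimes>) ws \<one>) ` {ws. set ws \<subseteq> letters \<and> length ws \<le> k}"
  proof
    fix g assume g: "g \<in> {g \<in> carrier G. word_length G A g \<le> k}"
    then obtain ws where "length ws = word_length G A g" "set ws \<subseteq> letters" "foldr (\<otimes>) ws \<one> = g"
      using word_length_attained[of g] by auto
    then show "g \<in> (\<lambda>ws. foldr (\<otimes>) ws \<one>) ` {ws. set ws \<subseteq> letters \<and> length ws \<le> k}" using g by force
  qed
qed

lemma len_eq: "g \<in> carrier G \<Longrightarrow> len G A g = word_length G A (inv g)"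
  by (simp add: len_def word_dist_def)

lemma len_one: "len G A \<one> = 0"
  by (simp add: len_eq word_length_one)

lemma finite_len_ball: "finite {g \<in> carrier G. len G A g \<le> k}"
proof (rule finite_subset)
  show "finite (m_inv G ` {g \<in> carrier G. word_length G A g \<le> k})" using finite_word_ball by simp
  show "{g \<in> carrier G. len G A g \<le> k} \<subseteq> m_inv G ` {g \<in> carrier G. word_length G A g \<le> k}"
  proof
    fix g assume "g \<in> {g \<in> carrier G. len G A g \<le> k}"
    then have "g = inv (inv g)" "inv g \<in> {g \<in> carrier G. word_length G A g \<le> k}" by (auto simp: len_eq)
    then show "g \<in> m_inv G ` {g \<in> carrier G. word_length G A g \<le> k}" by blast
  qed
qed

lemma len_triangle:
  assumes "g \<in> carrier G" "h \<in> carrier G"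
  shows "len G A g \<le> word_dist G A g h + len G A h"
proof -
  have "inv g = (inv g \<otimes> h) \<otimes> inv h" using assms by (simp add: m_assoc)
  then have "len G A g = word_length G A ((inv g \<otimes> h) \<otimes> inv h)" using assms by (simp add: len_eq)
  also have "\<dots> \<le> word_length G A (inv g \<otimes> h) + word_length G A (inv h)"
    using assms by (intro word_length_mult_le) auto
  finally show ?thesis using assms by (simp add: word_dist_def len_eq)
qed

section \<open>Diameter, minimal length and finite sublevels\<close>

lemma finite_word_dists:
  assumes "finite S"
  shows "finite {word_dist G A g g' |g g'. g \<in> S \<and> g' \<in> S}"
  using assms by (intro finite_image_set2) auto

lemma word_dist_le_diam:
  assumes "finite S" "g \<in> S" "h \<in> S"
  shows "word_dist G A g h \<le> word_diam G A S"
  unfolding word_diam_def by (rule Max_ge[OF finite_word_dists[OF assms(1)]]) (use assms in blast)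

lemma word_diam_mono:
  assumes "finite S" "R \<subseteq> S" "R \<noteq> {}"
  shows "word_diam G A R \<le> word_diam G A S"
  unfolding word_diam_def by (rule Max_mono[OF _ _ finite_word_dists[OF assms(1)]]) (use assms in blast)+

lemma len_min_le: "finite S \<Longrightarrow> g \<in> S \<Longrightarrow> len_min G A S \<le> len G A g"
  by (simp add: len_min_def)

lemma len_min_attained:
  assumes "finite S" "S \<noteq> {}"
  obtains g where "g \<in> S" "len G A g = len_min G A S"
  using Min_in[of "len G A ` S"] assms unfolding len_min_def by (metis finite_imageI image_iff image_is_empty)

lemma len_min_antimono: "finite S \<Longrightarrow> R \<subseteq> S \<Longrightarrow> R \<noteq> {} \<Longrightarrow> len_min G A S \<le> len_min G A R"
  unfolding len_min_def by (intro Min_antimono) auto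

lemma VR_posetD:
  assumes "S \<in> VR_poset G A t"
  shows "S \<subseteq> carrier G" "finite S" "S \<noteq> {}" "real (word_diam G A S) \<le> t"
  using assms by (auto simp: VR_poset_def)

lemma VR_poset_subset:
  assumes "S \<in> VR_poset G A t" "R \<subseteq> S" "R \<noteq> {}"
  shows "R \<in> VR_poset G A t"
  using VR_posetD[OF assms(1)] word_diam_mono[of S R] assms(2,3) finite_subset
  unfolding VR_poset_def by force

text \<open>These are the finite stages. Passing to a larger set cannot increase the minimal length,
  so together with S a sublevel contains all larger members of the complex, in particular all of
  \<open>D_poset\<close>.\<close>

definition VR_sublevel :: "real \<Rightarrow> nat \<Rightarrow> 'a set set" where
  "VR_sublevel t N = {S \<in> VR_poset G A t. len_min G A S \<le> N}"

text \<open>A member contains an element of length at most N and has diameter at most t, so by the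
  triangle inequality it lies in the finite ball of radius floor(t) + N.\<close>

lemma finite_VR_sublevel: "finite (VR_sublevel t N)"
proof (rule finite_subset)
  show "finite (Pow {g \<in> carrier G. len G A g \<le> nat \<lfloor>t\<rfloor> + N})" using finite_len_ball by simp
  show "VR_sublevel t N \<subseteq> Pow {g \<in> carrier G. len G A g \<le> nat \<lfloor>t\<rfloor> + N}"
  proof (intro subsetI PowI CollectI conjI)
    fix S g assume S: "S \<in> VR_sublevel t N" and g: "g \<in> S"
    then have V: "S \<in> VR_poset G A t" "len_min G A S \<le> N" by (auto simp: VR_sublevel_def)
    note V' = VR_posetD[OF V(1)]
    show gc: "g \<in> carrier G" using V' g by blast
    obtain h where h: "h \<in> S" "len G A h = len_min G A S" using len_min_attained V' by blast
    have "real (word_dist G A g h) \<le> t"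
      using word_dist_le_diam[OF V'(2) g h(1)] V'(4) by linarith
    then have "word_dist G A g h \<le> nat \<lfloor>t\<rfloor>" by linarith
    then show "len G A g \<le> nat \<lfloor>t\<rfloor> + N" using len_triangle[of g h] gc V'(1) h V(2) by fastforce
  qed
qed

lemma D_poset_sublevel:
  assumes "S \<in> VR_sublevel t N"
  shows "D_poset G A t S \<subseteq> VR_sublevel t N"
  using assms by (auto simp: D_poset_def VR_sublevel_def VR_poset_def)

lemma finite_D_poset: "S \<in> VR_poset G A t \<Longrightarrow> finite (D_poset G A t S)"
  using finite_subset[OF D_poset_sublevel finite_VR_sublevel, of S t "len_min G A S"]
  by (simp add: VR_sublevel_def)

lemma one_in_VR_poset: "0 \<le> t \<Longrightarrow> {\<one>} \<in> VR_poset G A t"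
  by (simp add: VR_poset_def word_diam_def word_dist_def word_length_one)

text \<open>The Morse function is \<open>S \<mapsto> (len_min S, card S)\<close>, in lexicographic order. Below \<open>S\<close> the
  descending link is the boundary of the simplex \<open>S\<close> if \<open>len\<close> is constant on \<open>S\<close>, and otherwise
  consists of the proper subsets meeting the set of elements of minimal length; above \<open>S\<close> it is \<open>D_poset\<close>.\<close>

lemma conn_upto_VR_sublevel:
  assumes t: "0 \<le> t"
    and D: "\<And>S. S \<in> VR_poset G A t \<Longrightarrow> S \<noteq> {\<one>} \<Longrightarrow> len G A constant_on S \<Longrightarrow>
      conn_upto (n - int (card S)) (D_complex G A t S)"
  shows "conn_upto n (top_of_set (order_points (VR_sublevel t N)))"
proof -
  let ?P = "VR_sublevel t N"
  have finP: "finite ?P" by (rule finite_VR_sublevel)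
  have P: "S \<subseteq> carrier G" "finite S" "S \<noteq> {}" "S \<in> VR_poset G A t" "len_min G A S \<le> N" if "S \<in> ?P" for S
    using that VR_posetD[of S t] unfolding VR_sublevel_def by blast+
  \<comment> \<open>B exceeds every cardinality that occurs, so \<open>\<rho>\<close> packs the
    lexicographic order into one number.\<close>
  obtain B where B: "\<And>S. S \<in> ?P \<Longrightarrow> card S < B"
    using finite_nat_set_iff_bounded[of "card ` ?P"] finP by auto
  define \<rho> where "\<rho> = (\<lambda>S. len_min G A S * B + card S)"
  have \<rho>_less: "\<rho> R < \<rho> S \<longleftrightarrow> len_min G A R < len_min G A S \<or> len_min G A R = len_min G A S \<and> card R < card S"
    if RS: "R \<in> ?P" "S \<in> ?P" for R S
  proof -
    have lex: "\<rho> R < \<rho> S" if "len_min G A R < len_min G A S" "R \<in> ?P" for R S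
    proof -
      have "\<rho> R < len_min G A R * B + B" using B[OF that(2)] by (simp add: \<rho>_def)
      also have "\<dots> = Suc (len_min G A R) * B" by simp
      also have "\<dots> \<le> len_min G A S * B" using that by (intro mult_le_mono1) simp
      finally show ?thesis by (simp add: \<rho>_def)
    qed
    consider "len_min G A R < len_min G A S" | "len_min G A R = len_min G A S" | "len_min G A S < len_min G A R"
      by linarith
    then show ?thesis
    proof cases
      case 1 then show ?thesis using lex RS by blast
    next
      case 2 then show ?thesis by (simp add: \<rho>_def)
    next
      case 3 then show ?thesis using lex[of S R] RS by auto
    qed
  qed
  have one: "{\<one>} \<in> ?P" "len_min G A {\<one>} = 0"
    using one_in_VR_poset[OF t] by (auto simp: VR_sublevel_def len_min_def len_one)
  show ?thesis
  proof (rule conn_upto_filtration[where \<rho> = \<rho>, OF finP])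
    show "{{\<one>}} \<subseteq> ?P" using one by simp
    show "conn_upto n (top_of_set (order_points {{\<one>}}))"
      by (rule cone_conn_upto[where p = "{\<one>}"]) auto
    show "\<rho> R \<noteq> \<rho> S" if "R \<in> ?P - {{\<one>}}" "S \<in> ?P - {{\<one>}}" "R < S" for R S
    proof -
      have RS: "R \<in> ?P" "S \<in> ?P" "R \<subset> S" using that by auto
      have "card R < card S" using RS P(2) psubset_card_mono by blast
      then have "\<rho> R < \<rho> S \<or> \<rho> S < \<rho> R" using \<rho>_less[OF RS(1,2)] \<rho>_less[OF RS(2,1)] by linarith
      then show ?thesis by auto
    qed
  next
    fix S assume S: "S \<in> ?P - {{\<one>}}"
    then have SP: "S \<in> ?P" and S1: "S \<noteq> {\<one>}" by auto
    note S' = P[OF SP]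
    let ?D = "D_poset G A t S"
    define M where "M = {g \<in> S. len G A g = len_min G A S}"
    have M: "M \<subseteq> S" "M \<noteq> {}" using len_min_attained[OF S'(2,3)] by (auto simp: M_def)
    have len_min_eq: "len_min G A R = len_min G A S \<longleftrightarrow> R \<inter> M \<noteq> {}" if R: "R \<subseteq> S" "R \<noteq> {}" for R
    proof
      have fR: "finite R" using R S'(2) finite_subset by blast
      show "R \<inter> M \<noteq> {}" if "len_min G A R = len_min G A S"
        using len_min_attained[OF fR R(2)] that R(1) by (auto simp: M_def)
      show "len_min G A R = len_min G A S" if RM: "R \<inter> M \<noteq> {}"
      proof -
        obtain g where "g \<in> R" "len G A g = len_min G A S" using RM by (auto simp: M_def)
        then have "len_min G A R \<le> len_min G A S" using len_min_le[OF fR] by metis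
        then show ?thesis using len_min_antimono[OF S'(2) R] by simp
      qed
    qed
    have link: "{R \<in> ?P. (R < S \<or> S < R) \<and> (R \<in> {{\<one>}} \<or> \<rho> R < \<rho> S)} = {U. U \<subset> S \<and> U \<inter> M \<noteq> {}} \<union> ?D"
      (is "?L = ?R")
    proof (intro equalityI subsetI)
      fix R assume "R \<in> ?L"
      then have R: "R \<in> ?P" "R \<subset> S \<or> S \<subset> R" "R = {\<one>} \<or> \<rho> R < \<rho> S" by auto
      note R' = P[OF R(1)]
      show "R \<in> ?R"
      proof (cases "R \<subset> S")
        case True
        \<comment> \<open>Below S the minimal length cannot decrease, so a descending R has the same
          one, that is, it meets M; for R = {1} this holds since its minimal length is 0.\<close>
        have "len_min G A S \<le> len_min G A R" using len_min_antimono[OF S'(2), of R] True R'(3) by blast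
        moreover have "len_min G A R \<le> len_min G A S" using R(3) one(2) \<rho>_less[OF R(1) SP] by auto
        ultimately show ?thesis using len_min_eq[of R] True R'(3) by auto
      next
        case False
        then have SR: "S \<subset> R" using R(2) by blast
        then have "R \<noteq> {\<one>}" using S'(3) by blast
        then have "\<rho> R < \<rho> S" using R(3) by blast
        \<comment> \<open>Above S the cardinality grows, so only a drop of the minimal length makes
          R descending.\<close>
        moreover have "\<not> card R < card S" using psubset_card_mono[OF R'(2) SR] by linarith
        ultimately have "len_min G A R < len_min G A S" using \<rho>_less[OF R(1) SP] by blast
        then show ?thesis using SR R' VR_posetD[OF R'(4)] by (auto simp: D_poset_def)
      qed
    next
      fix R assume "R \<in> ?R"
      then show "R \<in> ?L"
      proof
        assume "R \<in> {U. U \<subset> S \<and> U \<inter> M \<noteq> {}}"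
        then have R: "R \<subset> S" "R \<noteq> {}" "R \<inter> M \<noteq> {}" by auto
        then have eq: "len_min G A R = len_min G A S" using len_min_eq[of R] by blast
        then have RP: "R \<in> ?P" using R VR_poset_subset[OF S'(4), of R] S'(5) by (auto simp: VR_sublevel_def)
        moreover have "card R < card S" by (rule psubset_card_mono[OF S'(2) R(1)])
        ultimately show "R \<in> ?L" using R(1) eq \<rho>_less[OF RP SP] by simp
      next
        assume R: "R \<in> ?D"
        then have RP: "R \<in> ?P" using D_poset_sublevel[OF SP] by blast
        moreover have "S \<subset> R" "len_min G A R < len_min G A S" using R by (auto simp: D_poset_def)
        ultimately show "R \<in> ?L" using \<rho>_less[OF RP SP] by simp
      qed
    qed
    have finD: "finite ?D" by (rule finite_D_poset[OF S'(4)])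
    have DS: "S \<subseteq> d" if "d \<in> ?D" for d using that by (auto simp: D_poset_def)
    show "conn_upto (n - 1) (top_of_set (order_points {R \<in> ?P. (R < S \<or> S < R) \<and> (R \<in> {{\<one>}} \<or> \<rho> R < \<rho> S)}))"
    proof (cases "M = S")
      case True
      then have "len G A constant_on S" unfolding constant_on_def M_def by blast
      then have "conn_upto (n - int (card S)) (top_of_set (order_points ?D))"
        using D[OF S'(4) S1] by (simp add: D_complex_def poset_realization_finite[OF finD])
      \<comment> \<open>The degrees given up to |S| in the hypothesis are regained from the join
        with the boundary of S.\<close>
      then have "conn_upto (n - int (card S) + int (card S) - 1)
          (top_of_set (order_points ({U. U \<subset> S \<and> U \<noteq> {}} \<union> ?D)))"
        using conn_upto_boundary_join[OF S'(2,3) finD] DS by blast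
      moreover have "{U. U \<subset> S \<and> U \<inter> M \<noteq> {}} = {U. U \<subset> S \<and> U \<noteq> {}}" using True by blast
      ultimately show ?thesis unfolding link by simp
    next
      case False
      then show ?thesis unfolding link
        using M by (intro conn_upto_subsets_meeting S'(2) finD DS) auto
    qed
  qed
qed

text \<open>Comparable non-empty sets share an element, whose length bounds the minimal length of S;
  the sum of all lengths over all members of F is a crude bound that works for every T.\<close>

lemma comparable_VR_sublevel:
  assumes "finite F" "F \<subseteq> VR_poset G A t"
  obtains N where "{S \<in> VR_poset G A t. \<exists>T\<in>F. S \<subseteq> T \<or> T \<subseteq> S} \<subseteq> VR_sublevel t N"
proof
  let ?N = "\<Sum>T\<in>F. \<Sum>g\<in>T. len G A g"
  show "{S \<in> VR_poset G A t. \<exists>T\<in>F. S \<subseteq> T \<or> T \<subseteq> S} \<subseteq> VR_sublevel t ?N"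
  proof clarify
    fix S T assume S: "S \<in> VR_poset G A t" and T: "T \<in> F" "S \<subseteq> T \<or> T \<subseteq> S"
    have TV: "T \<in> VR_poset G A t" using T(1) assms(2) by blast
    note S' = VR_posetD[OF S] and T' = VR_posetD[OF TV]
    obtain g where g: "g \<in> S" "g \<in> T" using T(2) S'(3) T'(3) by blast
    have "len_min G A S \<le> len G A g" by (rule len_min_le[OF S'(2) g(1)])
    also have "\<dots> \<le> (\<Sum>g\<in>T. len G A g)" by (rule member_le_sum[OF g(2) _ T'(2)]) simp
    also have "\<dots> \<le> ?N" by (rule member_le_sum[OF T(1) _ assms(1)]) simp
    finally show "S \<in> VR_sublevel t ?N" using S by (simp add: VR_sublevel_def)
  qed
qed

text \<open>The local finiteness under which weak contractibility is upgraded to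
  contractibility.\<close>

lemma VR_poset_locally_finite:
  assumes "S \<in> VR_poset G A t"
  shows "finite {R \<in> VR_poset G A t. R \<subseteq> S \<or> S \<subseteq> R}"
proof -
  obtain N where "{R \<in> VR_poset G A t. \<exists>T\<in>{S}. R \<subseteq> T \<or> T \<subseteq> R} \<subseteq> VR_sublevel t N"
    using comparable_VR_sublevel[of "{S}" t] assms by auto
  then show ?thesis using finite_subset[OF _ finite_VR_sublevel] by auto
qed

text \<open>A finite F and everything comparable with it lie in one finite sublevel, whose null
  property passes to the whole complex by compactness of the cube boundary.\<close>

lemma conn_upto_VR:
  assumes "0 \<le> t"
    and "\<And>S. S \<in> VR_poset G A t \<Longrightarrow> S \<noteq> {\<one>} \<Longrightarrow> len G A constant_on S \<Longrightarrow>
      conn_upto (n - int (card S)) (D_complex G A t S)"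
  shows "conn_upto n (VR G A t)"
  unfolding conn_upto_def VR_def
proof (intro allI impI sphere_null_exhaustion)
  fix j F assume j: "int j \<le> n" and F: "finite F" "F \<subseteq> VR_poset G A t"
  obtain N where N: "{S \<in> VR_poset G A t. \<exists>T\<in>F. S \<subseteq> T \<or> T \<subseteq> S} \<subseteq> VR_sublevel t N"
    by (rule comparable_VR_sublevel[OF F])
  have null: "sphere_null j (top_of_set (order_points (VR_sublevel t N)))"
    using conn_upto_VR_sublevel[OF assms, of N] j by (simp add: conn_upto_def)
  have "VR_sublevel t N \<subseteq> VR_poset G A t" by (auto simp: VR_sublevel_def)
  then show "\<exists>E. finite E \<and> E \<subseteq> VR_poset G A t \<and>
      {S \<in> VR_poset G A t. \<exists>T\<in>F. S \<subseteq> T \<or> T \<subseteq> S} \<subseteq> E \<and> sphere_null j (top_of_set (order_points E))"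
    by (intro exI[of _ "VR_sublevel t N"] conjI finite_VR_sublevel N null)
qed

end

theorem theorem1:
  fixes G :: "('a, 'b) monoid_scheme" and A :: "'a set" and t :: real and n :: int
  assumes "group G"
    and "finite A" and "A \<subseteq> carrier G" and "generate G A = carrier G"
    and "t \<ge> 0"
  shows "((\<forall>S. S \<subseteq> carrier G \<and> finite S \<and> S \<noteq> {} \<and> S \<noteq> {\<one>\<^bsub>G\<^esub>} \<and>
               real (word_diam G A S) \<le> t \<and> len G A constant_on S \<longrightarrow>
               k_connected (n - int (card S) - 1) (D_complex G A t S))
           \<longrightarrow> k_connected (n - 1) (VR G A t))
       \<and> ((\<forall>S. S \<subseteq> carrier G \<and> finite S \<and> S \<noteq> {} \<and> S \<noteq> {\<one>\<^bsub>G\<^esub>} \<and>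
               real (word_diam G A S) \<le> t \<and> len G A constant_on S \<longrightarrow>
               contractible_nonempty (D_complex G A t S))
           \<longrightarrow> contractible_nonempty (VR G A t))"
proof -
  interpret word_metric G A
    using assms by (simp add: word_metric_def word_metric_axioms_def)
  show ?thesis
  proof (intro conjI impI)
    assume D: "\<forall>S. S \<subseteq> carrier G \<and> finite S \<and> S \<noteq> {} \<and> S \<noteq> {\<one>\<^bsub>G\<^esub>} \<and>
               real (word_diam G A S) \<le> t \<and> len G A constant_on S \<longrightarrow>
               k_connected (n - int (card S) - 1) (D_complex G A t S)"
    have "conn_upto n (VR G A t)"
    proof (rule conn_upto_VR[OF assms(5)])
      fix S assume "S \<in> VR_poset G A t" "S \<noteq> {\<one>\<^bsub>G\<^esub>}" "len G A constant_on S"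
      then have "k_connected (n - int (card S) - 1) (D_complex G A t S)"
        using D VR_posetD[of S t] by blast
      then show "conn_upto (n - int (card S)) (D_complex G A t S)"
        by (simp add: k_connected_iff_conn_upto)
    qed
    then show "k_connected (n - 1) (VR G A t)" by (simp add: k_connected_iff_conn_upto)
  next
    assume D: "\<forall>S. S \<subseteq> carrier G \<and> finite S \<and> S \<noteq> {} \<and> S \<noteq> {\<one>\<^bsub>G\<^esub>} \<and>
               real (word_diam G A S) \<le> t \<and> len G A constant_on S \<longrightarrow>
               contractible_nonempty (D_complex G A t S)"
    \<comment> \<open>Contractible descending complexes meet the connectivity hypothesis for every
      integer m, so all maps of spheres into the complex are null homotopic.\<close>
    have "conn_upto m (VR G A t)" for m
    proof (rule conn_upto_VR[OF assms(5)])
      fix S assume "S \<in> VR_poset G A t" "S \<noteq> {\<one>\<^bsub>G\<^esub>}" "len G A constant_on S"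
      then have "contractible_nonempty (D_complex G A t S)"
        using D VR_posetD[of S t] by blast
      then show "conn_upto (m - int (card S)) (D_complex G A t S)"
        by (simp add: conn_upto_def sphere_null_contractible)
    qed
    then have "sphere_null j (poset_realization (VR_poset G A t))" for j
      unfolding conn_upto_def VR_def by blast
    then show "contractible_nonempty (VR G A t)"
      unfolding VR_def by (intro contractible_poset_realization VR_poset_locally_finite)
  qed
qed

end
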